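(* Let $P_{X_iY_i}$, $i\in[1:m]$, be distributions on $\mathcal X\times\mathcal Y$ (finite alphabets), let $\nu_i>0$ with $\sum_i\nu_i=1$, and let the source in the WAK problem be $P_{X^nY^n}=\sum_{i=1}^m\nu_iP_{X_iY_i}^{\otimes n}$. Let $P_{\mathcal X,1},\dots,P_{\mathcal X,|\mathcal P_{\mathcal X}|}$ be the distinct $\mathcal X$-marginals of the $P_{X_iY_i}$, and $\mathfrak F_s=\{i:P_{\mathcal X,s}\text{ is the }\mathcal X\text{-marginal of }P_{X_iY_i}\}$. For $i\in\mathfrak F_s$ set $$\xi_i(R_c)=\log|\mathcal Y|-\min_{P_{U|X}:\,I(X_s;U)\le R_c}H(Y_i|U).$$ Let $R_c>0$ and suppose that the separability condition of the context holds at $R_c$ and that $(\xi_i(R_c))_{i=1}^m$ is increasing, i.e. $\xi_1(R_c)\le\dots\le\xi_m(R_c)$. Then for every $\epsilon\in[0,1)$ the minimum $\epsilon$-achievable compression rate for $Y^n$ is $$R^\star_{2,\epsilon}(R_c)=\log|\mathcal Y|-\xi_i(R_c)\qquad\text{when}\quad\sum_{j=1}^{i-1}\nu_j\le\epsilon<\sum_{j=1}^{i}\nu_j .$$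
   Context: WAK (Wyner–Ahlswede–Körner) problem: $(X^n,Y^n)\sim P_{X^nY^n}$ on $\mathcal X^n\times\mathcal Y^n$. A WAK-code is a triple of maps $\phi_{1n}:\mathcal X^n\to\mathcal M_1$, $\phi_{2n}:\mathcal Y^n\to\mathcal M_2$, $\bar\psi_n:\mathcal M_1\times\mathcal M_2\to\mathcal Y^n$ with $\mathcal M_1,\mathcal M_2$ finite sets (depending on $n$), $|\phi_{1n}|:=|\mathcal M_1|$, $|\phi_{2n}|:=|\mathcal M_2|$, and $\hat Y^n=\bar\psi_n(\phi_{1n}(X^n),\phi_{2n}(Y^n))$. For $\epsilon\in[0,1)$, $\mathcal R_{\mathrm{WAK},\epsilon}$ is the closure of the set of pairs $(R_c,R_2)$ for which there is a sequence of WAK-codes with $\limsup_n\frac1n\log|\phi_{1n}|\le R_c$, $\limsup_n\frac1n\log|\phi_{2n}|\le R_2$, $\limsup_n\Pr\{\hat Y^n\ne Y^n\}\le\epsilon$; and $R^\star_{2,\epsilon}(R_c)=\inf\{R_2:(R_c,R_2)\in\mathcal R_{\mathrm{WAK},\epsilon}\}$. $\log$ is natural, $H$ and $I$ are entropy and mutual information in nats. Test channels: $X_s\sim P_{\mathcal X,s}$, $U$ (in a finite alphabet) is generated from $X_s$ through a kernel $P_{U|X}$, and for $i\in\mathfrak F_s$, $(X_s,Y_i)\sim P_{X_iY_i}$ with $Y_i-X_s-U$ Markov. Separability condition at $R_c$: let $\mathcal W_s(R_c)=\{P_{U|X}: I(X_s;U)=R_c\}$ and, for $i\in\mathfrak F_s$,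 let $\mathcal W_s^{(i)}(R_c)$ be the set of kernels in $\mathcal W_s(R_c)$ attaining the minimum of $H(Y_i|U)$ in $\xi_i(R_c)$. Let $\mathcal O_s(R_c)=\bigcap_{i\in\mathfrak F_s}\mathcal W_s^{(i)}(R_c)$ if this is nonempty, and $\mathcal O_s(R_c)=\bigcup_{i\in\mathfrak F_s}\mathcal W_s^{(i)}(R_c)$ otherwise. The condition requires that for every $s$ the ordering of the numbers $\log|\mathcal Y|-H(Y_i|U)$, $i\in\mathfrak F_s$, does not depend on the kernel in $\mathcal O_s(R_c)$: there is an enumeration $i_1,\dots,i_{|\mathfrak F_s|}$ of $\mathfrak F_s$ such that for all $P_{U|X}\in\mathcal O_s(R_c)$, $\log|\mathcal Y|-H(Y_{i_1}|U)\le\dots\le\log|\mathcal Y|-H(Y_{i_{|\mathfrak F_s|}}|U)$. *)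

theory Defs
  imports "HOL-Probability.Probability"
begin

section \<open>WAK codes and the achievable rate region\<close>

text \<open>A word in $\mathcal X^n$ is a list of length \<open>n\<close>. The finite message sets, which may vary with
  the blocklength, are taken inside \<^typ>\<open>nat\<close>; only their cardinalities matter.\<close>

record ('x, 'y) wak_code =
  msgs1 :: "nat set"
  msgs2 :: "nat set"
  enc1 :: "'x list \<Rightarrow> nat"
  enc2 :: "'y list \<Rightarrow> nat"
  dec :: "nat \<times> nat \<Rightarrow> 'y list"

definition is_wak_code :: "nat \<Rightarrow> ('x, 'y) wak_code \<Rightarrow> bool" where
  "is_wak_code n C \<longleftrightarrow>
     finite (msgs1 C) \<and> finite (msgs2 C) \<and>
     enc1 C \<in> {xs. length xs = n} \<rightarrow> msgs1 C \<and>
     enc2 C \<in> {ys. length ys = n} \<rightarrow> msgs2 C \<and>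
     dec C \<in> msgs1 C \<times> msgs2 C \<rightarrow> {ys. length ys = n}"

text \<open>The law of $(X^n, Y^n)$ is given as a distribution on words over $\mathcal X \times \mathcal Y$.\<close>

definition wak_error :: "('x \<times> 'y) list pmf \<Rightarrow> ('x, 'y) wak_code \<Rightarrow> real" where
  "wak_error p C =
     measure_pmf.prob p {z. dec C (enc1 C (map fst z), enc2 C (map snd z)) \<noteq> map snd z}"

definition wak_achievable :: "(nat \<Rightarrow> ('x \<times> 'y) list pmf) \<Rightarrow> real \<Rightarrow> real \<times> real \<Rightarrow> bool" where
  "wak_achievable S \<epsilon> = (\<lambda>(Rc, R2).
     \<exists>C. (\<forall>n. is_wak_code n (C n)) \<and>
       limsup (\<lambda>n. ereal (ln (card (msgs1 (C n))) / n)) \<le> ereal Rc \<and>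
       limsup (\<lambda>n. ereal (ln (card (msgs2 (C n))) / n)) \<le> ereal R2 \<and>
       limsup (\<lambda>n. ereal (wak_error (S n) (C n))) \<le> ereal \<epsilon>)"

definition wak_region :: "(nat \<Rightarrow> ('x \<times> 'y) list pmf) \<Rightarrow> real \<Rightarrow> (real \<times> real) set" where
  "wak_region S \<epsilon> = closure {R. wak_achievable S \<epsilon> R}"

definition wak_min_rate :: "(nat \<Rightarrow> ('x \<times> 'y) list pmf) \<Rightarrow> real \<Rightarrow> real \<Rightarrow> real" where
  "wak_min_rate S \<epsilon> Rc = Inf {R2. (Rc, R2) \<in> wak_region S \<epsilon>}"

section \<open>Test channels\<close>

text \<open>The alphabet of \<open>U\<close> is an arbitrary finite subset of \<^typ>\<open>nat\<close>; its size is not bounded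
  in advance.\<close>

definition test_kernel :: "('x \<Rightarrow> nat pmf) \<Rightarrow> bool" where
  "test_kernel K \<longleftrightarrow> finite (\<Union>x. set_pmf (K x))"

definition joint_XU :: "'x pmf \<Rightarrow> ('x \<Rightarrow> nat pmf) \<Rightarrow> ('x \<times> nat) pmf" where
  "joint_XU Q K = bind_pmf Q (\<lambda>x. map_pmf (\<lambda>u. (x, u)) (K x))"

text \<open>\<open>U\<close> is drawn from \<open>K x\<close> alone, so $Y - X - U$ is a Markov chain.\<close>

definition joint_XYU :: "('x \<times> 'y) pmf \<Rightarrow> ('x \<Rightarrow> nat pmf) \<Rightarrow> ('x \<times> 'y \<times> nat) pmf" where
  "joint_XYU P K = bind_pmf P (\<lambda>(x, y). map_pmf (\<lambda>u. (x, y, u)) (K x))"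

text \<open>Base \<open>exp 1\<close>: information is measured in nats.\<close>

definition mutual_info_XU :: "'x pmf \<Rightarrow> ('x \<Rightarrow> nat pmf) \<Rightarrow> real" where
  "mutual_info_XU Q K =
     prob_space.mutual_information (measure_pmf (joint_XU Q K)) (exp 1)
       (count_space UNIV) (count_space UNIV) fst snd"

definition cond_entropy_YU :: "('x \<times> 'y) pmf \<Rightarrow> ('x \<Rightarrow> nat pmf) \<Rightarrow> real" where
  "cond_entropy_YU P K =
     prob_space.conditional_entropy (measure_pmf (joint_XYU P K)) (exp 1)
       (count_space UNIV) (count_space UNIV) (\<lambda>(x, y, u). y) (\<lambda>(x, y, u). u)"

definition marginal_X :: "('x \<times> 'y) pmf \<Rightarrow> 'x pmf" where
  "marginal_X P = map_pmf fst P"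

definition admissible_kernels :: "'x pmf \<Rightarrow> real \<Rightarrow> ('x \<Rightarrow> nat pmf) set" where
  "admissible_kernels Q Rc = {K. test_kernel K \<and> mutual_info_XU Q K \<le> Rc}"

text \<open>\<open>LEAST\<close> is the minimum over the infinite set of admissible kernels.\<close>

definition \<xi> :: "('x \<times> 'y) pmf \<Rightarrow> real \<Rightarrow> real" where
  "\<xi> P Rc = ln (real CARD('y)) -
     (LEAST h. h \<in> cond_entropy_YU P ` admissible_kernels (marginal_X P) Rc)"

section \<open>Separability condition\<close>

text \<open>The distinct $\mathcal X$-marginals serve as their own indices \<open>s\<close>: the argument \<open>Q\<close> below is
  $P_{\mathcal X,s}$.\<close>

definition marginals_X :: "nat \<Rightarrow> (nat \<Rightarrow> ('x \<times> 'y) pmf) \<Rightarrow> 'x pmf set" where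
  "marginals_X m P = (\<lambda>i. marginal_X (P i)) ` {1..m}"

definition \<FF> :: "nat \<Rightarrow> (nat \<Rightarrow> ('x \<times> 'y) pmf) \<Rightarrow> 'x pmf \<Rightarrow> nat set" where
  "\<FF> m P Q = {i \<in> {1..m}. marginal_X (P i) = Q}"

definition \<W> :: "'x pmf \<Rightarrow> real \<Rightarrow> ('x \<Rightarrow> nat pmf) set" where
  "\<W> Q Rc = {K. test_kernel K \<and> mutual_info_XU Q K = Rc}"

definition \<W>_opt :: "('x \<times> 'y) pmf \<Rightarrow> real \<Rightarrow> ('x \<Rightarrow> nat pmf) set" where
  "\<W>_opt P Rc = {K \<in> \<W> (marginal_X P) Rc.
     is_arg_min (cond_entropy_YU P) (\<lambda>K'. K' \<in> admissible_kernels (marginal_X P) Rc) K}"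

definition \<O> :: "nat \<Rightarrow> (nat \<Rightarrow> ('x \<times> 'y) pmf) \<Rightarrow> 'x pmf \<Rightarrow> real \<Rightarrow> ('x \<Rightarrow> nat pmf) set" where
  "\<O> m P Q Rc =
     (if (\<Inter>i \<in> \<FF> m P Q. \<W>_opt (P i) Rc) \<noteq> {}
      then (\<Inter>i \<in> \<FF> m P Q. \<W>_opt (P i) Rc)
      else (\<Union>i \<in> \<FF> m P Q. \<W>_opt (P i) Rc))"

definition separable :: "nat \<Rightarrow> (nat \<Rightarrow> ('x \<times> 'y) pmf) \<Rightarrow> real \<Rightarrow> bool" where
  "separable m P Rc \<longleftrightarrow>
     (\<forall>Q \<in> marginals_X m P. \<exists>js. distinct js \<and> set js = \<FF> m P Q \<and>
        (\<forall>K \<in> \<O> m P Q Rc.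
           sorted (map (\<lambda>i. ln (real CARD('y)) - cond_entropy_YU (P i) K) js)))"

end

theory Submission
  imports Defs "HOL-Real_Asymp.Real_Asymp"
begin

text \<open>A helper of rate \<open>Rc\<close> reduces the rate for source \<open>i\<close> alone to
  \<open>h\<^sub>i = min H(Y\<^sub>i|U)\<close> over \<open>I(X;U) \<le> Rc\<close>, and below \<open>h\<^sub>i\<close> the error tends to one. A code for the mixture
  with error \<open>\<epsilon>\<close> may give up on sources of total weight at most \<open>\<epsilon>\<close>, that is, on the most expensive
  ones, so that its rate is the largest of the remaining \<open>h\<^sub>i\<close>.

  Strong converse: condition the law of \<open>(X\<^sup>n, Y\<^sup>n)\<close> on the event of correct decoding. If that event
  has probability bounded away from zero, the conditioned law is within bounded divergence of the
  product law, and the usual single-letterisation gives a triple \<open>(X, Y, U)\<close> for which \<open>(X, Y) \<sim> P\<close>,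
  the Markov property and the rate constraints hold up to \<open>O(1/n)\<close>. The corresponding points
  \<open>(P\<^sub>X\<^sub>Y, H(X|U), H(Y|U), H(X,Y|U))\<close> lie in the convex hull of a compact set, so a limit point exists
  and satisfies all constraints exactly. The same compactness shows that the minimum \<open>h\<^sub>i\<close> is attained.

  Achievability: the helper guesses the marginal of \<open>X\<close> and covers \<open>x\<close> by a codeword of a kernel that
  depends only on that marginal. Separability provides one kernel that is good enough for all
  sources with this marginal that have to be decoded. The other encoder bins.\<close>


section \<open>Entropy of finitely supported random variables\<close>

text \<open>A weak converse would not do for a mixture. An error close to \<epsilon> only shows that
  one of the sources 1..i, possibly a different one for each n, has error bounded away from one; its
  error need not be small. Conditioning on correct decoding destroys both the independence over time
  and the Markov chain Y - X - U. The limit is therefore taken in a larger set without the Markov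
  constraint. It is a convex hull in a finite-dimensional space, so the alphabet of U may grow with
  n without harm. What was lost is recovered at the limit point, since the law P and the Markov
  property are both equality cases of Gibbs' inequality, and the inequalities that force them
  survive limits. Achievability is a one-shot bound whose error terms decay exponentially. This
  leaves room to divide one of them by a threshold that itself tends to zero, so that errors of the
  sources to be decoded vanish under a single code.\<close>

abbreviation (input) expct :: "'a pmf \<Rightarrow> ('a \<Rightarrow> real) \<Rightarrow> real" where
  "expct p f \<equiv> measure_pmf.expectation p f"

text \<open>Joint entropies are entropies of pair-valued functions, and conditional entropies are
  written as differences, so that \<open>ent\<close> alone carries all information measures.\<close>

definition ent :: "'a pmf \<Rightarrow> ('a \<Rightarrow> 'b) \<Rightarrow> real" where
  "ent p f = expct p (\<lambda>z. - ln (pmf (map_pmf f p) (f z)))"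

section \<open>Gibbs' inequality and its equality case\<close>

lemma expectation_mono_pmf:
  fixes f g :: "'a \<Rightarrow> real"
  assumes "finite (set_pmf p)" "\<And>z. z \<in> set_pmf p \<Longrightarrow> f z \<le> g z"
  shows "expct p f \<le> expct p g"
  using assms
  by (intro integral_mono_AE) (auto simp: integrable_measure_pmf_finite AE_measure_pmf_iff)

lemma expectation_cong_pmf:
  fixes f g :: "'a \<Rightarrow> real"
  assumes "\<And>z. z \<in> set_pmf p \<Longrightarrow> f z = g z"
  shows "expct p f = expct p g"
  using assms by (intro integral_cong_AE) (auto simp: AE_measure_pmf_iff)

text \<open>Jensen's inequality for \<open>ln\<close>, from \<open>ln t \<le> t - 1\<close>. With a
  likelihood ratio for \<open>r\<close> it is the nonnegativity of divergence.\<close>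

lemma expectation_ln_le_0:
  assumes fin: "finite (set_pmf p)" and pos: "\<And>z. z \<in> set_pmf p \<Longrightarrow> r z > (0::real)"
    and le: "expct p r \<le> 1"
  shows "expct p (\<lambda>z. ln (r z)) \<le> 0"
proof -
  have "expct p (\<lambda>z. ln (r z)) \<le> expct p (\<lambda>z. r z - 1)"
    using fin pos by (intro expectation_mono_pmf) (auto simp: ln_le_minus_one)
  also have "\<dots> = expct p r - 1"
    using fin by (simp add: integrable_measure_pmf_finite)
  finally show ?thesis using le by simp
qed

text \<open>The function \<open>r - 1 - ln r\<close> is nonnegative with mean at most zero, so it
  vanishes on the support; this forces \<open>r = 1\<close> there.\<close>

lemma expectation_ln_eq_0_imp:
  assumes fin: "finite (set_pmf p)" and pos: "\<And>z. z \<in> set_pmf p \<Longrightarrow> r z > (0::real)"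
    and le: "expct p r \<le> 1"
    and ge: "expct p (\<lambda>z. ln (r z)) \<ge> 0"
    and z: "z \<in> set_pmf p"
  shows "r z = 1"
proof -
  have "expct p (\<lambda>z. r z - 1 - ln (r z)) \<le> 0"
    using fin le ge by (simp add: integrable_measure_pmf_finite)
  moreover have "expct p (\<lambda>z. r z - 1 - ln (r z))
     = (\<Sum>z\<in>set_pmf p. (r z - 1 - ln (r z)) * pmf p z)"
    using fin by (intro integral_measure_pmf_real) auto
  moreover have nn: "(r z - 1 - ln (r z)) * pmf p z \<ge> 0" if "z \<in> set_pmf p" for z
    using ln_le_minus_one[OF pos[OF that]] by (intro mult_nonneg_nonneg) auto
  ultimately have "(\<Sum>z\<in>set_pmf p. (r z - 1 - ln (r z)) * pmf p z) = 0"
    by (intro antisym sum_nonneg) auto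
  then have "(r z - 1 - ln (r z)) * pmf p z = 0"
    using nn fin z by (subst (asm) sum_nonneg_eq_0_iff) auto
  then have "ln (r z) = r z - 1" using z by (auto simp: set_pmf_iff)
  then show ?thesis using ln_eq_minus_one pos z by blast
qed

lemma pmf_map_pos:
  "z \<in> set_pmf p \<Longrightarrow> pmf (map_pmf f p) (f z) > 0"
  by (simp add: pmf_positive_iff)

text \<open>The mean of a likelihood ratio is the mass that \<open>q\<close> puts on the range of
  \<open>f\<close>. Hence Gibbs' inequality holds for every \<open>q\<close> of mass at most one on
  that range.\<close>

lemma expectation_div_image_pmf:
  fixes q :: "'b \<Rightarrow> real"
  assumes fin: "finite (set_pmf p)"
  shows "expct p (\<lambda>z. q (f z) / pmf (map_pmf f p) (f z)) = (\<Sum>w\<in>f ` set_pmf p. q w)"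
proof -
  have "expct p (\<lambda>z. q (f z) / pmf (map_pmf f p) (f z))
     = expct (map_pmf f p) (\<lambda>w. q w / pmf (map_pmf f p) w)"
    by simp
  also have "\<dots> = (\<Sum>w\<in>f ` set_pmf p. q w / pmf (map_pmf f p) w * pmf (map_pmf f p) w)"
    using fin by (intro integral_measure_pmf_real) auto
  also have "\<dots> = (\<Sum>w\<in>f ` set_pmf p. q w)"
    by (intro sum.cong refl) (use pmf_map_pos[of _ p f] in force)
  finally show ?thesis .
qed

text \<open>Gibbs' inequality. Upper bounds on entropies come from a choice of \<open>q\<close>:
  uniform, with a resampled component, or a product law.\<close>

lemma ent_le_cross:
  assumes fin: "finite (set_pmf p)" and pos: "\<And>z. z \<in> set_pmf p \<Longrightarrow> q (f z) > (0::real)"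
    and le: "(\<Sum>w\<in>f ` set_pmf p. q w) \<le> 1"
  shows "ent p f \<le> expct p (\<lambda>z. - ln (q (f z)))"
proof -
  have "expct p (\<lambda>z. ln (q (f z) / pmf (map_pmf f p) (f z))) \<le> 0"
    using pos by (intro expectation_ln_le_0 fin) 
      (auto simp: expectation_div_image_pmf[OF fin] le pmf_map_pos)
  also have "expct p (\<lambda>z. ln (q (f z) / pmf (map_pmf f p) (f z)))
    = expct p (\<lambda>z. - ln (pmf (map_pmf f p) (f z)) - (- ln (q (f z))))"
    using pos pmf_map_pos[of _ p f] by (intro expectation_cong_pmf) (simp add: ln_divide_pos)
  also have "\<dots> = ent p f - expct p (\<lambda>z. - ln (q (f z)))"
    unfolding ent_def using fin by (subst Bochner_Integration.integral_diff) (auto intro: integrable_measure_pmf_finite)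
  finally show ?thesis by simp
qed

lemma ent_eq_cross_imp:
  assumes fin: "finite (set_pmf p)" and pos: "\<And>z. z \<in> set_pmf p \<Longrightarrow> q (f z) > (0::real)"
    and le: "(\<Sum>w\<in>f ` set_pmf p. q w) \<le> 1"
    and ge: "ent p f \<ge> expct p (\<lambda>z. - ln (q (f z)))"
    and z: "z \<in> set_pmf p"
  shows "q (f z) = pmf (map_pmf f p) (f z)"
proof -
  have "expct p (\<lambda>z. ln (q (f z) / pmf (map_pmf f p) (f z)))
    = expct p (\<lambda>z. - ln (pmf (map_pmf f p) (f z)) - (- ln (q (f z))))"
    using pos pmf_map_pos[of _ p f] by (intro expectation_cong_pmf) (simp add: ln_divide_pos)
  also have "\<dots> = ent p f - expct p (\<lambda>z. - ln (q (f z)))"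
    unfolding ent_def using fin by (subst Bochner_Integration.integral_diff) (auto intro: integrable_measure_pmf_finite)
  finally have "expct p (\<lambda>z. ln (q (f z) / pmf (map_pmf f p) (f z))) \<ge> 0"
    using ge by simp
  then have "q (f z) / pmf (map_pmf f p) (f z) = 1"
    using pos z le by (intro expectation_ln_eq_0_imp[OF fin, of "\<lambda>z. q (f z) / pmf (map_pmf f p) (f z)" z])
      (simp_all only: expectation_div_image_pmf[OF fin] divide_pos_pos pmf_map_pos)
  with pmf_map_pos[OF z, of f] show ?thesis by simp
qed

section \<open>Monotonicity, relabelling and subadditivity of entropy\<close>

lemma pmf_map_comp_ge:
  "pmf (map_pmf f p) (f z) \<le> pmf (map_pmf (\<lambda>z. h (f z)) p) (h (f z))"
  by (auto simp: pmf_map intro!: measure_pmf.finite_measure_mono)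

lemma ent_comp_le:
  assumes fin: "finite (set_pmf p)"
  shows "ent p (\<lambda>z. h (f z)) \<le> ent p f"
  unfolding ent_def
proof (rule expectation_mono_pmf[OF fin])
  fix z assume "z \<in> set_pmf p"
  from pmf_map_pos[OF this, of f] pmf_map_comp_ge[of f p z h]
  show "- ln (pmf (map_pmf (\<lambda>z. h (f z)) p) (h (f z))) \<le> - ln (pmf (map_pmf f p) (f z))" by simp
qed

lemma ent_cong:
  assumes "\<And>z. z \<in> set_pmf p \<Longrightarrow> f z = g z"
  shows "ent p f = ent p g"
proof -
  have "map_pmf f p = map_pmf g p" by (rule map_pmf_cong[OF refl]) (rule assms)
  then show ?thesis unfolding ent_def using assms by (intro expectation_cong_pmf) simp
qed

text \<open>Both functions induce the same partition of the support. Invertibility on the support is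
  enough, which is how relations such as U = X under a particular kernel are exploited.\<close>

lemma ent_eqI:
  assumes fin: "finite (set_pmf p)" 
    and "\<And>z. z \<in> set_pmf p \<Longrightarrow> g z = h (f z)" "\<And>z. z \<in> set_pmf p \<Longrightarrow> f z = k (g z)"
  shows "ent p f = ent p g"
proof (rule antisym)
  show "ent p f \<le> ent p g"
    using ent_cong[of p f "\<lambda>z. k (g z)", OF assms(3)] ent_comp_le[OF fin, of k g] by simp
  show "ent p g \<le> ent p f"
    using ent_cong[of p g "\<lambda>z. h (f z)", OF assms(2)] ent_comp_le[OF fin, of h f] by simp
qed

lemma ent_map: "ent (map_pmf g p) f = ent p (\<lambda>z. f (g z))"
  by (simp add: ent_def map_pmf_comp)

lemma ent_le_ln_card:
  assumes fin: "finite (set_pmf p)" and "f ` set_pmf p \<subseteq> A" "finite A"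
  shows "ent p f \<le> ln (card A)"
proof -
  have ne: "A \<noteq> {}" using assms set_pmf_not_empty[of p] by blast
  then have c: "card A > 0" using assms by (simp add: card_gt_0_iff)
  have "(\<Sum>w\<in>f ` set_pmf p. 1 / real (card A)) \<le> (\<Sum>w\<in>A. 1 / real (card A))"
    using assms by (intro sum_mono2) auto
  also have "\<dots> = 1" using c by simp
  finally have "ent p f \<le> expct p (\<lambda>z. - ln (1 / real (card A)))"
    using c by (intro ent_le_cross[where q="\<lambda>_. 1 / real (card A)"] fin) auto
  then show ?thesis using c by (simp add: ln_div)
qed

lemma sum_pmf_image_fst:
  assumes fin: "finite (set_pmf p)"
  shows "(\<Sum>a\<in>{a. (a, b) \<in> (\<lambda>z. (A z, B z)) ` set_pmf p}. pmf (map_pmf (\<lambda>z. (A z, B z)) p) (a, b))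
    = pmf (map_pmf B p) b"
proof -
  let ?r = "map_pmf (\<lambda>z. (A z, B z)) p"
  have f: "finite {a. (a, b) \<in> (\<lambda>z. (A z, B z)) ` set_pmf p}"
    by (rule finite_subset[of _ "A ` set_pmf p"]) (use fin in auto)
  have "map_pmf B p = map_pmf snd ?r" by (simp add: map_pmf_comp)
  then have "pmf (map_pmf B p) b = measure ?r (snd -` {b})" by (simp add: pmf_map)
  also have "\<dots> = measure ?r (snd -` {b} \<inter> set_pmf ?r)"
    by (rule measure_Int_set_pmf[symmetric])
  also have "snd -` {b} \<inter> set_pmf ?r = (\<lambda>a. (a, b)) ` {a. (a, b) \<in> (\<lambda>z. (A z, B z)) ` set_pmf p}"
    by auto
  also have "measure ?r \<dots> = (\<Sum>w\<in>\<dots>. pmf ?r w)"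
    using f by (intro measure_measure_pmf_finite) auto
  also have "\<dots> = (\<Sum>a\<in>{a. (a, b) \<in> (\<lambda>z. (A z, B z)) ` set_pmf p}. pmf ?r (a, b))"
    by (subst sum.reindex) (auto simp: inj_on_def)
  finally show ?thesis ..
qed

text \<open>Gibbs' inequality against the law that draws \<open>A\<close> from the coarser conditional law given
  \<open>g (B z)\<close>.\<close>

lemma ent_cond_mono:
  assumes fin: "finite (set_pmf p)"
  shows "ent p (\<lambda>z. (A z, B z)) - ent p B \<le> ent p (\<lambda>z. (A z, g (B z))) - ent p (\<lambda>z. g (B z))"
proof -
  define q where "q = (\<lambda>(a, b). pmf (map_pmf B p) b * pmf (map_pmf (\<lambda>z. (A z, g (B z))) p) (a, g b)
     / pmf (map_pmf (\<lambda>z. g (B z)) p) (g b))"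
  let ?f = "\<lambda>z. (A z, B z)"
  have pos: "q (?f z) > 0" if "z \<in> set_pmf p" for z
    using that pmf_map_pos[OF that, of B] pmf_map_pos[OF that, of "\<lambda>z. g (B z)"]
      pmf_map_pos[OF that, of "\<lambda>z. (A z, g (B z))"] by (simp add: q_def)
  have "(\<Sum>w\<in>?f ` set_pmf p. q w) = (\<Sum>w\<in>?f ` set_pmf p. case w of (a, b) \<Rightarrow> q (a, b))"
    by simp
  \<comment> \<open>Enlarging the index set to all pairs for which \<open>(a, g b)\<close> is
    attained lets the conditional law of \<open>A\<close> given \<open>g b\<close> sum to one for
    each \<open>b\<close>.\<close>
  also have "\<dots> \<le> (\<Sum>(a, b)\<in>(SIGMA a:A ` set_pmf p. {b \<in> B ` set_pmf p. (a, g b) \<in> (\<lambda>z. (A z, g (B z))) ` set_pmf p}). q (a, b))"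
    using fin by (intro sum_mono2) (auto simp: q_def)
  also have "\<dots> = (\<Sum>a\<in>A ` set_pmf p. \<Sum>b\<in>{b \<in> B ` set_pmf p. (a, g b) \<in> (\<lambda>z. (A z, g (B z))) ` set_pmf p}. q (a, b))"
    using fin by (subst sum.Sigma) auto
  also have "\<dots> = (\<Sum>b\<in>B ` set_pmf p. \<Sum>a\<in>{a \<in> A ` set_pmf p. (a, g b) \<in> (\<lambda>z. (A z, g (B z))) ` set_pmf p}. q (a, b))"
    using fin by (subst sum.swap_restrict) (auto)
  also have "\<dots> = (\<Sum>b\<in>B ` set_pmf p. pmf (map_pmf B p) b)"
  proof (intro sum.cong refl)
    fix b assume b: "b \<in> B ` set_pmf p"
    have "{a \<in> A ` set_pmf p. (a, g b) \<in> (\<lambda>z. (A z, g (B z))) ` set_pmf p} = {a. (a, g b) \<in> (\<lambda>z. (A z, g (B z))) ` set_pmf p}"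
      by auto
    then have "(\<Sum>a\<in>{a \<in> A ` set_pmf p. (a, g b) \<in> (\<lambda>z. (A z, g (B z))) ` set_pmf p}. q (a, b))
      = pmf (map_pmf B p) b / pmf (map_pmf (\<lambda>z. g (B z)) p) (g b) * pmf (map_pmf (\<lambda>z. g (B z)) p) (g b)"
      using sum_pmf_image_fst[OF fin, where b="g b" and A=A and B="\<lambda>z. g (B z)"]
      by (simp add: q_def sum_divide_distrib[symmetric] sum_distrib_left[symmetric] )
    also have "\<dots> = pmf (map_pmf B p) b"
      using b pmf_map_pos[of _ p "\<lambda>z. g (B z)"] by force
    finally show "(\<Sum>a\<in>{a \<in> A ` set_pmf p. (a, g b) \<in> (\<lambda>z. (A z, g (B z))) ` set_pmf p}. q (a, b)) = pmf (map_pmf B p) b" .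
  qed
  also have "\<dots> = 1"
    using fin by (intro sum_pmf_eq_1) auto
  finally have "ent p ?f \<le> expct p (\<lambda>z. - ln (q (?f z)))"
    by (intro ent_le_cross fin pos) auto
  also have "\<dots> = expct p (\<lambda>z. - ln (pmf (map_pmf B p) (B z))
      + (- ln (pmf (map_pmf (\<lambda>z. (A z, g (B z))) p) (A z, g (B z))))
      - (- ln (pmf (map_pmf (\<lambda>z. g (B z)) p) (g (B z)))))"
  proof (intro expectation_cong_pmf)
    fix z assume z: "z \<in> set_pmf p"
    show "- ln (q (?f z)) = - ln (pmf (map_pmf B p) (B z))
      + (- ln (pmf (map_pmf (\<lambda>z. (A z, g (B z))) p) (A z, g (B z))))
      - (- ln (pmf (map_pmf (\<lambda>z. g (B z)) p) (g (B z))))"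
      using pmf_map_pos[OF z, of B] pmf_map_pos[OF z, of "\<lambda>z. g (B z)"]
      pmf_map_pos[OF z, of "\<lambda>z. (A z, g (B z))"] 
      by (simp only: q_def prod.case ln_mult_pos ln_divide_pos mult_pos_pos)
  qed
  also have "\<dots> = ent p B + ent p (\<lambda>z. (A z, g (B z))) - ent p (\<lambda>z. g (B z))"
    unfolding ent_def using fin by (simp add: integrable_measure_pmf_finite)
  finally show ?thesis by simp
qed

lemma ent_pair_le:
  assumes fin: "finite (set_pmf p)"
  shows "ent p (\<lambda>z. (A z, B z)) \<le> ent p A + ent p B"
proof -
  have "ent p (\<lambda>z. (A z, B z)) - ent p B \<le> ent p (\<lambda>z. (A z, ())) - ent p (\<lambda>z. ())"
    using ent_cond_mono[OF fin, of A B "\<lambda>_. ()"] by simp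
  also have "ent p (\<lambda>z. ()) = 0" by (simp add: ent_def)
  also have "ent p (\<lambda>z. (A z, ())) = ent p A"
    by (rule ent_eqI[OF fin, of _ fst _ "\<lambda>a. (a, ())"]) auto
  finally show ?thesis by simp
qed

lemma ent_eq_sum:
  assumes "f ` set_pmf p \<subseteq> A" "finite A"
  shows "ent p f = (\<Sum>a\<in>A. - (pmf (map_pmf f p) a * ln (pmf (map_pmf f p) a)))"
proof -
  have "ent p f = expct (map_pmf f p) (\<lambda>a. - ln (pmf (map_pmf f p) a))"
    by (simp add: ent_def)
  also have "\<dots> = (\<Sum>a\<in>A. - ln (pmf (map_pmf f p) a) * pmf (map_pmf f p) a)"
    using assms by (intro integral_measure_pmf_real) auto
  finally show ?thesis by (simp add: mult.commute)
qed

subsection \<open>Agreement with the library's measure-theoretic notions\<close>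

lemma distributed_map_pmf:
  "distributed (measure_pmf p) (count_space UNIV) f (\<lambda>x. ennreal (pmf (map_pmf f p) x))"
proof -
  have "distr (measure_pmf p) (count_space UNIV) f = measure_pmf (map_pmf f p)"
    by (simp add: map_pmf_rep_eq)
  then show ?thesis
    by (simp add: distributed_def measure_pmf_eq_density[symmetric])
qed

lemma integral_count_space_pmf:
  fixes F :: "'b \<Rightarrow> real"
  shows "(\<integral>x. pmf (map_pmf f p) x * F x \<partial>count_space UNIV) = expct p (\<lambda>z. F (f z))"
proof -
  have "expct p (\<lambda>z. F (f z)) = expct (map_pmf f p) F" by simp
  also have "\<dots> = (\<integral>x. pmf (map_pmf f p) x *\<^sub>R F x \<partial>count_space UNIV)"
    by (subst measure_pmf_eq_density, subst integral_density) auto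
  finally show ?thesis by simp
qed

lemma information_space_pmf: "information_space (measure_pmf p) (exp 1)"
  by (simp add: information_space_def information_space_axioms_def measure_pmf.prob_space_axioms)

lemma log_exp_1: "log (exp 1) x = ln x"
  by (simp add: log_def)

text \<open>Countable value types make the product of the counting measures a counting measure, so
  that the general density formula becomes an expectation under \<open>p\<close>.\<close>

lemma mutual_information_pmf:
  fixes X :: "'a \<Rightarrow> 'b::countable" and Y :: "'a \<Rightarrow> 'c::countable"
  assumes fin: "finite (set_pmf p)"
  shows "prob_space.mutual_information (measure_pmf p) (exp 1) (count_space UNIV) (count_space UNIV) X Y
    = ent p X + ent p Y - ent p (\<lambda>z. (X z, Y z))"
proof -
  interpret information_space "measure_pmf p" "exp 1" by (rule information_space_pmf)
  let ?Pxy = "pmf (map_pmf (\<lambda>z. (X z, Y z)) p)" and ?Px = "pmf (map_pmf X p)" and ?Py = "pmf (map_pmf Y p)"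
  have cs: "count_space (UNIV::'b set) \<Otimes>\<^sub>M count_space (UNIV::'c set) = count_space UNIV"
    by (simp add: pair_measure_countable)
  have "prob_space.mutual_information (measure_pmf p) (exp 1) (count_space UNIV) (count_space UNIV) X Y = 
     integral\<^sup>L (count_space UNIV \<Otimes>\<^sub>M count_space UNIV) (\<lambda>x. ?Pxy x * log (exp 1) (?Pxy x / (?Px (fst x) * ?Py (snd x))))"
    by (intro mutual_information_distr sigma_finite_measure_count_space distributed_map_pmf)
       (auto simp: cs intro: distributed_map_pmf)
  also have "\<dots> = expct p (\<lambda>z. ln (?Pxy (X z, Y z) / (?Px (X z) * ?Py (Y z))))"
    by (simp add: cs log_exp_1 integral_count_space_pmf)
  also have "\<dots> = expct p (\<lambda>z. - ln (?Px (X z)) + - ln (?Py (Y z)) - (- ln (?Pxy (X z, Y z))))"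
  proof (intro expectation_cong_pmf)
    fix z assume z: "z \<in> set_pmf p"
    show "ln (?Pxy (X z, Y z) / (?Px (X z) * ?Py (Y z))) = - ln (?Px (X z)) + - ln (?Py (Y z)) - (- ln (?Pxy (X z, Y z)))"
      using pmf_map_pos[OF z, of X] pmf_map_pos[OF z, of Y] pmf_map_pos[OF z, of "\<lambda>z. (X z, Y z)"]
      by (simp add: ln_mult ln_div)
  qed
  also have "\<dots> = ent p X + ent p Y - ent p (\<lambda>z. (X z, Y z))"
    unfolding ent_def using fin by (simp add: integrable_measure_pmf_finite)
  finally show ?thesis .
qed

lemma conditional_entropy_pmf:
  fixes X :: "'a \<Rightarrow> 'b::countable" and Y :: "'a \<Rightarrow> 'c::countable"
  assumes fin: "finite (set_pmf p)"
  shows "prob_space.conditional_entropy (measure_pmf p) (exp 1) (count_space UNIV) (count_space UNIV) X Y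
    = ent p (\<lambda>z. (X z, Y z)) - ent p Y"
proof -
  interpret information_space "measure_pmf p" "exp 1" by (rule information_space_pmf)
  let ?Pxy = "pmf (map_pmf (\<lambda>z. (X z, Y z)) p)" and ?Py = "pmf (map_pmf Y p)"
  have cs: "count_space (UNIV::'b set) \<Otimes>\<^sub>M count_space (UNIV::'c set) = count_space UNIV"
    by (simp add: pair_measure_countable)
  have "prob_space.conditional_entropy (measure_pmf p) (exp 1) (count_space UNIV) (count_space UNIV) X Y = 
     - integral\<^sup>L (count_space UNIV \<Otimes>\<^sub>M count_space UNIV) (\<lambda>(x, y). ?Pxy (x, y) * log (exp 1) (?Pxy (x, y) / ?Py y))"
    by (intro conditional_entropy_generic_eq sigma_finite_measure_count_space distributed_map_pmf)
       (auto simp: cs intro: distributed_map_pmf)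
  also have "\<dots> = - integral\<^sup>L (count_space UNIV) (\<lambda>w. ?Pxy w * ln (?Pxy w / ?Py (snd w)))"
    by (simp add: cs log_exp_1 case_prod_unfold)
  also have "\<dots> = - expct p (\<lambda>z. ln (?Pxy (X z, Y z) / ?Py (Y z)))"
    by (simp add: integral_count_space_pmf)
  also have "expct p (\<lambda>z. ln (?Pxy (X z, Y z) / ?Py (Y z))) = 
      expct p (\<lambda>z. - ln (?Py (Y z)) - (- ln (?Pxy (X z, Y z))))"
  proof (intro expectation_cong_pmf)
    fix z assume z: "z \<in> set_pmf p"
    show "ln (?Pxy (X z, Y z) / ?Py (Y z)) = - ln (?Py (Y z)) - (- ln (?Pxy (X z, Y z)))"
      using pmf_map_pos[OF z, of Y] pmf_map_pos[OF z, of "\<lambda>z. (X z, Y z)"]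
      by (simp add: ln_div)
  qed
  also have "\<dots> = ent p Y - ent p (\<lambda>z. (X z, Y z))"
    unfolding ent_def using fin by (simp add: integrable_measure_pmf_finite)
  finally show ?thesis by simp
qed


section \<open>Single-letter profiles\<close>

definition plogp :: "real \<Rightarrow> real" where "plogp t = - (t * ln t)"

text \<open>Continuity at 0 is the right-hand limit of t ln t. It makes entropies continuous up to
  the boundary of the simplex, on which the compactness argument rests.\<close>

lemma continuous_on_plogp: "continuous_on {0..} plogp"
proof -
  have "continuous (at t within {0..}) plogp" if t: "t \<ge> 0" for t
  proof (cases "t = 0")
    case True
    have "((\<lambda>t::real. - (t * ln t)) \<longlongrightarrow> 0) (at_right 0)" by real_asymp
    then show ?thesis using True
      by (simp add: continuous_within plogp_def[abs_def] at_within_Ici_at_right)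
  next
    case False
    with t have "isCont plogp t" unfolding plogp_def[abs_def] by (intro continuous_intros) auto
    then show ?thesis by (rule continuous_at_imp_continuous_at_within)
  qed
  then show ?thesis by (auto simp: continuous_on_eq_continuous_within)
qed

definition prob_simplex :: "(real^'a::finite) set" where
  "prob_simplex = {v. (\<forall>z. 0 \<le> v $ z) \<and> (\<Sum>z\<in>UNIV. v $ z) = 1}"

text \<open>The law with its H(X), H(Y) and H(X,Y). Averaging such points with weights P(u) turns
  the three numbers into conditional entropies given U.\<close>

definition entropies :: "real^('x::finite \<times> 'y::finite) \<Rightarrow> (real^('x \<times> 'y)) \<times> real \<times> real \<times> real" where
  "entropies v = (v, (\<Sum>x\<in>UNIV. plogp (\<Sum>y\<in>UNIV. v $ (x, y))),
     (\<Sum>y\<in>UNIV. plogp (\<Sum>x\<in>UNIV. v $ (x, y))), (\<Sum>z\<in>UNIV. plogp (v $ z)))"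

text \<open>Points \<open>(P, H(X|U), H(Y|U), H(X,Y|U))\<close> for arbitrary finite \<open>U\<close> jointly distributed with
  \<open>(X, Y) \<sim> P\<close>, without Markov constraint.\<close>

definition profiles :: "((real^('x::finite \<times> 'y::finite)) \<times> real \<times> real \<times> real) set" where
  "profiles = convex hull (entropies ` prob_simplex)"

lemma compact_prob_simplex: "compact (prob_simplex :: (real^'a::finite) set)"
proof -
  have "norm v \<le> 1" if "v \<in> prob_simplex" for v :: "real^'a"
    using that norm_le_l1_cart[of v] by (simp add: prob_simplex_def)
  then have "bounded (prob_simplex :: (real^'a) set)" by (auto simp: bounded_iff)
  moreover have "closed (prob_simplex :: (real^'a) set)"
    unfolding prob_simplex_def
    by (intro closed_Collect_conj closed_Collect_all closed_Collect_le closed_Collect_eq continuous_intros)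
  ultimately show ?thesis by (simp add: compact_eq_bounded_closed)
qed

lemma continuous_on_entropies: "continuous_on prob_simplex entropies"
  unfolding entropies_def[abs_def]
  by (intro continuous_intros continuous_on_compose2[OF continuous_on_plogp])
     (auto simp: prob_simplex_def intro!: sum_nonneg)

text \<open>The convex hull of a compact set in finite dimension is compact. This stands in for a
  bound on the alphabet of U.\<close>

lemma compact_profiles: "compact (profiles :: ((real^('x::finite \<times> 'y::finite)) \<times> real \<times> real \<times> real) set)"
  unfolding profiles_def
  by (intro compact_convex_hull compact_continuous_image continuous_on_entropies compact_prob_simplex)

lemma convex_prob_simplex: "convex (prob_simplex :: (real^'a::finite) set)"
  unfolding convex_def prob_simplex_def
  by (auto simp: sum.distrib sum_distrib_left[symmetric])

lemma fst_profiles: "w \<in> profiles \<Longrightarrow> fst w \<in> prob_simplex"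
proof -
  have "fst ` profiles = convex hull (fst ` entropies ` (prob_simplex :: (real^('x::finite \<times> 'y::finite)) set))"
    unfolding profiles_def by (rule convex_hull_linear_image) (rule linear_fst)
  also have "fst ` entropies ` (prob_simplex :: (real^('x::finite \<times> 'y::finite)) set) = prob_simplex"
    by (force simp: entropies_def image_iff)
  also have "convex hull (prob_simplex :: (real^('x::finite \<times> 'y::finite)) set) = prob_simplex"
    using convex_prob_simplex by (simp add: convex_hull_eq)
  finally show "w \<in> profiles \<Longrightarrow> fst w \<in> prob_simplex" by blast
qed

definition pvec :: "'a::finite pmf \<Rightarrow> real^'a" where "pvec p = (\<chi> z. pmf p z)"

lemma pvec_nth [simp]: "pvec p $ z = pmf p z"
  by (simp add: pvec_def)

lemma pvec_in_simplex: "pvec p \<in> prob_simplex"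
  by (simp add: prob_simplex_def sum_pmf_eq_1)

lemma prob_simplex_imp_pvec:
  assumes "v \<in> prob_simplex" shows "\<exists>p. v = pvec p"
proof -
  have "(\<integral>\<^sup>+ x. ennreal (v $ x) \<partial>count_space UNIV) = 1"
    using assms by (simp add: nn_integral_count_space_finite prob_simplex_def)
  then have "pmf (embed_pmf (($) v)) x = v $ x" for x
    using assms by (intro pmf_embed_pmf) (auto simp: prob_simplex_def)
  then have "v = pvec (embed_pmf (($) v))" by (simp add: vec_eq_iff)
  then show ?thesis by blast
qed

lemma ent_finite:
  fixes f :: "'a \<Rightarrow> 'b::finite"
  shows "ent p f = (\<Sum>a\<in>UNIV. plogp (pmf (map_pmf f p) a))"
  by (subst ent_eq_sum[where A=UNIV]) (auto simp: plogp_def)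

lemma pmf_map_fst_sum:
  fixes p :: "('x::finite \<times> 'y::finite) pmf"
  shows "pmf (map_pmf fst p) x = (\<Sum>y\<in>UNIV. pmf p (x, y))"
proof -
  have e: "fst -` {x} = Pair x ` (UNIV :: 'y set)" by auto
  have "pmf (map_pmf fst p) x = (\<Sum>w\<in>Pair x ` UNIV. pmf p w)"
    by (simp add: pmf_map e measure_measure_pmf_finite)
  also have "\<dots> = (\<Sum>y\<in>UNIV. pmf p (x, y))" by (subst sum.reindex) (auto simp: inj_on_def)
  finally show ?thesis .
qed

lemma pmf_map_snd_sum:
  fixes p :: "('x::finite \<times> 'y::finite) pmf"
  shows "pmf (map_pmf snd p) y = (\<Sum>x\<in>UNIV. pmf p (x, y))"
proof -
  have e: "snd -` {y} = (\<lambda>x. (x, y)) ` (UNIV :: 'x set)" by auto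
  have "pmf (map_pmf snd p) y = (\<Sum>w\<in>(\<lambda>x. (x, y)) ` UNIV. pmf p w)"
    by (simp add: pmf_map e measure_measure_pmf_finite)
  also have "\<dots> = (\<Sum>x\<in>UNIV. pmf p (x, y))" by (subst sum.reindex) (auto simp: inj_on_def)
  finally show ?thesis .
qed

lemma entropies_pvec: "entropies (pvec p) = (pvec p, ent p fst, ent p snd, ent p (\<lambda>z. z))"
  by (simp add: entropies_def ent_finite pmf_map_fst_sum pmf_map_snd_sum)

subsection \<open>Conditioning on a random variable\<close>

lemma cond_pmf_map_disjoint:
  assumes "u \<in> U ` set_pmf p" shows "set_pmf p \<inter> U -` {u} \<noteq> {}"
  using assms by auto

lemma measure_vimage_pos:
  assumes "u \<in> U ` set_pmf p" shows "measure_pmf.prob p (U -` {u}) = pmf (map_pmf U p) u" "pmf (map_pmf U p) u > 0"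
  using assms by (auto simp: pmf_map[symmetric] pmf_positive_iff)

lemma total_expectation:
  fixes F :: "'a \<Rightarrow> real"
  assumes fin: "finite (set_pmf p)"
  shows "expct p F
    = (\<Sum>u\<in>U ` set_pmf p. pmf (map_pmf U p) u * expct (cond_pmf p (U -` {u})) F)"
proof -
  have "expct p F = (\<Sum>z\<in>set_pmf p. F z * pmf p z)"
    using fin by (intro integral_measure_pmf_real) auto
  also have "\<dots> = (\<Sum>u\<in>U ` set_pmf p. \<Sum>z\<in>{z \<in> set_pmf p. U z = u}. F z * pmf p z)"
    using fin by (rule sum.image_gen)
  also have "\<dots> = (\<Sum>u\<in>U ` set_pmf p. pmf (map_pmf U p) u * expct (cond_pmf p (U -` {u})) F)"
  proof (intro sum.cong refl)
    fix u assume u: "u \<in> U ` set_pmf p"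
    note d = cond_pmf_map_disjoint[OF u] and m = measure_vimage_pos[OF u]
    have "expct (cond_pmf p (U -` {u})) F
      = (\<Sum>z\<in>{z \<in> set_pmf p. U z = u}. F z * pmf (cond_pmf p (U -` {u})) z)"
      using fin d by (intro integral_measure_pmf_real) (auto simp: set_cond_pmf)
    also have "\<dots> = (\<Sum>z\<in>{z \<in> set_pmf p. U z = u}. F z * (pmf p z / pmf (map_pmf U p) u))"
      using d by (intro sum.cong refl) (auto simp: pmf_cond m)
    finally show "(\<Sum>z\<in>{z \<in> set_pmf p. U z = u}. F z * pmf p z)
      = pmf (map_pmf U p) u * expct (cond_pmf p (U -` {u})) F"
      using m(2) by (simp add: sum_distrib_left)
  qed
  finally show ?thesis .
qed

lemma pmf_map_cond_pmf:
  assumes u: "u \<in> U ` set_pmf p"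
  shows "pmf (map_pmf A (cond_pmf p (U -` {u}))) a = pmf (map_pmf (\<lambda>z. (A z, U z)) p) (a, u) / pmf (map_pmf U p) u"
proof -
  note d = cond_pmf_map_disjoint[OF u] and m = measure_vimage_pos[OF u]
  have "pmf (map_pmf A (cond_pmf p (U -` {u}))) a = measure (uniform_measure (measure_pmf p) (U -` {u})) (A -` {a})"
    using d by (simp add: pmf_map cond_pmf.rep_eq)
  also have "\<dots> = measure_pmf.prob p (U -` {u} \<inter> A -` {a}) / measure_pmf.prob p (U -` {u})"
    using m by (intro measure_uniform_measure) (auto simp: measure_pmf.emeasure_eq_measure)
  also have "U -` {u} \<inter> A -` {a} = (\<lambda>z. (A z, U z)) -` {(a, u)}" by auto
  finally show ?thesis by (simp add: pmf_map)
qed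

text \<open>Turns a difference of joint entropies into an average over the values of
  \<open>U\<close>, the shape of a convex combination.\<close>

lemma ent_cond_eq_sum:
  assumes fin: "finite (set_pmf p)"
  shows "ent p (\<lambda>z. (A z, U z)) - ent p U
    = (\<Sum>u\<in>U ` set_pmf p. pmf (map_pmf U p) u * ent (cond_pmf p (U -` {u})) A)"
proof -
  let ?F = "\<lambda>z. - ln (pmf (map_pmf (\<lambda>z. (A z, U z)) p) (A z, U z) / pmf (map_pmf U p) (U z))"
  have "ent p (\<lambda>z. (A z, U z)) - ent p U = expct p
     (\<lambda>z. - ln (pmf (map_pmf (\<lambda>z. (A z, U z)) p) (A z, U z)) - (- ln (pmf (map_pmf U p) (U z))))"
    unfolding ent_def using fin by (simp add: integrable_measure_pmf_finite)
  also have "\<dots> = expct p ?F"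
  proof (rule expectation_cong_pmf)
    fix z assume z: "z \<in> set_pmf p"
    show "- ln (pmf (map_pmf (\<lambda>z. (A z, U z)) p) (A z, U z)) - (- ln (pmf (map_pmf U p) (U z))) = ?F z"
      using pmf_map_pos[OF z, of "\<lambda>z. (A z, U z)"] pmf_map_pos[OF z, of U] by (simp only: ln_divide_pos)
  qed
  also have "\<dots> = (\<Sum>u\<in>U ` set_pmf p. pmf (map_pmf U p) u * expct (cond_pmf p (U -` {u})) ?F)"
    by (rule total_expectation[OF fin])
  also have "\<dots> = (\<Sum>u\<in>U ` set_pmf p. pmf (map_pmf U p) u * ent (cond_pmf p (U -` {u})) A)"
  proof (intro sum.cong refl arg_cong2[where f="(*)"])
    fix u assume u: "u \<in> U ` set_pmf p"
    show "expct (cond_pmf p (U -` {u})) ?F = ent (cond_pmf p (U -` {u})) A"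
      unfolding ent_def pmf_map_cond_pmf[OF u]
      by (rule expectation_cong_pmf) (use u in \<open>auto simp: set_cond_pmf[OF cond_pmf_map_disjoint[OF u]]\<close>)
  qed
  finally show ?thesis .
qed

text \<open>The convex combination has the weights P(U = u) and, as points, the
  \<open>entropies\<close> of the law of \<open>Z\<close> given U = u. The type of \<open>U\<close>
  is arbitrary because in the converse it holds a message and a list of past letters.\<close>

lemma rv_in_profiles:
  fixes Z :: "'a \<Rightarrow> 'x::finite \<times> 'y::finite"
  assumes fin: "finite (set_pmf p)"
  shows "(pvec (map_pmf Z p), ent p (\<lambda>z. (fst (Z z), U z)) - ent p U, ent p (\<lambda>z. (snd (Z z), U z)) - ent p U,
     ent p (\<lambda>z. (Z z, U z)) - ent p U) \<in> profiles"
proof -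
  define r where "r = (\<lambda>u. map_pmf Z (cond_pmf p (U -` {u})))"
  let ?c = "\<lambda>u. pmf (map_pmf U p) u" and ?W = "U ` set_pmf p"
  have fW: "finite ?W" using fin by simp
  have "(\<Sum>u\<in>?W. ?c u *\<^sub>R entropies (pvec (r u))) \<in> profiles"
    unfolding profiles_def using fin
    by (intro convex_sum convex_convex_hull)
       (auto intro!: hull_inc imageI pvec_in_simplex sum_pmf_eq_1)
  also have "(\<Sum>u\<in>?W. ?c u *\<^sub>R entropies (pvec (r u))) = 
    (\<Sum>u\<in>?W. (?c u *\<^sub>R pvec (r u), ?c u * ent (cond_pmf p (U -` {u})) (\<lambda>z. fst (Z z)),
      ?c u * ent (cond_pmf p (U -` {u})) (\<lambda>z. snd (Z z)), ?c u * ent (cond_pmf p (U -` {u})) Z))"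
    by (simp add: entropies_pvec r_def ent_map)
  also have "\<dots> = (\<Sum>u\<in>?W. ?c u *\<^sub>R pvec (r u), \<Sum>u\<in>?W. ?c u * ent (cond_pmf p (U -` {u})) (\<lambda>z. fst (Z z)),
      \<Sum>u\<in>?W. ?c u * ent (cond_pmf p (U -` {u})) (\<lambda>z. snd (Z z)), \<Sum>u\<in>?W. ?c u * ent (cond_pmf p (U -` {u})) Z)"
    by (simp only: sum_prod)
  also have "(\<Sum>u\<in>?W. ?c u *\<^sub>R pvec (r u)) = pvec (map_pmf Z p)"
  proof (subst vec_eq_iff, intro allI)
    fix z
    have "pmf q z = expct q (indicator {z})" for q :: "('x \<times> 'y) pmf"
      by (simp add: pmf.rep_eq)
    then have *: "pmf (map_pmf Z q) z = expct q (\<lambda>a. indicator {z} (Z a))" for q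
      by (metis integral_map_pmf)
    show "(\<Sum>u\<in>?W. ?c u *\<^sub>R pvec (r u)) $ z = pvec (map_pmf Z p) $ z"
      using total_expectation[OF fin, of "\<lambda>a. indicator {z} (Z a)" U] by (simp add: r_def *)
  qed
  finally show ?thesis by (simp add: ent_cond_eq_sum[OF fin])
qed

section \<open>Profiles and test channels\<close>

text \<open>Agreement on the support of \<open>p\<close> already uses up all the mass of
  \<open>q\<close>.\<close>

lemma pmf_eq_if_eq_on_set_pmf:
  assumes fin: "finite (set_pmf p)" and eq: "\<And>z. z \<in> set_pmf p \<Longrightarrow> pmf q z = pmf p z"
  shows "q = p"
proof -
  have "measure_pmf.prob q (set_pmf p) = (\<Sum>z\<in>set_pmf p. pmf p z)"
    using fin eq by (simp add: measure_measure_pmf_finite)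
  also have "\<dots> = 1" using fin by (intro sum_pmf_eq_1) auto
  finally have sub: "set_pmf q \<subseteq> set_pmf p"
    by (subst (asm) measure_pmf.prob_eq_1) (auto simp: AE_measure_pmf_iff)
  show ?thesis
  proof (rule pmf_eqI)
    fix z show "pmf q z = pmf p z"
      using eq sub by (cases "z \<in> set_pmf p") (blast, metis pmf_eq_0_set_pmf subsetD)
  qed
qed

section \<open>The joint law of source and test channel, and its entropies\<close>

lemma pmf_joint_XYU: "pmf (joint_XYU P K) (x, y, u) = pmf P (x, y) * pmf (K x) u"
proof -
  have inj: "inj (\<lambda>u. (x, y, u))" for x :: 'a and y :: 'b by (auto simp: inj_on_def)
  have "pmf (joint_XYU P K) (x, y, u) = expct P (\<lambda>(x', y'). pmf (map_pmf (\<lambda>u. (x', y', u)) (K x')) (x, y, u))"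
    by (simp add: joint_XYU_def pmf_bind case_prod_unfold)
  also have "\<dots> = expct P (\<lambda>w. pmf (K x) u * indicator {(x, y)} w)"
    by (intro expectation_cong_pmf)
       (auto simp: indicator_def pmf_map_inj'[OF inj] pmf_eq_0_set_pmf)
  also have "\<dots> = pmf P (x, y) * pmf (K x) u"
    by (simp add: pmf.rep_eq)
  finally show ?thesis .
qed

lemma finite_set_joint_XYU:
  fixes P :: "('x::finite \<times> 'y::finite) pmf"
  assumes "test_kernel K" shows "finite (set_pmf (joint_XYU P K))"
proof -
  have "set_pmf (joint_XYU P K) \<subseteq> UNIV \<times> UNIV \<times> (\<Union>x. set_pmf (K x))"
    by (auto simp: joint_XYU_def)
  then show ?thesis by (rule finite_subset) (use assms in \<open>auto simp: test_kernel_def\<close>)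
qed

abbreviation coordX where "coordX \<equiv> (\<lambda>(x, y, u). x)"
abbreviation coordY where "coordY \<equiv> (\<lambda>(x, y, u). y)"
abbreviation coordU where "coordU \<equiv> (\<lambda>(x, y, u). u)"
abbreviation coordXY where "coordXY \<equiv> (\<lambda>(x, y, u). (x, y))"

lemma map_coordXY_joint_XYU: "map_pmf coordXY (joint_XYU P K) = P"
  by (simp add: joint_XYU_def map_bind_pmf map_pmf_comp case_prod_unfold bind_return_pmf')

lemma joint_XU_eq: "joint_XU (marginal_X P) K = map_pmf (\<lambda>z. (coordX z, coordU z)) (joint_XYU P K)"
  by (simp add: joint_XU_def marginal_X_def joint_XYU_def map_bind_pmf bind_map_pmf map_pmf_comp case_prod_unfold)

lemma pmf_joint_XU: "pmf (joint_XU Q K) (x, u) = pmf Q x * pmf (K x) u"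
proof -
  have inj: "inj (\<lambda>u. (x, u))" for x :: 'a by (auto simp: inj_on_def)
  have "pmf (joint_XU Q K) (x, u) = expct Q (\<lambda>x'. pmf (map_pmf (\<lambda>u. (x', u)) (K x')) (x, u))"
    by (simp add: joint_XU_def pmf_bind)
  also have "\<dots> = expct Q (\<lambda>w. pmf (K x) u * indicator {x} w)"
    by (intro expectation_cong_pmf)
       (auto simp: indicator_def pmf_map_inj'[OF inj] pmf_eq_0_set_pmf)
  also have "\<dots> = pmf Q x * pmf (K x) u"
    by (simp add: pmf.rep_eq)
  finally show ?thesis .
qed

lemma mutual_info_XU_eq:
  fixes P :: "('x::finite \<times> 'y::finite) pmf"
  assumes K: "test_kernel K"
  shows "mutual_info_XU (marginal_X P) K = ent P fst
    - (ent (joint_XYU P K) (\<lambda>z. (coordX z, coordU z)) - ent (joint_XYU P K) coordU)"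
proof -
  let ?J = "joint_XYU P K"
  have fin: "finite (set_pmf (joint_XU (marginal_X P) K))"
    unfolding joint_XU_eq using finite_set_joint_XYU[OF K, of P] by simp
  have "ent P fst = ent (map_pmf coordXY ?J) fst" by (simp add: map_coordXY_joint_XYU)
  also have "\<dots> = ent ?J coordX" by (simp add: ent_map case_prod_unfold)
  finally show ?thesis
    unfolding mutual_info_XU_def mutual_information_pmf[OF fin]
    by (simp add: joint_XU_eq ent_map case_prod_unfold)
qed

lemma cond_entropy_YU_eq:
  fixes P :: "('x::finite \<times> 'y::finite) pmf"
  assumes K: "test_kernel K"
  shows "cond_entropy_YU P K = ent (joint_XYU P K) (\<lambda>z. (coordY z, coordU z)) - ent (joint_XYU P K) coordU"
  unfolding cond_entropy_YU_def by (rule conditional_entropy_pmf[OF finite_set_joint_XYU[OF K]])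

lemma expectation_joint_XYU_XY:
  fixes F :: "_ \<Rightarrow> real"
  shows "expct (joint_XYU P K) (\<lambda>z. F (coordXY z)) = expct P F"
  by (metis integral_map_pmf map_coordXY_joint_XYU)

text \<open>This is H(Y|X,U) = H(Y|X): the factor \<open>pmf (K x) u\<close> occurs in both joint
  laws and cancels between the logarithms.\<close>

lemma markov_joint_XYU:
  fixes P :: "('x::finite \<times> 'y::finite) pmf"
  assumes K: "test_kernel K"
  shows "ent (joint_XYU P K) (\<lambda>z. (coordXY z, coordU z)) - ent (joint_XYU P K) (\<lambda>z. (coordX z, coordU z))
    = ent P (\<lambda>z. z) - ent P fst"
proof -
  let ?J = "joint_XYU P K"
  note fin = finite_set_joint_XYU[OF K, of P]
  have J: "pmf (map_pmf (\<lambda>z. (coordXY z, coordU z)) ?J) ((x, y), u) = pmf P (x, y) * pmf (K x) u" for x y u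
  proof -
    have "inj (\<lambda>z :: 'x \<times> 'y \<times> nat. (coordXY z, coordU z))" by (auto simp: inj_on_def)
    from pmf_map_inj'[OF this, of ?J "(x, y, u)"] show ?thesis by (simp add: pmf_joint_XYU)
  qed
  have J2: "pmf (map_pmf (\<lambda>z. (coordX z, coordU z)) ?J) (x, u) = pmf (map_pmf fst P) x * pmf (K x) u" for x u
    using joint_XU_eq[of P K] pmf_joint_XU[of "marginal_X P" K x u] by (simp add: marginal_X_def)
  have "ent ?J (\<lambda>z. (coordXY z, coordU z)) - ent ?J (\<lambda>z. (coordX z, coordU z)) =
     expct ?J (\<lambda>z. - ln (pmf (map_pmf (\<lambda>z. (coordXY z, coordU z)) ?J) (coordXY z, coordU z))
      - (- ln (pmf (map_pmf (\<lambda>z. (coordX z, coordU z)) ?J) (coordX z, coordU z))))"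
    unfolding ent_def using fin by (subst Bochner_Integration.integral_diff) (auto intro: integrable_measure_pmf_finite)
  also have "\<dots> = expct ?J (\<lambda>z. - ln (pmf P (coordXY z)) - (- ln (pmf (map_pmf fst P) (fst (coordXY z)))))"
  proof (rule expectation_cong_pmf)
    fix z assume z: "z \<in> set_pmf ?J"
    obtain x y u where zz: "z = (x, y, u)" by (cases z)
    with z have p: "pmf P (x, y) * pmf (K x) u > 0"
      by (metis pmf_joint_XYU pmf_positive)
    then have pos: "pmf P (x, y) > 0" "pmf (K x) u > 0"
      using pmf_nonneg[of P "(x, y)"] pmf_nonneg[of "K x" u] by (auto simp: zero_less_mult_iff)
    then have "pmf (map_pmf fst P) x > 0"
      using pmf_map_pos[of "(x, y)" P fst] by (simp add: pmf_positive_iff)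
    with pos show "- ln (pmf (map_pmf (\<lambda>z. (coordXY z, coordU z)) ?J) (coordXY z, coordU z))
      - (- ln (pmf (map_pmf (\<lambda>z. (coordX z, coordU z)) ?J) (coordX z, coordU z)))
      = - ln (pmf P (coordXY z)) - (- ln (pmf (map_pmf fst P) (fst (coordXY z))))"
      by (simp add: zz J J2 ln_mult_pos)
  qed
  also have "\<dots> = expct P (\<lambda>z. - ln (pmf P z) - (- ln (pmf (map_pmf fst P) (fst z))))"
    by (rule expectation_joint_XYU_XY[of P K "\<lambda>z. - ln (pmf P z) - (- ln (pmf (map_pmf fst P) (fst z)))"])
  also have "\<dots> = ent P (\<lambda>z. z) - ent P fst"
    unfolding ent_def by (subst Bochner_Integration.integral_diff) (auto intro: integrable_measure_pmf_finite)
  finally show ?thesis .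
qed

text \<open>Here \<open>a\<close> is H(X|U), and the last coordinate is H(X,Y|U) = H(X|U) + H(Y|X)
  by the Markov property.\<close>

lemma kernel_profile:
  fixes P :: "('x::finite \<times> 'y::finite) pmf"
  assumes K: "test_kernel K"
  defines "a \<equiv> ent P fst - mutual_info_XU (marginal_X P) K"
  shows "(pvec P, a, cond_entropy_YU P K, a + (ent P (\<lambda>z. z) - ent P fst)) \<in> profiles"
proof -
  let ?J = "joint_XYU P K"
  have "(pvec (map_pmf coordXY ?J), ent ?J (\<lambda>z. (fst (coordXY z), coordU z)) - ent ?J coordU,
     ent ?J (\<lambda>z. (snd (coordXY z), coordU z)) - ent ?J coordU, ent ?J (\<lambda>z. (coordXY z, coordU z)) - ent ?J coordU) \<in> profiles"
    by (rule rv_in_profiles[OF finite_set_joint_XYU[OF K]])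
  moreover have "ent ?J (\<lambda>z. (coordXY z, coordU z)) - ent ?J coordU = a + (ent P (\<lambda>z. z) - ent P fst)"
    using markov_joint_XYU[OF K, of P] mutual_info_XU_eq[OF K, of P] by (simp add: a_def)
  moreover have "ent ?J (\<lambda>z. (fst (coordXY z), coordU z)) - ent ?J coordU = a"
    using mutual_info_XU_eq[OF K, of P] by (simp add: a_def case_prod_unfold)
  moreover have "ent ?J (\<lambda>z. (snd (coordXY z), coordU z)) - ent ?J coordU = cond_entropy_YU P K"
    using cond_entropy_YU_eq[OF K, of P] by (simp add: case_prod_unfold)
  ultimately show ?thesis by (simp add: map_coordXY_joint_XYU)
qed

text \<open>A convex combination is read as a joint law: its weights become the law of U, and each
  of its points becomes the law of (X, Y) given one value of U.\<close>

lemma profiles_imp_joint: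
  fixes w :: "(real^('x::finite \<times> 'y::finite)) \<times> real \<times> real \<times> real"
  assumes "w \<in> profiles"
  shows "\<exists>J :: ('x \<times> 'y \<times> nat) pmf. finite (set_pmf J) \<and> w = (pvec (map_pmf coordXY J),
     ent J (\<lambda>z. (coordX z, coordU z)) - ent J coordU, ent J (\<lambda>z. (coordY z, coordU z)) - ent J coordU,
     ent J (\<lambda>z. (coordXY z, coordU z)) - ent J coordU)"
proof -
  obtain S c where S: "finite S" "S \<subseteq> entropies ` prob_simplex" "\<And>s. s \<in> S \<Longrightarrow> 0 \<le> (c s :: real)"
    "sum c S = 1" "(\<Sum>s\<in>S. c s *\<^sub>R s) = w"
    using assms unfolding profiles_def convex_hull_explicit by blast
  have "\<exists>q. s = entropies (pvec q)" if "s \<in> S" for s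
    using S(2) that prob_simplex_imp_pvec by blast
  then obtain q where q: "\<And>s. s \<in> S \<Longrightarrow> s = entropies (pvec (q s))" by metis
  \<comment> \<open>The finitely many points of the combination are numbered, and the numbers serve
    as values of U.\<close>
  obtain g where g: "bij_betw g S {0..<card S}" using ex_bij_betw_finite_nat[OF S(1)] by blast
  define I where "I = embed_pmf (\<lambda>s. if s \<in> S then c s else 0)"
  have pI: "pmf I s = (if s \<in> S then c s else 0)" for s
    unfolding I_def
  proof (rule pmf_embed_pmf)
    have "(\<integral>\<^sup>+ x. ennreal (if x \<in> S then c x else 0) \<partial>count_space UNIV) = (\<Sum>x\<in>S. ennreal (if x \<in> S then c x else 0))"
      by (rule nn_integral_count_space'[OF S(1)]) auto
    also have "\<dots> = ennreal (sum c S)" using S by (subst sum_ennreal[symmetric]) auto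
    finally show "(\<integral>\<^sup>+ x. ennreal (if x \<in> S then c x else 0) \<partial>count_space UNIV) = 1" by (simp add: S)
  qed (use S in auto)
  have setI: "set_pmf I \<subseteq> S" by (auto simp: set_pmf_iff pI split: if_splits)
  define J where "J = bind_pmf I (\<lambda>s. map_pmf (\<lambda>(x, y). (x, y, g s)) (q s))"
  have "set_pmf J \<subseteq> UNIV \<times> UNIV \<times> g ` S" using setI by (auto simp: J_def)
  then have fin: "finite (set_pmf J)" by (rule finite_subset) (use S in auto)
  have mU: "map_pmf coordU J = map_pmf g I"
    by (simp add: J_def map_bind_pmf map_pmf_comp case_prod_unfold map_pmf_const) (simp add: map_pmf_def)
  have pJ: "pmf J (x, y, g s) = c s * pmf (q s) (x, y)" if "s \<in> S" for x y s
  proof -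
    have inj: "inj (\<lambda>(x :: 'x, y :: 'y). (x, y, g s))" for s by (auto simp: inj_on_def)
    have "pmf J (x, y, g s) = expct I (\<lambda>s'. pmf (map_pmf (\<lambda>(x, y). (x, y, g s')) (q s')) (x, y, g s))"
      by (simp add: J_def pmf_bind)
    also have "\<dots> = expct I (\<lambda>s'. pmf (q s) (x, y) * indicator {s} s')"
    proof (rule expectation_cong_pmf)
      fix s' assume "s' \<in> set_pmf I"
      then have s': "s' \<in> S" using setI by auto
      show "pmf (map_pmf (\<lambda>(x, y). (x, y, g s')) (q s')) (x, y, g s) = pmf (q s) (x, y) * indicator {s} s'"
      proof (cases "s' = s")
        case True
        then show ?thesis using pmf_map_inj'[OF inj[of s], of "q s" "(x, y)"] by simp
      next
        case False
        then have "g s \<noteq> g s'" using g s' that by (auto simp: bij_betw_def inj_on_def)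
        then show ?thesis using False by (auto simp: pmf_eq_0_set_pmf)
      qed
    qed
    also have "\<dots> = c s * pmf (q s) (x, y)" using that pI[of s] by (simp add: pmf.rep_eq)
    finally show ?thesis .
  qed
  have c_pos: "pmf (map_pmf coordU J) (g s) = c s" if "s \<in> S" for s
  proof -
    have "pmf (map_pmf g I) (g s) = pmf I s"
    proof (cases "s \<in> set_pmf I")
      case True
      then show ?thesis
        by (intro pmf_map_inj) (use g setI in \<open>auto simp: bij_betw_def inj_on_def\<close>)
    next
      case False
      then have "g s \<notin> g ` set_pmf I" using g that setI by (auto simp: bij_betw_def inj_on_def)
      then show ?thesis using False by (metis pmf_eq_0_set_pmf set_map_pmf)
    qed
    then show ?thesis using that pI by (simp add: mU)
  qed
  let ?W = "coordU ` set_pmf J"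
  have W: "?W = g ` set_pmf I" using mU by (metis set_map_pmf)
  \<comment> \<open>Given U = \<open>g s\<close>, the law of (X, Y) is \<open>q s\<close>. Points of
    weight zero are not values of U and are excluded.\<close>
  have cond: "map_pmf coordXY (cond_pmf J (coordU -` {g s})) = q s" if "s \<in> set_pmf I" for s
  proof (rule pmf_eqI)
    fix z :: "'x \<times> 'y"
    have sS: "s \<in> S" using that setI by auto
    have u: "g s \<in> ?W" using that W by auto
    have inj: "inj (\<lambda>z :: 'x \<times> 'y \<times> nat. (coordXY z, coordU z))" by (auto simp: inj_on_def)
    have "pmf (map_pmf coordXY (cond_pmf J (coordU -` {g s}))) z = pmf (map_pmf (\<lambda>z. (coordXY z, coordU z)) J) (z, g s) / pmf (map_pmf coordU J) (g s)"
      by (rule pmf_map_cond_pmf[OF u])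
    also have "\<dots> = pmf J (fst z, snd z, g s) / c s"
      using pmf_map_inj'[OF inj, of J "(fst z, snd z, g s)"] by (simp add: c_pos[OF sS])
    also have "\<dots> = pmf (q s) z"
    proof -
      have "c s \<noteq> 0" using that pI sS by (auto simp: set_pmf_iff)
      then show ?thesis by (simp add: pJ[OF sS])
    qed
    finally show "pmf (map_pmf coordXY (cond_pmf J (coordU -` {g s}))) z = pmf (q s) z" .
  qed
  have injI: "inj_on g (set_pmf I)" using g setI by (auto simp: bij_betw_def inj_on_def)
  have sum_eq: "ent J (\<lambda>z. (A (coordXY z), coordU z)) - ent J coordU = (\<Sum>s\<in>S. c s * ent (q s) A)" for A :: "'x \<times> 'y \<Rightarrow> 'b"
  proof -
    have "ent J (\<lambda>z. (A (coordXY z), coordU z)) - ent J coordU = (\<Sum>u\<in>g ` set_pmf I. pmf (map_pmf coordU J) u * ent (cond_pmf J (coordU -` {u})) (\<lambda>z. A (coordXY z)))"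
      by (subst ent_cond_eq_sum[OF fin]) (simp only: W)
    also have "\<dots> = (\<Sum>s\<in>set_pmf I. pmf (map_pmf coordU J) (g s) * ent (cond_pmf J (coordU -` {g s})) (\<lambda>z. A (coordXY z)))"
      by (subst sum.reindex[OF injI]) simp
    also have "\<dots> = (\<Sum>s\<in>set_pmf I. c s * ent (q s) A)"
      by (intro sum.cong refl arg_cong2[where f="(*)"] c_pos)
         (use setI in \<open>auto simp: cond[symmetric] ent_map\<close>)
    also have "\<dots> = (\<Sum>s\<in>S. c s * ent (q s) A)"
      by (intro sum.mono_neutral_left S setI) (auto simp: set_pmf_iff pI)
    finally show ?thesis .
  qed
  have vec: "pvec (map_pmf coordXY J) = (\<Sum>s\<in>S. c s *\<^sub>R pvec (q s))"
  proof (subst vec_eq_iff, intro allI)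
    fix z
    have "map_pmf coordXY J = bind_pmf I q"
      by (simp add: J_def map_bind_pmf map_pmf_comp case_prod_unfold)
    then have "pmf (map_pmf coordXY J) z = expct I (\<lambda>s. pmf (q s) z)"
      by (simp add: pmf_bind)
    also have "\<dots> = (\<Sum>s\<in>S. pmf (q s) z * pmf I s)"
      using S setI by (intro integral_measure_pmf_real) auto
    finally show "pvec (map_pmf coordXY J) $ z = (\<Sum>s\<in>S. c s *\<^sub>R pvec (q s)) $ z"
      by (simp add: pI mult.commute cong: sum.cong)
  qed
  have "w = (\<Sum>s\<in>S. (c s *\<^sub>R pvec (q s), c s * ent (q s) fst, c s * ent (q s) snd, c s * ent (q s) (\<lambda>z. z)))"
  proof -
    have "w = (\<Sum>s\<in>S. c s *\<^sub>R entropies (pvec (q s)))" using S(5) q by (metis (no_types, lifting) sum.cong)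
    then show ?thesis by (simp add: entropies_pvec)
  qed
  also have "\<dots> = (pvec (map_pmf coordXY J), (\<Sum>s\<in>S. c s * ent (q s) fst), (\<Sum>s\<in>S. c s * ent (q s) snd), (\<Sum>s\<in>S. c s * ent (q s) (\<lambda>z. z)))"
    by (simp only: sum_prod vec)
  finally have "w = \<dots>" .
  then show ?thesis 
    using fin sum_eq[of fst] sum_eq[of snd] sum_eq[of "\<lambda>z. z"]
    by (intro exI[of _ J]) (simp add: case_prod_unfold)
qed

text \<open>\<open>H(Y|X,U) \<ge> H(Y|X)\<close> forces the Markov property, by the equality case of Gibbs' inequality.\<close>

lemma profiles_imp_kernel:
  fixes P :: "('x::finite \<times> 'y::finite) pmf"
  assumes w: "(pvec P, a, b, c) \<in> profiles" and markov: "c - a \<ge> ent P (\<lambda>z. z) - ent P fst"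
  shows "\<exists>K. test_kernel K \<and> mutual_info_XU (marginal_X P) K = ent P fst - a \<and> cond_entropy_YU P K = b
    \<and> c - a = ent P (\<lambda>z. z) - ent P fst"
proof -
  obtain J :: "('x \<times> 'y \<times> nat) pmf" where fin: "finite (set_pmf J)" and J: "pvec P = pvec (map_pmf coordXY J)"
     "a = ent J (\<lambda>z. (coordX z, coordU z)) - ent J coordU" "b = ent J (\<lambda>z. (coordY z, coordU z)) - ent J coordU"
     "c = ent J (\<lambda>z. (coordXY z, coordU z)) - ent J coordU"
    using profiles_imp_joint[OF w] by auto
  have "pmf P z = pmf (map_pmf coordXY J) z" for z using J(1) by (metis pvec_nth)
  then have P: "P = map_pmf coordXY J" by (rule pmf_eqI)
  have Q: "map_pmf fst P = map_pmf coordX J" by (simp add: P map_pmf_comp case_prod_unfold)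
  \<comment> \<open>Outside the support of X there is nothing to condition on.
    \<open>return_pmf 0\<close> fills the gap and keeps the alphabet finite.\<close>
  define K where "K = (\<lambda>x. if x \<in> coordX ` set_pmf J then map_pmf coordU (cond_pmf J (coordX -` {x})) else return_pmf 0)"
  have K: "test_kernel K"
    unfolding test_kernel_def
  proof (rule finite_subset)
    show "(\<Union>x. set_pmf (K x)) \<subseteq> insert 0 (coordU ` set_pmf J)"
      by (auto simp: K_def set_cond_pmf[OF cond_pmf_map_disjoint] split: if_splits) force+
    show "finite (insert 0 (coordU ` set_pmf J))" using fin by simp
  qed
  let ?XU = "\<lambda>z. (coordX z, coordU z)"
  have KQ: "pmf (K x) u = pmf (map_pmf ?XU J) (x, u) / pmf (map_pmf coordX J) x" if "x \<in> coordX ` set_pmf J" for x u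
  proof -
    have "pmf (map_pmf (\<lambda>z. (coordU z, coordX z)) J) (u, x) = pmf (map_pmf ?XU J) (x, u)"
    proof -
      have "map_pmf (\<lambda>z. (coordU z, coordX z)) J = map_pmf prod.swap (map_pmf ?XU J)"
        by (simp add: map_pmf_comp)
      moreover have "pmf (map_pmf prod.swap (map_pmf ?XU J)) (prod.swap (x, u)) = pmf (map_pmf ?XU J) (x, u)"
        by (rule pmf_map_inj') (rule inj_swap)
      ultimately show ?thesis by simp
    qed
    then show ?thesis
      using pmf_map_cond_pmf[OF that, of coordU u] that by (simp add: K_def)
  qed
  let ?J = "joint_XYU P K"
  have pos: "pmf P (coordXY z) > 0" "pmf (map_pmf ?XU J) (?XU z) > 0" "pmf (map_pmf coordX J) (coordX z) > 0" if "z \<in> set_pmf J" for z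
    using that pmf_map_pos[OF that, of coordXY] pmf_map_pos[OF that, of ?XU] pmf_map_pos[OF that, of coordX]
    by (simp_all add: P)
  have pJ: "pmf ?J z = pmf P (coordXY z) * (pmf (map_pmf ?XU J) (?XU z) / pmf (map_pmf coordX J) (coordX z))" if "z \<in> set_pmf J" for z
  proof -
    obtain x y u where zz: "z = (x, y, u)" by (cases z)
    have "x \<in> coordX ` set_pmf J" using that zz by force
    then show ?thesis by (simp add: zz pmf_joint_XYU KQ)
  qed
  \<comment> \<open>The cross entropy of \<open>J\<close> relative to its Markov version
    \<open>?J\<close> is H(X,Y) + H(X,U) - H(X). By hypothesis the entropy of \<open>J\<close> is at
    least that, so Gibbs' inequality is tight and \<open>?J = J\<close>.\<close>
  have "expct J (\<lambda>z. - ln (pmf ?J z)) = expct J (\<lambda>z. 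
     - ln (pmf P (coordXY z)) + - ln (pmf (map_pmf ?XU J) (?XU z)) - (- ln (pmf (map_pmf coordX J) (coordX z))))"
  proof (rule expectation_cong_pmf)
    fix z assume z: "z \<in> set_pmf J"
    show "- ln (pmf ?J z) = - ln (pmf P (coordXY z)) + - ln (pmf (map_pmf ?XU J) (?XU z)) - (- ln (pmf (map_pmf coordX J) (coordX z)))"
      using pos[OF z] by (simp only: pJ[OF z] ln_mult_pos ln_divide_pos divide_pos_pos)
  qed
  also have "\<dots> = ent J coordXY + ent J ?XU - ent J coordX"
    unfolding ent_def using fin by (simp add: integrable_measure_pmf_finite P)
  also have "\<dots> = ent P (\<lambda>z. z) + ent J ?XU - ent P fst"
    by (simp add: P ent_map case_prod_unfold)
  also have "\<dots> \<le> ent J (\<lambda>z. (coordXY z, coordU z))"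
    using markov by (simp add: J)
  also have "\<dots> = ent J (\<lambda>z. z)"
    by (rule ent_eqI[OF fin, of _ "\<lambda>((x, y), u). (x, y, u)" _ "\<lambda>z. (coordXY z, coordU z)"]) auto
  finally have ge: "ent J (\<lambda>z. z) \<ge> expct J (\<lambda>z. - ln (pmf ?J z))" .
  have "pmf ?J z = pmf (map_pmf (\<lambda>z. z) J) z" if "z \<in> set_pmf J" for z
  proof (rule ent_eq_cross_imp[OF fin _ _ ge that])
    fix z assume z: "z \<in> set_pmf J"
    show "0 < pmf ?J z" using pos[OF z] by (simp add: pJ[OF z])
  next
    show "sum (pmf ?J) ((\<lambda>z. z) ` set_pmf J) \<le> 1"
      using fin by (simp add: measure_measure_pmf_finite[symmetric])
  qed
  then have eq: "?J = J" by (intro pmf_eq_if_eq_on_set_pmf[OF fin]) simp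
  have "mutual_info_XU (marginal_X P) K = ent P fst - a"
    by (simp add: mutual_info_XU_eq[OF K] eq J)
  moreover have "cond_entropy_YU P K = b"
    by (simp add: cond_entropy_YU_eq[OF K] eq J)
  moreover have "c - a = ent P (\<lambda>z. z) - ent P fst"
    using markov_joint_XYU[OF K, of P] by (simp add: eq J)
  ultimately show ?thesis using K by blast
qed


section \<open>The minimum conditional entropy\<close>

text \<open>Cross entropy relative to \<open>P\<close>. As \<open>ln 0 = 0\<close>, letters outside
  the support of \<open>P\<close> contribute 0 instead of infinity, so that \<open>cross P\<close>
  is linear and continuous. Their mass is controlled by a separate entry of
  \<open>slack\<close>.\<close>

definition cross :: "'a::finite pmf \<Rightarrow> real^'a \<Rightarrow> real" where
  "cross P v = (\<Sum>z\<in>UNIV. v $ z * - ln (pmf P z))"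

definition crossX :: "('x::finite \<times> 'y::finite) pmf \<Rightarrow> real^('x \<times> 'y) \<Rightarrow> real" where
  "crossX P v = (\<Sum>z\<in>UNIV. v $ z * - ln (pmf (map_pmf fst P) (fst z)))"

text \<open>Nonpositive exactly at the profiles of kernels \<open>P(u|x)\<close> with \<open>I(X;U) \<le> Rc\<close> and \<open>H(Y|U) \<le> R2\<close>:
  the last two entries are \<open>I(U;Y|X)\<close> and the divergence of the first component from \<open>P\<close>, up to
  cross entropies.\<close>

definition slack :: "('x::finite \<times> 'y::finite) pmf \<Rightarrow> real \<Rightarrow> real \<Rightarrow> (real^('x \<times> 'y)) \<times> real \<times> real \<times> real \<Rightarrow> real" where
  "slack P Rc R2 = (\<lambda>(v, a, b, c).
     max (\<Sum>z\<in>- set_pmf P. v $ z) (max (b - R2) (max (cross P v - Rc - c)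
       (max (cross P v - crossX P v - (c - a)) (cross P v - (\<Sum>z\<in>UNIV. plogp (v $ z)))))))"

lemma cross_pvec: "cross P (pvec r) = expct r (\<lambda>z. - ln (pmf P z))"
  by (subst integral_measure_pmf_real[of UNIV]) (auto simp: cross_def mult.commute)

lemma crossX_pvec: "crossX P (pvec r) = expct r (\<lambda>z. - ln (pmf (map_pmf fst P) (fst z)))"
  by (subst integral_measure_pmf_real[of UNIV]) (auto simp: crossX_def mult.commute)

lemma sum_plogp_pvec: "(\<Sum>z\<in>UNIV. plogp (pvec r $ z)) = ent r (\<lambda>z. z)"
  by (simp add: ent_finite)

lemma continuous_on_slack: "continuous_on profiles (slack P Rc R2)"
proof -
  have "continuous_on profiles (\<lambda>w. plogp (fst w $ z))" for z
    by (rule continuous_on_compose2[OF continuous_on_plogp]) 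
       (auto intro!: continuous_intros dest!: fst_profiles simp: prob_simplex_def simp del: split_paired_All)
  then show ?thesis
    unfolding slack_def cross_def crossX_def case_prod_unfold
    by (intro continuous_intros continuous_on_max)
qed

text \<open>A minimiser of the continuous \<open>slack\<close> on the compact set has slack at most
  zero. No mass then lies outside the support of \<open>P\<close>, so the equality case of Gibbs'
  inequality identifies the law with \<open>P\<close>. Cross entropies thereby become entropies, and
  the remaining entries are the rate constraints and the Markov property.\<close>

lemma slack_limit:
  fixes P :: "('x::finite \<times> 'y::finite) pmf"
  assumes "\<And>\<eta>. \<eta> > 0 \<Longrightarrow> \<exists>w\<in>profiles. slack P Rc R2 w \<le> \<eta>"
  shows "\<exists>K\<in>admissible_kernels (marginal_X P) Rc. cond_entropy_YU P K \<le> R2"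
proof -
  have "profiles \<noteq> ({} :: ((real^('x \<times> 'y)) \<times> real \<times> real \<times> real) set)"
    using assms[of 1] by auto
  from continuous_attains_inf[OF compact_profiles this continuous_on_slack[of P Rc R2]]
  obtain w where w: "w \<in> profiles" "\<And>w'. w' \<in> profiles \<Longrightarrow> slack P Rc R2 w \<le> slack P Rc R2 w'" by blast
  have "slack P Rc R2 w \<le> 0"
  proof (rule field_le_epsilon)
    fix \<eta> :: real assume "\<eta> > 0"
    then show "slack P Rc R2 w \<le> 0 + \<eta>" using assms[of \<eta>] w(2) by force
  qed
  moreover obtain v a b c where wv: "w = (v, a, b, c)" by (cases w)
  ultimately have s: "(\<Sum>z\<in>- set_pmf P. v $ z) \<le> 0" "b \<le> R2" "cross P v - Rc \<le> c"
    "cross P v - crossX P v \<le> c - a" "cross P v \<le> (\<Sum>z\<in>UNIV. plogp (v $ z))"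
    by (auto simp: slack_def)
  obtain r where r: "v = pvec r" using prob_simplex_imp_pvec fst_profiles[OF w(1)] wv by auto
  have "(\<Sum>z\<in>- set_pmf P. pmf r z) = 0"
    using s(1) by (intro antisym sum_nonneg) (auto simp: r)
  then have "\<forall>z\<in>- set_pmf P. pmf r z = 0" by (subst (asm) sum_nonneg_eq_0_iff) auto
  then have sub: "set_pmf r \<subseteq> set_pmf P" by (auto simp: set_pmf_iff)
  have "pmf P z = pmf (map_pmf (\<lambda>z. z) r) z" if "z \<in> set_pmf r" for z
  proof (rule ent_eq_cross_imp[OF _ _ _ _ that])
    show "expct r (\<lambda>z. - ln (pmf P z)) \<le> ent r (\<lambda>z. z)"
      using s(5) by (simp only: r cross_pvec sum_plogp_pvec)
    show "0 < pmf P z" if "z \<in> set_pmf r" for z using that sub by (auto simp: pmf_positive_iff)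
    show "sum (pmf P) ((\<lambda>z. z) ` set_pmf r) \<le> 1" by (simp add: measure_measure_pmf_finite[symmetric])
  qed simp
  then have "P = r" by (intro pmf_eq_if_eq_on_set_pmf) auto
  with r have v: "v = pvec P" by simp
  have cr: "cross P v = ent P (\<lambda>z. z)" "crossX P v = ent P fst"
    by (simp_all add: v cross_pvec crossX_pvec ent_def)
  have "(pvec P, a, b, c) \<in> profiles" using w(1) wv v by simp
  from profiles_imp_kernel[OF this] s(4) cr
  obtain K where K: "test_kernel K" "mutual_info_XU (marginal_X P) K = ent P fst - a" "cond_entropy_YU P K = b"
    "c - a = ent P (\<lambda>z. z) - ent P fst" by auto
  then have "K \<in> admissible_kernels (marginal_X P) Rc"
    using s(3) cr by (simp add: admissible_kernels_def)
  then show ?thesis using K s(2) by auto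
qed

text \<open>Feeds kernels that are optimal up to \<eta> into \<open>slack_limit\<close>.\<close>

lemma kernel_slack:
  fixes P :: "('x::finite \<times> 'y::finite) pmf"
  assumes K: "K \<in> admissible_kernels (marginal_X P) Rc" and le: "cond_entropy_YU P K \<le> R2 + \<eta>" and "\<eta> \<ge> 0"
  shows "\<exists>w\<in>profiles. slack P Rc R2 w \<le> \<eta>"
proof -
  have "test_kernel K" and I: "mutual_info_XU (marginal_X P) K \<le> Rc" using K by (auto simp: admissible_kernels_def)
  from kernel_profile[OF this(1)] show ?thesis
  proof (rule rev_bexI)
    have "cross P (pvec P) = ent P (\<lambda>z. z)" "crossX P (pvec P) = ent P fst"
      by (simp_all add: cross_pvec crossX_pvec ent_def)
    moreover have "(\<Sum>z\<in>- set_pmf P. pmf P z) = 0" by (rule sum.neutral) (auto simp: pmf_eq_0_set_pmf)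
    ultimately show "slack P Rc R2 (pvec P, ent P fst - mutual_info_XU (marginal_X P) K, cond_entropy_YU P K, 
       ent P fst - mutual_info_XU (marginal_X P) K + (ent P (\<lambda>z. z) - ent P fst)) \<le> \<eta>"
      using I le \<open>\<eta> \<ge> 0\<close> by (simp add: slack_def sum_plogp_pvec[simplified])
  qed
qed

definition hmin :: "('x \<times> 'y) pmf \<Rightarrow> real \<Rightarrow> real" where
  "hmin P Rc = (LEAST h. h \<in> cond_entropy_YU P ` admissible_kernels (marginal_X P) Rc)"

lemma ent_fst_eq_coordX: "ent P fst = ent (joint_XYU P K) coordX"
proof -
  have "ent P fst = ent (map_pmf coordXY (joint_XYU P K)) fst" by (simp add: map_coordXY_joint_XYU)
  then show ?thesis by (simp add: ent_map case_prod_unfold)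
qed

lemma ent_eq_coordXY: "ent P (\<lambda>z. z) = ent (joint_XYU P K) coordXY"
proof -
  have "ent P (\<lambda>z. z) = ent (map_pmf coordXY (joint_XYU P K)) (\<lambda>z. z)" by (simp add: map_coordXY_joint_XYU)
  then show ?thesis by (simp only: ent_map)
qed

lemma const_kernel_admissible:
  fixes P :: "('x::finite \<times> 'y::finite) pmf"
  assumes "Rc \<ge> 0"
  shows "(\<lambda>_. return_pmf 0) \<in> admissible_kernels (marginal_X P) Rc"
proof -
  let ?K = "\<lambda>_ :: 'x. return_pmf (0 :: nat)"
  have K: "test_kernel ?K" by (simp add: test_kernel_def)
  note fin = finite_set_joint_XYU[OF K, of P]
  have "ent (joint_XYU P ?K) coordX \<le> ent (joint_XYU P ?K) (\<lambda>z. (coordX z, coordU z))"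
    using ent_comp_le[OF fin, of fst "\<lambda>z. (coordX z, coordU z)"] by simp
  moreover have "ent (joint_XYU P ?K) coordU \<le> ln (card {0 :: nat})"
    by (rule ent_le_ln_card[OF fin]) (auto simp: joint_XYU_def)
  ultimately show ?thesis
    using mutual_info_XU_eq[OF K, of P] ent_fst_eq_coordX[of P ?K] K assms by (simp add: admissible_kernels_def)
qed

lemma cond_entropy_YU_nonneg:
  fixes P :: "('x::finite \<times> 'y::finite) pmf"
  assumes K: "test_kernel K" shows "0 \<le> cond_entropy_YU P K"
  using ent_comp_le[OF finite_set_joint_XYU[OF K, of P], of snd "\<lambda>z. (coordY z, coordU z)"]
  by (simp add: cond_entropy_YU_eq[OF K] case_prod_unfold)

text \<open>\<open>LEAST\<close> on the reals is informative only if a minimum exists. Kernels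
  approaching the infimum give profiles of arbitrarily small slack at \<open>R2 = I\<close>, and
  \<open>slack_limit\<close> returns a kernel that attains it.\<close>

lemma min_attained:
  fixes P :: "('x::finite \<times> 'y::finite) pmf"
  assumes "Rc \<ge> 0"
  shows "\<exists>K\<in>admissible_kernels (marginal_X P) Rc. \<forall>K'\<in>admissible_kernels (marginal_X P) Rc.
     cond_entropy_YU P K \<le> cond_entropy_YU P K'"
proof -
  let ?A = "admissible_kernels (marginal_X P) Rc"
  define I where "I = Inf (cond_entropy_YU P ` ?A)"
  have ne: "cond_entropy_YU P ` ?A \<noteq> {}" using const_kernel_admissible[OF assms, of P] by blast
  have bdd: "bdd_below (cond_entropy_YU P ` ?A)"
    by (rule bdd_belowI[of _ 0]) (auto simp: admissible_kernels_def cond_entropy_YU_nonneg)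
  have "\<exists>w\<in>profiles. slack P Rc I w \<le> \<eta>" if "\<eta> > 0" for \<eta>
  proof -
    have "\<exists>x\<in>cond_entropy_YU P ` ?A. x < I + \<eta>"
      using cInf_less_iff[OF ne bdd, of "I + \<eta>"] that by (simp add: I_def)
    then obtain K where "K \<in> ?A" "cond_entropy_YU P K < I + \<eta>" by blast
    then show ?thesis using that by (intro kernel_slack[of K]) auto
  qed
  from slack_limit[OF this] obtain K where K: "K \<in> ?A" "cond_entropy_YU P K \<le> I" by blast
  moreover have "I \<le> cond_entropy_YU P K'" if "K' \<in> ?A" for K'
    unfolding I_def using that bdd by (intro cInf_lower) auto
  ultimately show ?thesis by force
qed

lemma hmin_attained:
  fixes P :: "('x::finite \<times> 'y::finite) pmf"
  assumes "Rc \<ge> 0"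
  shows "\<exists>K\<in>admissible_kernels (marginal_X P) Rc. cond_entropy_YU P K = hmin P Rc"
    and "K' \<in> admissible_kernels (marginal_X P) Rc \<Longrightarrow> hmin P Rc \<le> cond_entropy_YU P K'"
proof -
  obtain K where K: "K \<in> admissible_kernels (marginal_X P) Rc" "\<And>K'. K'\<in>admissible_kernels (marginal_X P) Rc \<Longrightarrow>
     cond_entropy_YU P K \<le> cond_entropy_YU P K'" using min_attained[OF assms, of P] by blast
  have "hmin P Rc = cond_entropy_YU P K"
    unfolding hmin_def using K by (intro Least_equality) auto
  then show "\<exists>K\<in>admissible_kernels (marginal_X P) Rc. cond_entropy_YU P K = hmin P Rc"
    and "K' \<in> admissible_kernels (marginal_X P) Rc \<Longrightarrow> hmin P Rc \<le> cond_entropy_YU P K'"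
    using K by auto
qed

lemma xi_eq: "\<xi> (P :: ('x \<times> 'y) pmf) Rc = ln (real CARD('y)) - hmin P Rc"
  by (simp add: \<xi>_def hmin_def)

lemma hmin_le_of_slack:
  fixes P :: "('x::finite \<times> 'y::finite) pmf"
  assumes "Rc \<ge> 0" "\<And>\<eta>. \<eta> > 0 \<Longrightarrow> \<exists>w\<in>profiles. slack P Rc R2 w \<le> \<eta>"
  shows "hmin P Rc \<le> R2"
  using slack_limit[OF assms(2)] hmin_attained(2)[OF assms(1), of _ P] by force

section \<open>Using separability to choose one kernel per marginal\<close>

definition id_kernel :: "'x::finite \<Rightarrow> nat pmf" where "id_kernel x = return_pmf (to_nat x)"

text \<open>With U = X the helper reveals everything: I(X;U) = H(X), and H(Y|U) = H(Y|X) meets the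
  lower bound of \<open>cond_entropy_YU_ge\<close>.\<close>

lemma id_kernel:
  fixes P :: "('x::finite \<times> 'y::finite) pmf"
  shows "test_kernel (id_kernel :: 'x \<Rightarrow> nat pmf)" "mutual_info_XU (marginal_X P) id_kernel = ent P fst"
    "cond_entropy_YU P id_kernel = ent P (\<lambda>z. z) - ent P fst"
proof -
  show K: "test_kernel (id_kernel :: 'x \<Rightarrow> nat pmf)" by (simp add: test_kernel_def id_kernel_def)
  let ?J = "joint_XYU P id_kernel"
  note fin = finite_set_joint_XYU[OF K, of P]
  have supp: "coordU z = to_nat (coordX z)" if "z \<in> set_pmf ?J" for z
    using that by (auto simp: joint_XYU_def id_kernel_def)
  have 1: "ent ?J (\<lambda>z. (coordX z, coordU z)) = ent ?J coordU"
    by (rule ent_eqI[OF fin, of _ snd _ "\<lambda>u. (from_nat u, u)"]) (auto simp: supp)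
  have 2: "ent ?J (\<lambda>z. (coordY z, coordU z)) = ent ?J coordXY"
    by (rule ent_eqI[OF fin, of _ "\<lambda>(y, u). (from_nat u, y)" _ "\<lambda>(x, y). (y, to_nat x)"])
       (use supp in \<open>auto simp: case_prod_unfold\<close>)
  have 3: "ent ?J coordU = ent ?J coordX"
    by (rule ent_eqI[OF fin, of _ from_nat _ to_nat]) (auto simp: supp)
  show "mutual_info_XU (marginal_X P) id_kernel = ent P fst"
    by (simp add: mutual_info_XU_eq[OF K] 1)
  show "cond_entropy_YU P id_kernel = ent P (\<lambda>z. z) - ent P fst"
    unfolding cond_entropy_YU_eq[OF K] 2 3 using ent_eq_coordXY[of P id_kernel] ent_fst_eq_coordX[of P id_kernel] by simp
qed

text \<open>H(Y|U) is at least H(Y|X,U), which equals H(Y|X) by the Markov property.\<close>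

lemma cond_entropy_YU_ge:
  fixes P :: "('x::finite \<times> 'y::finite) pmf"
  assumes K: "test_kernel K" shows "ent P (\<lambda>z. z) - ent P fst \<le> cond_entropy_YU P K"
proof -
  let ?J = "joint_XYU P K"
  note fin = finite_set_joint_XYU[OF K, of P]
  have "ent ?J (\<lambda>z. (coordXY z, coordU z)) = ent ?J (\<lambda>z. (coordY z, (coordX z, coordU z)))"
    by (rule ent_eqI[OF fin, of _ "\<lambda>((x, y), u). (y, (x, u))" _ "\<lambda>(y, (x, u)). ((x, y), u)"]) auto
  then have "ent P (\<lambda>z. z) - ent P fst = ent ?J (\<lambda>z. (coordY z, (coordX z, coordU z))) - ent ?J (\<lambda>z. (coordX z, coordU z))"
    using markov_joint_XYU[OF K, of P] by simp
  also have "\<dots> \<le> ent ?J (\<lambda>z. (coordY z, snd (coordX z, coordU z))) - ent ?J (\<lambda>z. snd (coordX z, coordU z))"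
    by (rule ent_cond_mono[OF fin])
  finally show ?thesis by (simp add: cond_entropy_YU_eq[OF K])
qed

lemma W_optD:
  fixes P :: "('x::finite \<times> 'y::finite) pmf"
  assumes "Rc \<ge> 0" "K \<in> \<W>_opt P Rc"
  shows "K \<in> admissible_kernels (marginal_X P) Rc" "cond_entropy_YU P K = hmin P Rc"
proof -
  show K: "K \<in> admissible_kernels (marginal_X P) Rc"
    using assms(2) by (simp add: \<W>_opt_def is_arg_min_def)
  obtain K' where "K' \<in> admissible_kernels (marginal_X P) Rc" "cond_entropy_YU P K' = hmin P Rc"
    using hmin_attained(1)[OF assms(1), of P] by blast
  then show "cond_entropy_YU P K = hmin P Rc"
    using assms(2) hmin_attained(2)[OF assms(1) K] by (force simp: \<W>_opt_def is_arg_min_def not_less intro: antisym)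
qed

text \<open>Mixing an optimal kernel with the identity kernel raises \<open>I(X;U)\<close> linearly up to \<open>H(X)\<close>
  without increasing \<open>H(Y|U)\<close>.\<close>

lemma W_opt_nonempty:
  fixes P :: "('x::finite \<times> 'y::finite) pmf"
  assumes "Rc \<ge> 0" and le: "Rc \<le> ent P fst"
  shows "\<W>_opt P Rc \<noteq> {}"
proof -
  obtain K0 where K0: "K0 \<in> admissible_kernels (marginal_X P) Rc" "cond_entropy_YU P K0 = hmin P Rc"
    using hmin_attained(1)[OF assms(1), of P] by blast
  define H where "H = ent P fst"
  define D where "D = ent P (\<lambda>z. z) - ent P fst"
  define I0 where "I0 = mutual_info_XU (marginal_X P) K0"
  have k0: "test_kernel K0" and I0: "I0 \<le> Rc" using K0 by (auto simp: admissible_kernels_def I0_def)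
  \<comment> \<open>The weight of the identity kernel is chosen so that I(X;U) becomes exactly
    \<open>Rc\<close>. If \<open>I0 = H\<close>, then \<open>Rc = H\<close> as well and weight 0
    works.\<close>
  have "\<exists>t\<in>{0..1}. (1 - t) * (H - I0) = H - Rc"
  proof (cases "I0 = H")
    case True
    then show ?thesis using I0 le by (intro bexI[of _ 0]) (auto simp: H_def)
  next
    case False
    then have "H - I0 > 0" using I0 le by (simp add: H_def)
    then show ?thesis using I0 le
      by (intro bexI[of _ "1 - (H - Rc) / (H - I0)"]) (auto simp: H_def field_simps)
  qed
  then obtain t where t: "0 \<le> t" "t \<le> 1" "(1 - t) * (H - I0) = H - Rc" by auto
  have "(pvec P, H - I0, hmin P Rc, H - I0 + D) \<in> profiles"
    using kernel_profile[OF k0, of P] K0(2) by (simp add: H_def I0_def D_def)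
  moreover have "(pvec P, 0, D, D) \<in> profiles"
    using kernel_profile[OF id_kernel(1), of P] id_kernel(2,3)[of P] by (simp add: D_def)
  moreover have "convex (profiles :: ((real^('x \<times> 'y)) \<times> real \<times> real \<times> real) set)"
    by (simp add: profiles_def)
  ultimately have "(1 - t) *\<^sub>R (pvec P, H - I0, hmin P Rc, H - I0 + D) + t *\<^sub>R (pvec P, 0, D, D) \<in> profiles"
    using t by (intro convexD) auto
  also have "(1 - t) *\<^sub>R (pvec P, H - I0, hmin P Rc, H - I0 + D) + t *\<^sub>R (pvec P, 0, D, D)
    = (pvec P, H - Rc, (1 - t) * hmin P Rc + t * D, H - Rc + D)"
    using t(3) by (simp add: scaleR_left.add[symmetric] ring_distribs)
  finally have "(pvec P, H - Rc, (1 - t) * hmin P Rc + t * D, H - Rc + D) \<in> profiles" .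
  from profiles_imp_kernel[OF this]
  obtain K where K: "test_kernel K" "mutual_info_XU (marginal_X P) K = Rc" "cond_entropy_YU P K = (1 - t) * hmin P Rc + t * D"
    by (auto simp: D_def H_def)
  have "D \<le> hmin P Rc" using cond_entropy_YU_ge[OF k0, of P] K0(2) by (simp add: D_def)
  then have "cond_entropy_YU P K \<le> hmin P Rc"
    using t mult_left_mono[of D "hmin P Rc" t] by (simp add: K algebra_simps)
  then have "K \<in> \<W>_opt P Rc"
    using K hmin_attained(2)[OF assms(1), of _ P] by (force simp: \<W>_opt_def \<W>_def is_arg_min_def admissible_kernels_def)
  then show ?thesis by blast
qed

text \<open>The helper sees x only and can learn no more than the marginal, so all sources sharing
  it must be served by one kernel. Those to be served are the ones with \<open>hmin\<close> at most
  \<open>h\<close>, and their conditional entropy need not be minimal, only at most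
  \<open>h\<close>.\<close>

lemma common_kernel:
  fixes P :: "nat \<Rightarrow> ('x::finite \<times> 'y::finite) pmf"
  assumes Rc: "Rc \<ge> 0" and sep: "separable m P Rc" and Q: "Q \<in> marginals_X m P"
  shows "\<exists>K. test_kernel K \<and> mutual_info_XU Q K \<le> Rc \<and>
     (\<forall>j\<in>{1..m}. marginal_X (P j) = Q \<longrightarrow> hmin (P j) Rc \<le> h \<longrightarrow> cond_entropy_YU (P j) K \<le> h)"
proof -
  obtain j0 where j0: "j0 \<in> {1..m}" "marginal_X (P j0) = Q" using Q by (auto simp: marginals_X_def)
  have ent_eq: "ent (P j) fst = ent (P j0) fst" if "marginal_X (P j) = Q" for j
  proof -
    have "ent (P j) fst = ent (marginal_X (P j)) (\<lambda>z. z)" for j by (simp add: marginal_X_def ent_map)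
    then show ?thesis using that j0 by simp
  qed
  show ?thesis
  proof (cases "Rc \<le> ent (P j0) fst")
    \<comment> \<open>Above H(X) no kernel has I(X;U) = \<open>Rc\<close>, so separability is
      vacuous; the identity kernel is then optimal for all sources at once.\<close>
    case False
    have "cond_entropy_YU (P j) id_kernel \<le> h" if "marginal_X (P j) = Q" "hmin (P j) Rc \<le> h" for j
    proof -
      obtain K where "K \<in> admissible_kernels (marginal_X (P j)) Rc" "cond_entropy_YU (P j) K = hmin (P j) Rc"
        using hmin_attained(1)[OF Rc, of "P j"] by blast
      then have "cond_entropy_YU (P j) id_kernel \<le> hmin (P j) Rc"
        using cond_entropy_YU_ge[of K "P j"] by (simp add: id_kernel admissible_kernels_def)
      then show ?thesis using that by simp
    qed
    then show ?thesis using False id_kernel(2)[of "P j0"] j0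
      by (intro exI[of _ id_kernel]) (auto simp: id_kernel(1))
  next
    case True
    have ne: "\<W>_opt (P j) Rc \<noteq> {}" if "marginal_X (P j) = Q" for j
      using W_opt_nonempty[OF Rc, of "P j"] True ent_eq[OF that] by simp
    show ?thesis
    proof (cases "(\<Inter>i \<in> \<FF> m P Q. \<W>_opt (P i) Rc) = {}")
      case False
      then obtain K where K: "\<And>i. i \<in> \<FF> m P Q \<Longrightarrow> K \<in> \<W>_opt (P i) Rc" by blast
      show ?thesis
        using W_optD[OF Rc K] j0 by (intro exI[of _ K]) (auto simp: \<FF>_def admissible_kernels_def)
    next
      case inter: True
      obtain js where js: "set js = \<FF> m P Q" "\<And>K. K \<in> \<O> m P Q Rc \<Longrightarrow>
           sorted (map (\<lambda>i. ln (real CARD('y)) - cond_entropy_YU (P i) K) js)"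
        using sep Q unfolding separable_def by blast
      show ?thesis
      proof (cases "\<exists>t<length js. hmin (P (js ! t)) Rc \<le> h")
        case False
        have "\<not> hmin (P j) Rc \<le> h" if "j \<in> {1..m}" "marginal_X (P j) = Q" for j
        proof -
          have "j \<in> set js" using that by (simp add: js \<FF>_def)
          then show ?thesis using False by (auto simp: in_set_conv_nth)
        qed
        then show ?thesis using const_kernel_admissible[OF Rc, of "P j0"] j0
          by (intro exI[of _ "\<lambda>_. return_pmf 0"]) (auto simp: admissible_kernels_def)
      next
        case True
        \<comment> \<open>A kernel optimal for the first source in the enumeration with
          \<open>hmin\<close> at most \<open>h\<close> suffices: sources behind it have no larger
          H(Y|U) under this kernel, and those before it have \<open>hmin\<close> above
          \<open>h\<close>.\<close>
        define t where "t = (LEAST t. t < length js \<and> hmin (P (js ! t)) Rc \<le> h)"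
        have t: "t < length js" "hmin (P (js ! t)) Rc \<le> h"
          using LeastI_ex[OF True] by (auto simp: t_def)
        have tF: "js ! t \<in> \<FF> m P Q" using t js(1) nth_mem by blast
        then obtain K where K: "K \<in> \<W>_opt (P (js ! t)) Rc" using ne by (auto simp: \<FF>_def)
        have "K \<in> \<O> m P Q Rc" using inter tF K by (auto simp: \<O>_def)
        note sorted = js(2)[OF this]
        have "cond_entropy_YU (P j) K \<le> h" if "j \<in> {1..m}" "marginal_X (P j) = Q" "hmin (P j) Rc \<le> h" for j
        proof -
          have "j \<in> set js" using that by (simp add: js \<FF>_def)
          then obtain u where u: "u < length js" "js ! u = j" by (auto simp: in_set_conv_nth)
          have "t \<le> u" unfolding t_def by (rule Least_le) (use u that in auto)
          then have "cond_entropy_YU (P j) K \<le> cond_entropy_YU (P (js ! t)) K"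
            using sorted_nth_mono[OF sorted, of t u] u t by simp
          also have "\<dots> = hmin (P (js ! t)) Rc" by (rule W_optD[OF Rc K])
          finally show ?thesis using t by simp
        qed
        moreover have "K \<in> admissible_kernels Q Rc" using W_optD(1)[OF Rc K] tF by (simp add: \<FF>_def)
        ultimately show ?thesis by (intro exI[of _ K]) (auto simp: admissible_kernels_def)
      qed
    qed
  qed
qed


section \<open>The strong converse\<close>

lemma pmf_replicate_pmf:
  "pmf (replicate_pmf n p) z = (if length z = n then \<Prod>t<n. pmf p (z ! t) else 0)"
proof (induction n arbitrary: z)
  case 0
  then show ?case by (auto simp: indicator_def)
next
  case (Suc n)
  have eq: "replicate_pmf (Suc n) p = map_pmf (\<lambda>(x, xs). x # xs) (pair_pmf p (replicate_pmf n p))"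
    by (simp add: pair_pmf_def map_bind_pmf)
  show ?case
  proof (cases z)
    case Nil
    then show ?thesis by (simp add: pmf_eq_0_set_pmf set_replicate_pmf del: replicate_pmf.simps)
  next
    case (Cons a l)
    have "inj (\<lambda>(x, xs). x # xs :: 'a list)" by (auto simp: inj_on_def)
    from pmf_map_inj'[OF this, of "pair_pmf p (replicate_pmf n p)" "(a, l)"]
    have "pmf (replicate_pmf (Suc n) p) z = pmf p a * pmf (replicate_pmf n p) l"
      unfolding eq Cons by (simp add: pmf_pair)
    then show ?thesis unfolding Suc.IH
      by (auto simp: Cons prod.lessThan_Suc_shift simp del: replicate_pmf.simps prod.lessThan_Suc)
  qed
qed

lemma finite_set_replicate_pmf:
  fixes p :: "'a::finite pmf" shows "finite (set_pmf (replicate_pmf n p))"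
proof (rule finite_subset)
  show "set_pmf (replicate_pmf n p) \<subseteq> {xs. set xs \<subseteq> UNIV \<and> length xs = n}"
    by (auto simp: set_replicate_pmf)
qed (rule finite_lists_length_eq, simp)

lemma ln_pmf_replicate_pmf:
  assumes "z \<in> set_pmf (replicate_pmf n p)"
  shows "- ln (pmf (replicate_pmf n p) z) = (\<Sum>t<n. - ln (pmf p (z ! t)))"
proof -
  have z: "length z = n" "\<And>t. t < n \<Longrightarrow> z ! t \<in> set_pmf p"
    using assms by (auto simp: set_replicate_pmf in_lists_conv_set)
  have "ln (\<Prod>t<n. pmf p (z ! t)) = (\<Sum>t<n. ln (pmf p (z ! t)))"
  proof (rule ln_prod)
    show "pmf p (z ! t) \<noteq> 0" if "t \<in> {..<n}" for t
      using that z(2) by (simp add: set_pmf_iff)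
  qed simp
  then show ?thesis by (simp add: pmf_replicate_pmf z sum_negf)
qed

lemma expectation_sum_pmf:
  fixes f :: "'i \<Rightarrow> 'a \<Rightarrow> real"
  assumes "finite (set_pmf p)"
  shows "expct p (\<lambda>z. \<Sum>t\<in>I. f t z) = (\<Sum>t\<in>I. expct p (f t))"
  using assms by (intro Bochner_Integration.integral_sum) (auto intro: integrable_measure_pmf_finite)

text \<open>Against a product law the cross entropy splits into letters. The lemma is used with the
  marginal of X and with the time-averaged letter law.\<close>

lemma ent_list_le_cross:
  assumes fin: "finite (set_pmf p)" and sub: "f ` set_pmf p \<subseteq> set_pmf (replicate_pmf n r)"
  shows "ent p f \<le> (\<Sum>t<n. expct p (\<lambda>z. - ln (pmf r (f z ! t))))"
proof -
  have "ent p f \<le> expct p (\<lambda>z. - ln (pmf (replicate_pmf n r) (f z)))"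
  proof (rule ent_le_cross[OF fin])
    show "0 < pmf (replicate_pmf n r) (f z)" if "z \<in> set_pmf p" for z
      using that sub by (auto simp: pmf_positive_iff)
    show "sum (pmf (replicate_pmf n r)) (f ` set_pmf p) \<le> 1"
      using fin by (simp add: measure_measure_pmf_finite[symmetric])
  qed
  also have "\<dots> = expct p (\<lambda>z. \<Sum>t<n. - ln (pmf r (f z ! t)))"
    by (rule expectation_cong_pmf) (use sub in \<open>auto intro: ln_pmf_replicate_pmf\<close>)
  also have "\<dots> = (\<Sum>t<n. expct p (\<lambda>z. - ln (pmf r (f z ! t))))"
    by (rule expectation_sum_pmf[OF fin])
  finally show ?thesis .
qed

text \<open>The chain rule for a word given \<open>M\<close>. Positions start at 0, so
  \<open>take t\<close> is the strict past of position \<open>t\<close>.\<close>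

lemma ent_chain_list:
  assumes fin: "finite (set_pmf p)" and len: "\<And>z. z \<in> set_pmf p \<Longrightarrow> length (f z) = n"
  shows "(\<Sum>t<n. ent p (\<lambda>z. (f z ! t, (M z, take t (f z)))) - ent p (\<lambda>z. (M z, take t (f z))))
    = ent p (\<lambda>z. (M z, f z)) - ent p M"
proof -
  let ?g = "\<lambda>t. ent p (\<lambda>z. (M z, take t (f z)))"
  have step: "ent p (\<lambda>z. (f z ! t, (M z, take t (f z)))) = ?g (Suc t)" if "t < n" for t
  proof (rule ent_eqI[OF fin, of _ "\<lambda>(a, (m, l)). (m, l @ [a])" _ "\<lambda>(m, l). (last l, (m, butlast l))"])
    fix z assume "z \<in> set_pmf p"
    then have "take (Suc t) (f z) = take t (f z) @ [f z ! t]"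
      using len that by (intro take_Suc_conv_app_nth) auto
    then show "(M z, take (Suc t) (f z)) = (case (f z ! t, (M z, take t (f z))) of (a, (m, l)) \<Rightarrow> (m, l @ [a]))"
      "(f z ! t, (M z, take t (f z))) = (case (M z, take (Suc t) (f z)) of (m, l) \<Rightarrow> (last l, (m, butlast l)))"
      by auto
  qed
  have "(\<Sum>t<n. ent p (\<lambda>z. (f z ! t, (M z, take t (f z)))) - ?g t) = (\<Sum>t<n. ?g (Suc t) - ?g t)"
    by (rule sum.cong) (auto simp: step)
  also have "\<dots> = ?g n - ?g 0" by (rule sum_lessThan_telescope)
  also have "?g n = ent p (\<lambda>z. (M z, f z))" by (rule ent_cong) (use len in auto)
  also have "?g 0 = ent p M" by (rule ent_eqI[OF fin, of _ fst _ "\<lambda>m. (m, [])"]) auto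
  finally show ?thesis .
qed

text \<open>The law of the source conditioned on correct decoding, single-letterised with
  \<open>U\<^sub>t = (message, z\<^sub>1 \<dots> z\<^sub>t\<^sub>-\<^sub>1)\<close> and uniform \<open>t\<close>.\<close>

lemma code_profile:
  fixes P :: "('x::finite \<times> 'y::finite) pmf"
  assumes C: "is_wak_code n C" and n: "n > 0" and err: "wak_error (replicate_pmf n P) C < 1"
  shows "\<exists>w\<in>profiles. slack P (ln (card (msgs1 C)) / n) (ln (card (msgs2 C)) / n) w
     \<le> - ln (1 - wak_error (replicate_pmf n P) C) / n"
proof -
  let ?S = "replicate_pmf n P"
  define D where "D = {z. dec C (enc1 C (map fst z), enc2 C (map snd z)) = map snd z}"
  define \<delta> where "\<delta> = measure_pmf.prob ?S D"
  have "wak_error ?S C = measure_pmf.prob ?S (- D)"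
    by (simp add: wak_error_def D_def Collect_neg_eq)
  also have "\<dots> = 1 - \<delta>" unfolding \<delta>_def by (subst measure_pmf.prob_compl[symmetric]) (auto simp: Compl_eq_Diff_UNIV)
  finally have \<delta>: "1 - wak_error ?S C = \<delta>" by simp
  then have \<delta>_pos: "\<delta> > 0" using err by simp
  have ne: "set_pmf ?S \<inter> D \<noteq> {}"
  proof
    assume "set_pmf ?S \<inter> D = {}"
    then have "\<delta> = 0" unfolding \<delta>_def by (subst measure_pmf_zero_iff) auto
    then show False using \<delta>_pos by simp
  qed
  define p where "p = cond_pmf ?S D"
  have set_p: "set_pmf p = set_pmf ?S \<inter> D" by (simp add: p_def set_cond_pmf[OF ne])
  then have fin: "finite (set_pmf p)" using finite_set_replicate_pmf by auto
  have len: "length z = n" and let': "\<And>t. t < n \<Longrightarrow> z ! t \<in> set_pmf P" and zD: "z \<in> D" and zS: "z \<in> set_pmf ?S"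
    if "z \<in> set_pmf p" for z
    using that by (auto simp: set_p set_replicate_pmf in_lists_conv_set)
  define M where "M z = enc1 C (map fst z)" for z :: "('x \<times> 'y) list"
  define M2 where "M2 z = enc2 C (map snd z)" for z :: "('x \<times> 'y) list"
  define U where "U t z = (M z, take t z)" for t z
  have ent_M: "ent p M \<le> ln (card (msgs1 C))"
    by (rule ent_le_ln_card[OF fin]) (use C len in \<open>auto simp: is_wak_code_def M_def\<close>)
  have ent_M2: "ent p M2 \<le> ln (card (msgs2 C))"
    by (rule ent_le_ln_card[OF fin]) (use C len in \<open>auto simp: is_wak_code_def M2_def\<close>)
  define a where "a t = ent p (\<lambda>z. (fst (z ! t), U t z)) - ent p (U t)" for t
  define b where "b t = ent p (\<lambda>z. (snd (z ! t), U t z)) - ent p (U t)" for t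
  define c where "c t = ent p (\<lambda>z. (z ! t, U t z)) - ent p (U t)" for t
  define v where "v = (1 / real n) *\<^sub>R (\<Sum>t<n. pvec (map_pmf (\<lambda>z. z ! t) p))"
  let ?w = "(v, (1 / n) * (\<Sum>t<n. a t), (1 / n) * (\<Sum>t<n. b t), (1 / n) * (\<Sum>t<n. c t))"
  have "(\<Sum>t<n. (1 / real n) *\<^sub>R (pvec (map_pmf (\<lambda>z. z ! t) p), a t, b t, c t)) \<in> profiles"
    unfolding profiles_def
  proof (intro convex_sum convex_convex_hull)
    fix t
    show "(pvec (map_pmf (\<lambda>z. z ! t) p), a t, b t, c t) \<in> convex hull (entropies ` prob_simplex)"
      using rv_in_profiles[OF fin, of "\<lambda>z. z ! t" "U t"] by (simp add: a_def b_def c_def profiles_def)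
  qed (use n in auto)
  also have "(\<Sum>t<n. (1 / real n) *\<^sub>R (pvec (map_pmf (\<lambda>z. z ! t) p), a t, b t, c t)) = ?w"
    by (simp add: sum_prod v_def scaleR_sum_right sum_distrib_left sum_divide_distrib)
  finally have w: "?w \<in> profiles" .
  have lin: "(\<Sum>z\<in>UNIV. v $ z * F z) = (\<Sum>t<n. expct p (\<lambda>z. F (z ! t))) / n" for F :: "'x \<times> 'y \<Rightarrow> real"
  proof -
    have "expct p (\<lambda>z. F (z ! t)) = (\<Sum>z\<in>UNIV. pvec (map_pmf (\<lambda>z. z ! t) p) $ z * F z)" for t
    proof -
      have "expct p (\<lambda>z. F (z ! t)) = expct (map_pmf (\<lambda>z. z ! t) p) F" by simp
      also have "\<dots> = (\<Sum>z\<in>UNIV. F z * pmf (map_pmf (\<lambda>z. z ! t) p) z)"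
        by (rule integral_measure_pmf_real) auto
      finally show ?thesis by (simp add: mult.commute)
    qed
    then have "(\<Sum>t<n. expct p (\<lambda>z. F (z ! t))) = (\<Sum>z\<in>UNIV. \<Sum>t<n. pvec (map_pmf (\<lambda>z. z ! t) p) $ z * F z)"
      by (simp only:) (rule sum.swap)
    also have "\<dots> = n * (\<Sum>z\<in>UNIV. v $ z * F z)"
      using n by (simp add: v_def sum_distrib_right sum_distrib_left)
    finally show ?thesis using n by simp
  qed
  obtain r where r: "v = pvec r"
    using prob_simplex_imp_pvec fst_profiles[OF w] by auto
  \<comment> \<open>Conditioning on \<open>D\<close> divides probabilities by \<delta>, so the
    entropy falls short of the cross entropy by exactly -ln \<delta>. This is the only loss, and it
    is spread over n letters.\<close>
  have ent_p: "ent p (\<lambda>z. z) = n * cross P v + ln \<delta>"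
  proof -
    have "ent p (\<lambda>z. z) = expct p (\<lambda>z. (\<Sum>t<n. - ln (pmf P (z ! t))) + ln \<delta>)"
      unfolding ent_def
    proof (rule expectation_cong_pmf)
      fix z assume z: "z \<in> set_pmf p"
      have "pmf p z = pmf ?S z / \<delta>" using zD[OF z] by (simp add: p_def pmf_cond[OF ne] \<delta>_def)
      moreover have "pmf ?S z > 0" using zS[OF z] by (simp add: pmf_positive_iff)
      ultimately have "- ln (pmf p z) = - ln (pmf ?S z) + ln \<delta>"
        using \<delta>_pos by (simp add: ln_divide_pos)
      then show "- ln (pmf (map_pmf (\<lambda>z. z) p) z) = (\<Sum>t<n. - ln (pmf P (z ! t))) + ln \<delta>"
        by (simp only: ln_pmf_replicate_pmf[OF zS[OF z]] map_pmf_ident)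
    qed
    also have "\<dots> = (\<Sum>t<n. expct p (\<lambda>z. - ln (pmf P (z ! t)))) + ln \<delta>"
      using fin by (subst expectation_sum_pmf[OF fin, symmetric]) (simp add: integrable_measure_pmf_finite)
    finally show ?thesis using n lin[of "\<lambda>z. - ln (pmf P z)"] by (simp add: cross_def)
  qed
  have sum_c: "(\<Sum>t<n. c t) = ent p (\<lambda>z. z) - ent p M"
  proof -
    have "(\<Sum>t<n. c t) = ent p (\<lambda>z. (M z, z)) - ent p M"
      unfolding c_def U_def by (rule ent_chain_list[OF fin len])
    also have "ent p (\<lambda>z. (M z, z)) = ent p (\<lambda>z. z)"
      by (rule ent_eqI[OF fin, of _ snd _ "\<lambda>z. (M z, z)"]) auto
    finally show ?thesis .
  qed
  \<comment> \<open>\<open>U\<close> contains whole past letters (x, y). Keeping only one component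
    of them cannot decrease the conditional entropy, and the chain rule then applies to that
    component alone.\<close>
  have proj: "(\<Sum>t<n. ent p (\<lambda>z. (h (z ! t), U t z)) - ent p (U t)) \<le> ent p (\<lambda>z. (M z, map h z)) - ent p M" for h :: "'x \<times> 'y \<Rightarrow> 'b"
  proof -
    have "(\<Sum>t<n. ent p (\<lambda>z. (h (z ! t), U t z)) - ent p (U t))
      \<le> (\<Sum>t<n. ent p (\<lambda>z. (map h z ! t, (M z, take t (map h z)))) - ent p (\<lambda>z. (M z, take t (map h z))))"
    proof (rule sum_mono)
      fix t assume t: "t \<in> {..<n}"
      have "ent p (\<lambda>z. (h (z ! t), U t z)) - ent p (U t) \<le> ent p (\<lambda>z. (h (z ! t), (\<lambda>(m, l). (m, map h l)) (U t z))) - ent p (\<lambda>z. (\<lambda>(m, l). (m, map h l)) (U t z))"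
        by (rule ent_cond_mono[OF fin])
      also have "ent p (\<lambda>z. (h (z ! t), (\<lambda>(m, l). (m, map h l)) (U t z))) = ent p (\<lambda>z. (map h z ! t, (M z, take t (map h z))))"
        by (rule ent_cong) (use t len in \<open>auto simp: U_def take_map\<close>)
      also have "ent p (\<lambda>z. (\<lambda>(m, l). (m, map h l)) (U t z)) = ent p (\<lambda>z. (M z, take t (map h z)))"
        by (rule ent_cong) (auto simp: U_def take_map)
      finally show "ent p (\<lambda>z. (h (z ! t), U t z)) - ent p (U t) \<le> ent p (\<lambda>z. (map h z ! t, (M z, take t (map h z)))) - ent p (\<lambda>z. (M z, take t (map h z)))" .
    qed
    also have "\<dots> = ent p (\<lambda>z. (M z, map h z)) - ent p M"
      by (rule ent_chain_list[OF fin]) (use len in auto)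
    finally show ?thesis .
  qed
  have sum_a: "(\<Sum>t<n. a t) \<le> ent p (map fst) - ent p M"
  proof -
    have "ent p (\<lambda>z. (M z, map fst z)) = ent p (map fst)"
      by (rule ent_eqI[OF fin, of _ snd _ "\<lambda>x. (enc1 C x, x)"]) (auto simp: M_def)
    then show ?thesis using proj[of fst] by (simp add: a_def)
  qed
  \<comment> \<open>Under \<open>p\<close> decoding is always correct, so the two messages determine
    the word y and its entropy given \<open>M\<close> is at most that of the second message.\<close>
  have sum_b: "(\<Sum>t<n. b t) \<le> ln (card (msgs2 C))"
  proof -
    have "ent p (\<lambda>z. (M z, map snd z)) = ent p (\<lambda>z. (\<lambda>(m, m2). (m, dec C (m, m2))) (M z, M2 z))"
      by (rule ent_cong) (use zD in \<open>auto simp: D_def M_def M2_def\<close>)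
    also have "\<dots> \<le> ent p (\<lambda>z. (M z, M2 z))" by (rule ent_comp_le[OF fin])
    also have "\<dots> \<le> ent p M + ent p M2" by (rule ent_pair_le[OF fin])
    finally show ?thesis using proj[of snd] ent_M2 by (simp add: b_def)
  qed
  have ent_X: "ent p (map fst) \<le> n * crossX P v"
  proof -
    have "ent p (map fst) \<le> (\<Sum>t<n. expct p (\<lambda>z. - ln (pmf (map_pmf fst P) (map fst z ! t))))"
    proof (rule ent_list_le_cross[OF fin])
      show "map fst ` set_pmf p \<subseteq> set_pmf (replicate_pmf n (map_pmf fst P))"
        using zS by (force simp: set_replicate_pmf in_lists_conv_set)
    qed
    also have "\<dots> = (\<Sum>t<n. expct p (\<lambda>z. - ln (pmf (map_pmf fst P) (fst (z ! t)))))"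
      by (intro sum.cong refl expectation_cong_pmf) (simp add: len)
    finally show ?thesis using n lin[of "\<lambda>z. - ln (pmf (map_pmf fst P) (fst z))"] by (simp add: crossX_def)
  qed
  \<comment> \<open>The time-averaged law \<open>r\<close> as single-letter reference bounds the
    divergence of \<open>r\<close> from \<open>P\<close>; this makes the letter law converge to
    \<open>P\<close>.\<close>
  have ent_r: "ent p (\<lambda>z. z) \<le> n * (\<Sum>z\<in>UNIV. plogp (v $ z))"
  proof -
    have rpos: "z ! t \<in> set_pmf r" if z: "z \<in> set_pmf p" and t: "t < n" for z t
    proof -
      have "0 < pmf (map_pmf (\<lambda>z. z ! t) p) (z ! t)" by (rule pmf_map_pos[OF z])
      also have "\<dots> \<le> (\<Sum>s<n. pmf (map_pmf (\<lambda>z. z ! s) p) (z ! t))"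
        by (rule member_le_sum) (use t in auto)
      finally have "pmf r (z ! t) > 0" 
        using n arg_cong[OF r, of "\<lambda>v. v $ (z ! t)"] 
        by (simp add: v_def) (metis divide_pos_pos of_nat_0_less_iff)
      then show ?thesis by (simp add: pmf_positive_iff)
    qed
    have "ent p (\<lambda>z. z) \<le> (\<Sum>t<n. expct p (\<lambda>z. - ln (pmf r (z ! t))))"
    proof (rule ent_list_le_cross[OF fin])
      show "(\<lambda>z. z) ` set_pmf p \<subseteq> set_pmf (replicate_pmf n r)"
        using rpos len by (auto simp: set_replicate_pmf in_lists_conv_set in_set_conv_nth simp del: split_paired_All) metis+
    qed
    also have "\<dots> = n * (\<Sum>z\<in>UNIV. v $ z * - ln (pmf r z))"
      using n lin[of "\<lambda>z. - ln (pmf r z)"] by simp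
    finally show ?thesis by (simp add: r plogp_def)
  qed
  have off: "(\<Sum>z\<in>- set_pmf P. v $ z) = 0"
  proof (rule sum.neutral, rule ballI)
    fix z assume z: "z \<in> - set_pmf P"
    have "pmf (map_pmf (\<lambda>z. z ! t) p) z = 0" if "t < n" for t
      using let' that z by (auto simp: pmf_eq_0_set_pmf)
    then show "v $ z = 0" by (simp add: v_def)
  qed
  have "ln \<delta> \<le> 0" using \<delta>_pos by (simp add: \<delta>_def)
  have nn: "real n > 0" using n by simp
  have 1: "(1 / n) * (\<Sum>t<n. b t) - ln (card (msgs2 C)) / n \<le> - ln \<delta> / n"
    using divide_right_mono[OF sum_b, of "real n"] divide_nonpos_nonneg[OF \<open>ln \<delta> \<le> 0\<close>, of "real n"] nn by simp
  have 2: "cross P v - ln (card (msgs1 C)) / n - (1 / n) * (\<Sum>t<n. c t) \<le> - ln \<delta> / n"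
  proof -
    have "cross P v - ln (card (msgs1 C)) / n - (1 / n) * (\<Sum>t<n. c t)
      = (n * cross P v - ln (card (msgs1 C)) - (\<Sum>t<n. c t)) / n"
      using nn by (simp add: diff_divide_distrib)
    also have "\<dots> \<le> - ln \<delta> / n"
      using sum_c ent_p ent_M by (intro divide_right_mono) auto
    finally show ?thesis .
  qed
  have 3: "cross P v - crossX P v - ((1 / n) * (\<Sum>t<n. c t) - (1 / n) * (\<Sum>t<n. a t)) \<le> - ln \<delta> / n"
  proof -
    have "cross P v - crossX P v - ((1 / n) * (\<Sum>t<n. c t) - (1 / n) * (\<Sum>t<n. a t))
      = (n * cross P v - n * crossX P v - ((\<Sum>t<n. c t) - (\<Sum>t<n. a t))) / n"
      using nn by (simp add: diff_divide_distrib)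
    also have "\<dots> \<le> - ln \<delta> / n"
      using sum_c ent_p sum_a ent_X by (intro divide_right_mono) auto
    finally show ?thesis .
  qed
  have 4: "cross P v - (\<Sum>z\<in>UNIV. plogp (v $ z)) \<le> - ln \<delta> / n"
  proof -
    have "cross P v - (\<Sum>z\<in>UNIV. plogp (v $ z)) = (n * cross P v - n * (\<Sum>z\<in>UNIV. plogp (v $ z))) / n"
      using nn by (simp add: diff_divide_distrib)
    also have "\<dots> \<le> - ln \<delta> / n"
      using ent_r ent_p by (intro divide_right_mono) auto
    finally show ?thesis .
  qed
  have "0 \<le> - ln \<delta> / n" using divide_nonpos_nonneg[OF \<open>ln \<delta> \<le> 0\<close>, of "real n"] by simp
  with 1 2 3 4 off have "slack P (ln (card (msgs1 C)) / n) (ln (card (msgs2 C)) / n) ?w \<le> - ln \<delta> / n"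
    unfolding slack_def prod.case by (intro max.boundedI) simp_all
  then show ?thesis unfolding \<delta> using w by blast
qed

text \<open>One code of some positive length for each \<eta> suffices, rather than a sequence of
  codes: in a mixture, the source that a code serves may change with n.\<close>

lemma strong_converse:
  fixes P :: "('x::finite \<times> 'y::finite) pmf"
  assumes "Rc \<ge> 0"
    and codes: "\<And>\<eta>. \<eta> > 0 \<Longrightarrow> \<exists>n>0. \<exists>C. is_wak_code n C \<and> ln (card (msgs1 C)) / n \<le> Rc + \<eta> \<and>
      ln (card (msgs2 C)) / n \<le> R2 + \<eta> \<and> wak_error (replicate_pmf n P) C < 1 \<and>
      - ln (1 - wak_error (replicate_pmf n P) C) / n \<le> \<eta>"
  shows "hmin P Rc \<le> R2"
proof (rule hmin_le_of_slack[OF assms(1)])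
  fix \<eta> :: real assume \<eta>: "\<eta> > 0"
  then obtain n and C :: "('x, 'y) wak_code" where C: "n > 0" "is_wak_code n C" "ln (card (msgs1 C)) / n \<le> Rc + \<eta> / 2"
    "ln (card (msgs2 C)) / n \<le> R2 + \<eta> / 2" "wak_error (replicate_pmf n P) C < 1" 
    "- ln (1 - wak_error (replicate_pmf n P) C) / n \<le> \<eta> / 2"
    using codes[of "\<eta> / 2"] by auto
  obtain w where w: "w \<in> profiles" "slack P (ln (card (msgs1 C)) / n) (ln (card (msgs2 C)) / n) w \<le> \<eta> / 2"
    using code_profile[OF C(2,1,5)] C(6) by (meson order_trans)
  obtain v a b c where "w = (v, a, b, c)" by (cases w)
  with w have "(v, a, b, c) \<in> profiles" and 
    s: "slack P (ln (card (msgs1 C)) / n) (ln (card (msgs2 C)) / n) (v, a, b, c) \<le> \<eta> / 2"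
    by simp_all
  moreover have "slack P Rc R2 (v, a, b, c) \<le> \<eta>"
    using s C(3,4) \<eta> unfolding slack_def prod.case max.bounded_iff by (intro conjI) linarith+
  ultimately show "\<exists>w\<in>profiles. slack P Rc R2 w \<le> \<eta>" by blast
qed


section \<open>Greedy covering and binning\<close>

lemma exists_le_average:
  fixes q f :: "'a \<Rightarrow> real"
  assumes "finite A" "\<And>a. a \<in> A \<Longrightarrow> q a \<ge> 0" "sum q A = 1"
  shows "\<exists>a\<in>A. f a \<le> (\<Sum>a\<in>A. q a * f a)"
proof (rule ccontr)
  let ?S = "\<Sum>a\<in>A. q a * f a"
  assume "\<not> ?thesis"
  then have gt: "f a > ?S" if "a \<in> A" for a using that by (auto simp: not_le)
  have "(\<Sum>a\<in>A. q a * (f a - ?S)) = 0"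
    using assms(3) by (simp add: right_diff_distrib sum_subtractf sum_distrib_right[symmetric])
  moreover have nn: "q a * (f a - ?S) \<ge> 0" if "a \<in> A" for a
    using assms(2)[OF that] gt[OF that] by simp
  ultimately have "\<forall>a\<in>A. q a * (f a - ?S) = 0"
    using assms(1) by (subst (asm) sum_nonneg_eq_0_iff) auto
  then have "\<forall>a\<in>A. q a = 0" using gt by force
  then show False using assms(3) by simp
qed

text \<open>Convexity of \<open>exp\<close>: its tangent at -pt lies below it at 0 and at -t, and
  these two bounds are averaged with weights 1 - p and p.\<close>

lemma exp_convex_bound:
  fixes p t :: real
  assumes "0 \<le> p" "p \<le> 1"
  shows "exp (- (p * t)) \<le> 1 - p + p * exp (- t)"
proof -
  define e where "e = exp (- (p * t))"
  have e: "e > 0" by (simp add: e_def)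
  have 1: "e * (1 + p * t) \<le> 1"
  proof -
    have "e * (1 + p * t) \<le> e * exp (p * t)" using e exp_ge_add_one_self[of "p * t"] by simp
    then show ?thesis by (simp add: e_def exp_minus)
  qed
  have 2: "e * (1 + (p * t - t)) \<le> exp (- t)"
  proof -
    have "e * (1 + (p * t - t)) \<le> e * exp (p * t - t)" using e exp_ge_add_one_self[of "p * t - t"] by simp
    also have "\<dots> = exp (- t)" by (simp add: e_def exp_add[symmetric])
    finally show ?thesis .
  qed
  have "e = (1 - p) * (e * (1 + p * t)) + p * (e * (1 + (p * t - t)))" by (simp add: algebra_simps)
  also have "\<dots> \<le> (1 - p) * 1 + p * exp (- t)"
    using assms 1 2 by (intro add_mono mult_left_mono) auto
  finally show ?thesis by (simp add: e_def)
qed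

text \<open>The right-hand side is the expected uncovered weight for \<open>M\<close> independent
  codewords drawn from \<open>q\<close>. Choosing them one at a time, each at least as good as the
  average, derandomises this.\<close>

lemma greedy_cover:
  fixes w :: "'a \<Rightarrow> real" and q :: "'u \<Rightarrow> real"
  assumes "finite X" "finite A" and w: "\<And>x. x \<in> X \<Longrightarrow> w x \<ge> 0"
    and q: "\<And>u. u \<in> A \<Longrightarrow> q u \<ge> 0" "sum q A = 1"
  shows "\<exists>cs. set cs \<subseteq> A \<and> length cs = M \<and>
    (\<Sum>x\<in>X. w x * of_bool (\<forall>u\<in>set cs. (x, u) \<notin> G)) \<le> (\<Sum>x\<in>X. w x * (\<Sum>u\<in>A. q u * of_bool ((x, u) \<notin> G)) ^ M)"
  using w
proof (induction M arbitrary: w)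
  case 0
  then show ?case by simp
next
  case (Suc M)
  let ?b = "\<lambda>x. \<Sum>u\<in>A. q u * of_bool ((x, u) \<notin> G)"
  have b: "?b x \<ge> 0" for x using q by (intro sum_nonneg) auto
  \<comment> \<open>The factor \<open>?b x\<close> in the weight is the chance that the codeword
    still to be chosen misses \<open>x\<close>.\<close>
  obtain cs where cs: "set cs \<subseteq> A" "length cs = M"
    "(\<Sum>x\<in>X. (w x * ?b x) * of_bool (\<forall>u\<in>set cs. (x, u) \<notin> G)) \<le> (\<Sum>x\<in>X. (w x * ?b x) * ?b x ^ M)"
    using Suc.IH[of "\<lambda>x. w x * ?b x"] Suc.prems b by auto
  define f where "f u = (\<Sum>x\<in>X. w x * of_bool (\<forall>u\<in>set cs. (x, u) \<notin> G) * of_bool ((x, u) \<notin> G))" for u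
  obtain u where u: "u \<in> A" "f u \<le> (\<Sum>u\<in>A. q u * f u)"
    using exists_le_average[OF assms(2) q] by blast
  have "(\<Sum>x\<in>X. w x * of_bool (\<forall>v\<in>set (u # cs). (x, v) \<notin> G)) = f u"
    unfolding f_def by (intro sum.cong refl) auto
  also have "\<dots> \<le> (\<Sum>u\<in>A. q u * f u)" by (rule u)
  also have "\<dots> = (\<Sum>x\<in>X. (w x * ?b x) * of_bool (\<forall>u\<in>set cs. (x, u) \<notin> G))"
    unfolding f_def sum_distrib_left by (subst sum.swap) (simp add: sum_distrib_left sum_distrib_right ac_simps)
  also have "\<dots> \<le> (\<Sum>x\<in>X. (w x * ?b x) * ?b x ^ M)" by (rule cs)
  also have "\<dots> = (\<Sum>x\<in>X. w x * ?b x ^ Suc M)" by (simp add: ac_simps)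
  finally show ?case using u cs by (intro exI[of _ "u # cs"]) auto
qed

text \<open>If p and a are the masses of the good \<open>u\<close> for \<open>x\<close> under
  \<kappa> and \<open>q\<close>, then p \<le> \<Gamma> a. Thus (1 - a)^M is at most
  exp(-pM/\<Gamma>), and \<open>exp_convex_bound\<close> separates the missing \<kappa>-mass 1 - p
  from exp(-M/\<Gamma>).\<close>

lemma covering:
  fixes w :: "'a \<Rightarrow> real" and q :: "'u \<Rightarrow> real" and \<kappa> :: "'a \<Rightarrow> 'u \<Rightarrow> real"
  assumes fin: "finite X" "finite A" and w: "\<And>x. x \<in> X \<Longrightarrow> w x \<ge> 0" and w1: "sum w X = 1"
    and q: "\<And>u. u \<in> A \<Longrightarrow> q u \<ge> 0" "sum q A = 1"
    and \<kappa>: "\<And>x u. x \<in> X \<Longrightarrow> u \<in> A \<Longrightarrow> \<kappa> x u \<ge> 0" "\<And>x. x \<in> X \<Longrightarrow> sum (\<kappa> x) A = 1"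
    and \<Gamma>: "\<Gamma> > 0" and G: "\<And>x u. x \<in> X \<Longrightarrow> u \<in> A \<Longrightarrow> (x, u) \<in> G \<Longrightarrow> \<kappa> x u \<le> \<Gamma> * q u"
  shows "\<exists>cs. set cs \<subseteq> A \<and> length cs = M \<and>
    (\<Sum>x\<in>X. w x * of_bool (\<forall>u\<in>set cs. (x, u) \<notin> G))
      \<le> (\<Sum>x\<in>X. \<Sum>u\<in>A. w x * \<kappa> x u * of_bool ((x, u) \<notin> G)) + exp (- (M / \<Gamma>))"
proof -
  obtain cs where cs: "set cs \<subseteq> A" "length cs = M"
    "(\<Sum>x\<in>X. w x * of_bool (\<forall>u\<in>set cs. (x, u) \<notin> G)) \<le> (\<Sum>x\<in>X. w x * (\<Sum>u\<in>A. q u * of_bool ((x, u) \<notin> G)) ^ M)"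
    using greedy_cover[OF fin, of w q M G] w q by auto
  have "(\<Sum>x\<in>X. w x * (\<Sum>u\<in>A. q u * of_bool ((x, u) \<notin> G)) ^ M)
    \<le> (\<Sum>x\<in>X. w x * ((\<Sum>u\<in>A. \<kappa> x u * of_bool ((x, u) \<notin> G)) + exp (- (M / \<Gamma>))))"
  proof (intro sum_mono mult_left_mono w)
    fix x assume x: "x \<in> X"
    define a where "a = (\<Sum>u\<in>A. q u * of_bool ((x, u) \<in> G))"
    define p where "p = (\<Sum>u\<in>A. \<kappa> x u * of_bool ((x, u) \<in> G))"
    have a: "(\<Sum>u\<in>A. q u * of_bool ((x, u) \<notin> G)) = 1 - a"
      unfolding a_def q(2)[symmetric] sum_subtractf[symmetric] by (intro sum.cong refl) auto
    have p: "(\<Sum>u\<in>A. \<kappa> x u * of_bool ((x, u) \<notin> G)) = 1 - p"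
      unfolding p_def \<kappa>(2)[OF x, symmetric] sum_subtractf[symmetric] by (intro sum.cong refl) auto
    have p0: "p \<ge> 0" unfolding p_def using \<kappa>(1)[OF x] by (intro sum_nonneg) auto
    have "1 - p \<ge> 0" unfolding p[symmetric] using \<kappa>(1)[OF x] by (intro sum_nonneg) auto
    then have p1: "p \<le> 1" by simp
    have a1: "1 - a \<ge> 0" unfolding a[symmetric] using q by (intro sum_nonneg) auto
    have "p \<le> (\<Sum>u\<in>A. \<Gamma> * q u * of_bool ((x, u) \<in> G))"
      unfolding p_def using G[OF x] by (intro sum_mono) (auto simp: of_bool_def)
    also have "\<dots> = \<Gamma> * a" by (simp add: a_def sum_distrib_left ac_simps)
    finally have pa: "p / \<Gamma> \<le> a" using \<Gamma> by (simp add: field_simps)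
    have "(1 - a) ^ M \<le> exp (- a) ^ M"
      using a1 exp_ge_add_one_self[of "- a"] by (intro power_mono) auto
    also have "\<dots> = exp (- (M * a))" by (simp add: exp_of_nat_mult[symmetric])
    also have "\<dots> \<le> exp (- (p * (M / \<Gamma>)))"
      using mult_left_mono[OF pa, of "real M"] by (simp add: ac_simps)
    also have "\<dots> \<le> 1 - p + p * exp (- (M / \<Gamma>))" by (rule exp_convex_bound[OF p0 p1])
    also have "\<dots> \<le> 1 - p + exp (- (M / \<Gamma>))" using p1 mult_right_mono[OF p1, of "exp (- (M / \<Gamma>))"] by simp
    finally show "(\<Sum>u\<in>A. q u * of_bool ((x, u) \<notin> G)) ^ M \<le> (\<Sum>u\<in>A. \<kappa> x u * of_bool ((x, u) \<notin> G)) + exp (- (M / \<Gamma>))"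
      by (simp add: a p)
  qed
  also have "\<dots> = (\<Sum>x\<in>X. \<Sum>u\<in>A. w x * \<kappa> x u * of_bool ((x, u) \<notin> G)) + exp (- (M / \<Gamma>))"
    using w1 by (simp add: distrib_left sum.distrib sum_distrib_left sum_distrib_right[symmetric] mult.assoc)
  finally show ?thesis using cs by (intro exI[of _ cs] conjI) (assumption | erule (1) order_trans)+
qed

text \<open>Random bins collide with probability 1/N. Each new element is put into the bin with the
  least added cost, which is at most the average; \<open>c\<close> need not be symmetric, so both
  orders are charged.\<close>

lemma greedy_binning:
  fixes c :: "'b \<Rightarrow> 'b \<Rightarrow> real"
  assumes "finite B" and N: "N > 0" and c: "\<And>y y'. c y y' \<ge> 0"
  shows "\<exists>f. (\<forall>y. f y < (N :: nat)) \<and>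
     (\<Sum>y\<in>B. \<Sum>y'\<in>B - {y}. c y y' * of_bool (f y = f y')) \<le> (\<Sum>y\<in>B. \<Sum>y'\<in>B - {y}. c y y') / N"
  using assms(1)
proof (induction B rule: finite_induct)
  case empty
  then show ?case using N by (intro exI[of _ "\<lambda>_. 0"]) simp
next
  case (insert b B)
  have split: "(\<Sum>y\<in>insert b B. \<Sum>y'\<in>insert b B - {y}. g y y') = (\<Sum>y\<in>B. g b y + g y b) + (\<Sum>y\<in>B. \<Sum>y'\<in>B - {y}. g y y')"
    for g :: "'b \<Rightarrow> 'b \<Rightarrow> real"
  proof -
    have "(\<Sum>y\<in>insert b B. \<Sum>y'\<in>insert b B - {y}. g y y') = (\<Sum>y'\<in>insert b B - {b}. g b y') + (\<Sum>y\<in>B. \<Sum>y'\<in>insert b B - {y}. g y y')"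
      using insert by simp
    also have "insert b B - {b} = B" using insert by auto
    also have "(\<Sum>y\<in>B. \<Sum>y'\<in>insert b B - {y}. g y y') = (\<Sum>y\<in>B. g y b + (\<Sum>y'\<in>B - {y}. g y y'))"
    proof (rule sum.cong[OF refl])
      fix y assume y: "y \<in> B"
      then have "insert b B - {y} = insert b (B - {y})" using insert by auto
      then show "(\<Sum>y'\<in>insert b B - {y}. g y y') = g y b + (\<Sum>y'\<in>B - {y}. g y y')" using insert by simp
    qed
    finally show ?thesis by (simp add: sum.distrib)
  qed
  obtain f where f: "\<And>y. f y < N" "(\<Sum>y\<in>B. \<Sum>y'\<in>B - {y}. c y y' * of_bool (f y = f y')) \<le> (\<Sum>y\<in>B. \<Sum>y'\<in>B - {y}. c y y') / N"
    using insert.IH by blast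
  define g where "g j = (\<Sum>y\<in>B. (c b y + c y b) * of_bool (f y = j))" for j
  have "\<exists>j\<in>{..<N}. g j \<le> (\<Sum>j<N. (1 / N) * g j)"
    using N by (intro exists_le_average) auto
  then obtain j where j: "j < N" "g j \<le> (\<Sum>j<N. (1 / N) * g j)" by auto
  have "(\<Sum>j<N. (1 / N) * g j) = (\<Sum>j<N. g j) / N" by (simp add: sum_divide_distrib)
  also have "(\<Sum>j<N. g j) = (\<Sum>y\<in>B. \<Sum>j<N. (c b y + c y b) * of_bool (f y = j))"
    unfolding g_def by (rule sum.swap)
  also have "\<dots> = (\<Sum>y\<in>B. c b y + c y b)"
  proof (rule sum.cong[OF refl])
    fix y
    have "(\<Sum>j<N. (c b y + c y b) * of_bool (f y = j)) = (\<Sum>j<N. if f y = j then c b y + c y b else 0)"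
      by (intro sum.cong) auto
    then show "(\<Sum>j<N. (c b y + c y b) * of_bool (f y = j)) = c b y + c y b" using f(1)[of y] by simp
  qed
  finally have gj: "g j \<le> (\<Sum>y\<in>B. c b y + c y b) / N" using j by simp
  let ?f = "f(b := j)"
  have "(\<Sum>y\<in>B. c b y * of_bool (?f b = ?f y) + c y b * of_bool (?f y = ?f b)) = g j"
    unfolding g_def by (intro sum.cong refl) (use insert.hyps in \<open>auto simp: of_bool_def\<close>)
  moreover have "(\<Sum>y\<in>B. \<Sum>y'\<in>B - {y}. c y y' * of_bool (?f y = ?f y')) = (\<Sum>y\<in>B. \<Sum>y'\<in>B - {y}. c y y' * of_bool (f y = f y'))"
  proof (rule sum.cong[OF refl], rule sum.cong[OF refl])
    fix y y' assume "y \<in> B" "y' \<in> B - {y}"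
    then have "y \<noteq> b" "y' \<noteq> b" using insert.hyps by auto
    then show "c y y' * of_bool (?f y = ?f y') = c y y' * of_bool (f y = f y')" by simp
  qed
  ultimately have "(\<Sum>y\<in>insert b B. \<Sum>y'\<in>insert b B - {y}. c y y' * of_bool (?f y = ?f y')) \<le> (\<Sum>y\<in>insert b B. \<Sum>y'\<in>insert b B - {y}. c y y') / N"
    unfolding split using gj f(2) by (simp add: add_divide_distrib)
  then show ?case using f(1) j(1) by (intro exI[of _ ?f]) auto
qed

section \<open>A one-shot achievability bound\<close>

text \<open>The helper describes \<open>x\<close> by a pair \<open>g x = (s, u)\<close>; the list \<open>L s u\<close> contains the \<open>y\<close> that are
  not too unlikely given \<open>u\<close> under some source of class \<open>s\<close>, and the bin index of \<open>y\<close> resolves the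
  list. Codewords \<open>u\<close> are admissible for \<open>x\<close> only if \<open>y\<close> is likely to fall into the list, which
  replaces the Markov lemma.\<close>

lemma one_shot:
  fixes p :: "'j \<Rightarrow> 'a \<Rightarrow> 'b \<Rightarrow> real" and Q :: "'s \<Rightarrow> 'a \<Rightarrow> real" and \<kappa> :: "'s \<Rightarrow> 'a \<Rightarrow> 'u \<Rightarrow> real"
    and cl :: "'j \<Rightarrow> 's" and t :: "'a \<Rightarrow> 's"
    and M N :: nat and \<epsilon>1 \<epsilon>2 \<epsilon>3 :: real
  assumes fin: "finite X" "finite Y" "finite A" "finite J" and Jne: "J \<noteq> {}"
    and p: "\<And>j x y. p j x y \<ge> 0" and pQ: "\<And>j x. j \<in> J \<Longrightarrow> x \<in> X \<Longrightarrow> (\<Sum>y\<in>Y. p j x y) = Q (cl j) x"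
    and Q1: "\<And>s. s \<in> cl ` J \<Longrightarrow> sum (Q s) X = 1"
    and \<kappa>: "\<And>s x u. \<kappa> s x u \<ge> 0" and \<kappa>1: "\<And>s x. s \<in> cl ` J \<Longrightarrow> x \<in> X \<Longrightarrow> sum (\<kappa> s x) A = 1"
    and t: "\<And>x. t x \<in> cl ` J"
    and pos: "\<Gamma> > 0" "\<Lambda> > 0" "\<theta> > 0" "M > 0" "N > 0" and Yne: "Y \<noteq> {}"
    and q_def: "\<And>s u. q s u = (\<Sum>x\<in>X. Q s x * \<kappa> s x u)"
    and r_def: "\<And>j y u. r j y u = (\<Sum>x\<in>X. p j x y * \<kappa> (cl j) x u)"
    and e1_le: "\<And>s. s \<in> cl ` J \<Longrightarrow> (\<Sum>x\<in>X. \<Sum>u\<in>A. Q s x * \<kappa> s x u * of_bool (\<Gamma> * q s u < \<kappa> s x u)) \<le> \<epsilon>1"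
    and e2_le: "\<And>j. j \<in> J \<Longrightarrow> (\<Sum>y\<in>Y. \<Sum>u\<in>A. r j y u * of_bool (\<Lambda> * r j y u < q (cl j) u)) \<le> \<epsilon>2"
    and e3_le: "\<And>s. s \<in> cl ` J \<Longrightarrow> (\<Sum>x\<in>X. Q s x * of_bool (t x \<noteq> s)) \<le> \<epsilon>3"
  shows "\<exists>(g :: 'a \<Rightarrow> 's \<times> 'u) W f D. g \<in> X \<rightarrow> W \<and> finite W \<and> card W \<le> card J * M \<and> (\<forall>y. f y < N) \<and>
     (\<forall>w b. D w b \<in> Y) \<and>
     (\<forall>j\<in>J. (\<Sum>x\<in>X. \<Sum>y\<in>Y. p j x y * of_bool (D (g x) (f y) \<noteq> y))
       \<le> \<epsilon>3 + \<epsilon>1 + card J * \<epsilon>2 / \<theta> + exp (- (M / \<Gamma>)) + \<theta> + (real (card J))\<^sup>2 * \<Lambda> / N)"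
proof -
  define e1 where "e1 s = (\<Sum>x\<in>X. \<Sum>u\<in>A. Q s x * \<kappa> s x u * of_bool (\<kappa> s x u > \<Gamma> * q s u))" for s
  define e2 where "e2 j = (\<Sum>y\<in>Y. \<Sum>u\<in>A. r j y u * of_bool (r j y u * \<Lambda> < q (cl j) u))" for j
  define e3 where "e3 s = (\<Sum>x\<in>X. Q s x * of_bool (t x \<noteq> s))" for s
  have "(\<Sum>j\<in>J. e2 j) \<le> (\<Sum>j\<in>J. \<epsilon>2)"
    unfolding e2_def using e2_le by (intro sum_mono) (simp add: mult.commute)
  then have e2_sum: "(\<Sum>j\<in>J. e2 j) / \<theta> \<le> card J * \<epsilon>2 / \<theta>"
    using pos by (intro divide_right_mono) auto
  have q0: "q s u \<ge> 0" if "s \<in> cl ` J" for s u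
  proof -
    have "Q s x \<ge> 0" if "x \<in> X" for x
      using \<open>s \<in> cl ` J\<close> that pQ p by (metis imageE sum_nonneg)
    then show ?thesis unfolding q_def using \<kappa> by (intro sum_nonneg) auto
  qed
  have Q0: "Q s x \<ge> 0" if "s \<in> cl ` J" "x \<in> X" for s x
    using that pQ p by (metis imageE sum_nonneg)
  have q1: "sum (q s) A = 1" if "s \<in> cl ` J" for s
  proof -
    have "sum (q s) A = (\<Sum>x\<in>X. \<Sum>u\<in>A. Q s x * \<kappa> s x u)" unfolding q_def by (rule sum.swap)
    also have "\<dots> = 1" using that Q1 by (simp add: sum_distrib_left[symmetric] \<kappa>1)
    finally show ?thesis .
  qed
  have r0: "r j y u \<ge> 0" for j y u unfolding r_def using p \<kappa> by (intro sum_nonneg) auto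
  have rq: "(\<Sum>y\<in>Y. r j y u) = q (cl j) u" if "j \<in> J" for j u
  proof -
    have "(\<Sum>y\<in>Y. r j y u) = (\<Sum>x\<in>X. \<Sum>y\<in>Y. p j x y * \<kappa> (cl j) x u)" unfolding r_def by (rule sum.swap)
    also have "\<dots> = q (cl j) u" unfolding q_def
      using that by (intro sum.cong refl) (simp add: sum_distrib_right[symmetric] pQ)
    finally show ?thesis .
  qed
  have e2_nonneg: "e2 j \<ge> 0" for j unfolding e2_def using r0 by (intro sum_nonneg) auto
  \<comment> \<open>The condition \<open>r j y u > 0\<close> empties the list at codewords of
    probability zero, where the other inequality would admit every \<open>y\<close>.\<close>
  define L where "L s u = {y \<in> Y. \<exists>j\<in>J. cl j = s \<and> q s u \<le> r j y u * \<Lambda> \<and> r j y u > 0}" for s u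
  \<comment> \<open>Each listed \<open>y\<close> has conditional probability at least 1/\<Lambda>
    given \<open>u\<close> under some source, and each source allows at most \<Lambda> of
    these.\<close>
  have card_L: "card (L s u) \<le> card J * \<Lambda>" if s: "s \<in> cl ` J" for s u
  proof -
    have one: "card {y \<in> Y. q s u \<le> r j y u * \<Lambda> \<and> r j y u > 0} \<le> \<Lambda>" if j: "j \<in> J" "cl j = s" for j
    proof (cases "q s u = 0")
      case True
      then have "(\<Sum>y\<in>Y. r j y u) = 0" using rq[OF j(1), of u] j(2) by simp
      then have "\<forall>y\<in>Y. r j y u = 0"
        using r0 fin by (subst (asm) sum_nonneg_eq_0_iff) auto
      then have "{y \<in> Y. q s u \<le> r j y u * \<Lambda> \<and> r j y u > 0} = {}" by auto
      then show ?thesis using less_imp_le[OF pos(2)] by (simp only: card.empty of_nat_0)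
    next
      case False
      then have qp: "q s u > 0" using q0[OF s, of u] by simp
      have "card {y \<in> Y. q s u \<le> r j y u * \<Lambda> \<and> r j y u > 0} * q s u
        = (\<Sum>y\<in>{y \<in> Y. q s u \<le> r j y u * \<Lambda> \<and> r j y u > 0}. q s u)" by simp
      also have "\<dots> \<le> (\<Sum>y\<in>{y \<in> Y. q s u \<le> r j y u * \<Lambda> \<and> r j y u > 0}. r j y u * \<Lambda>)"
        by (rule sum_mono) auto
      also have "\<dots> \<le> (\<Sum>y\<in>Y. r j y u * \<Lambda>)" using fin r0 pos by (intro sum_mono2) auto
      also have "\<dots> = q s u * \<Lambda>" using rq[OF j(1), of u] j(2) by (simp add: sum_distrib_right[symmetric])
      finally show ?thesis using qp by simp
    qed
    have "L s u = (\<Union>j\<in>{j\<in>J. cl j = s}. {y \<in> Y. q s u \<le> r j y u * \<Lambda> \<and> r j y u > 0})" by (auto simp: L_def)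
    then have "card (L s u) \<le> (\<Sum>j\<in>{j\<in>J. cl j = s}. card {y \<in> Y. q s u \<le> r j y u * \<Lambda> \<and> r j y u > 0})"
      using fin by (simp add: card_UN_le)
    then have "real (card (L s u)) \<le> (\<Sum>j\<in>{j\<in>J. cl j = s}. real (card {y \<in> Y. q s u \<le> r j y u * \<Lambda> \<and> r j y u > 0}))"
      by (simp only: of_nat_sum[symmetric] of_nat_le_iff)
    also have "\<dots> \<le> (\<Sum>j\<in>{j\<in>J. cl j = s}. \<Lambda>)" by (intro sum_mono) (use one in auto)
    also have "\<dots> \<le> (\<Sum>j\<in>J. \<Lambda>)" using fin pos by (intro sum_mono2) auto
    finally show ?thesis by simp
  qed
  define miss where "miss s x u = (\<Sum>j\<in>{j\<in>J. cl j = s}. \<Sum>y\<in>Y. p j x y * of_bool (y \<notin> L s u))" for s x u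
  have miss0: "miss s x u \<ge> 0" for s x u unfolding miss_def using p by (intro sum_nonneg) auto
  \<comment> \<open>The first condition is the change of measure for \<open>covering\<close>. The
    second says that given \<open>x\<close> the list misses \<open>y\<close> with probability at
    most \<theta> under every source of the class.\<close>
  define G where "G s = {(x, u). \<kappa> s x u \<le> \<Gamma> * q s u \<and> miss s x u \<le> \<theta> * Q s x}" for s
  define good where "good s l \<longleftrightarrow> set l \<subseteq> A \<and> length l = M \<and> (\<Sum>x\<in>X. Q s x * of_bool (\<forall>u\<in>set l. (x, u) \<notin> G s))
      \<le> (\<Sum>x\<in>X. \<Sum>u\<in>A. Q s x * \<kappa> s x u * of_bool ((x, u) \<notin> G s)) + exp (- (M / \<Gamma>))" for s l
  have "\<exists>l. good s l" if s: "s \<in> cl ` J" for s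
    unfolding good_def
  proof (rule covering[OF fin(1,3) _ Q1[OF s] _ q1[OF s] _ _ pos(1)])
    show "Q s x \<ge> 0" if "x \<in> X" for x using Q0[OF s that] .
    show "q s u \<ge> 0" for u using q0[OF s] .
    show "\<kappa> s x u \<ge> 0" for x u by (rule \<kappa>)
    show "sum (\<kappa> s x) A = 1" if "x \<in> X" for x using \<kappa>1[OF s that] .
    show "\<kappa> s x u \<le> \<Gamma> * q s u" if "(x, u) \<in> G s" for x u using that by (simp add: G_def)
  qed
  then have "\<forall>s\<in>cl ` J. \<exists>l. good s l" by blast
  from bchoice[OF this] obtain cs where good: "\<forall>s\<in>cl ` J. good s (cs s)" by (rule exE)
  have cs: "set (cs s) \<subseteq> A" "length (cs s) = M" "(\<Sum>x\<in>X. Q s x * of_bool (\<forall>u\<in>set (cs s). (x, u) \<notin> G s))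
      \<le> (\<Sum>x\<in>X. \<Sum>u\<in>A. Q s x * \<kappa> s x u * of_bool ((x, u) \<notin> G s)) + exp (- (M / \<Gamma>))" if s: "s \<in> cl ` J" for s
    using bspec[OF good s] unfolding good_def by simp_all
  \<comment> \<open>Averaged over \<open>x\<close> and \<open>u\<close>, the missed mass is the
    probability under \<open>r\<close> that \<open>y\<close> is too unlikely given
    \<open>u\<close>.\<close>
  have miss_sum: "(\<Sum>x\<in>X. \<Sum>u\<in>A. \<kappa> s x u * miss s x u) \<le> (\<Sum>j\<in>J. e2 j)" if s: "s \<in> cl ` J" for s
  proof -
    have "(\<Sum>x\<in>X. \<Sum>u\<in>A. \<kappa> s x u * miss s x u)
      = (\<Sum>x\<in>X. \<Sum>u\<in>A. \<Sum>j\<in>{j\<in>J. cl j = s}. \<Sum>y\<in>Y. p j x y * \<kappa> s x u * of_bool (y \<notin> L s u))"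
      by (simp add: miss_def sum_distrib_left ac_simps)
    also have "\<dots> = (\<Sum>j\<in>{j\<in>J. cl j = s}. \<Sum>y\<in>Y. \<Sum>u\<in>A. \<Sum>x\<in>X. p j x y * \<kappa> s x u * of_bool (y \<notin> L s u))"
    proof -
      have "(\<Sum>x\<in>X. \<Sum>u\<in>A. \<Sum>j\<in>{j\<in>J. cl j = s}. \<Sum>y\<in>Y. p j x y * \<kappa> s x u * of_bool (y \<notin> L s u))
        = (\<Sum>x\<in>X. \<Sum>j\<in>{j\<in>J. cl j = s}. \<Sum>u\<in>A. \<Sum>y\<in>Y. p j x y * \<kappa> s x u * of_bool (y \<notin> L s u))"
        by (rule sum.cong[OF refl], rule sum.swap)
      also have "\<dots> = (\<Sum>j\<in>{j\<in>J. cl j = s}. \<Sum>x\<in>X. \<Sum>u\<in>A. \<Sum>y\<in>Y. p j x y * \<kappa> s x u * of_bool (y \<notin> L s u))"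
        by (rule sum.swap)
      also have "\<dots> = (\<Sum>j\<in>{j\<in>J. cl j = s}. \<Sum>x\<in>X. \<Sum>y\<in>Y. \<Sum>u\<in>A. p j x y * \<kappa> s x u * of_bool (y \<notin> L s u))"
        by (rule sum.cong[OF refl], rule sum.cong[OF refl], rule sum.swap)
      also have "\<dots> = (\<Sum>j\<in>{j\<in>J. cl j = s}. \<Sum>y\<in>Y. \<Sum>x\<in>X. \<Sum>u\<in>A. p j x y * \<kappa> s x u * of_bool (y \<notin> L s u))"
        by (rule sum.cong[OF refl], rule sum.swap)
      also have "\<dots> = (\<Sum>j\<in>{j\<in>J. cl j = s}. \<Sum>y\<in>Y. \<Sum>u\<in>A. \<Sum>x\<in>X. p j x y * \<kappa> s x u * of_bool (y \<notin> L s u))"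
        by (rule sum.cong[OF refl], rule sum.cong[OF refl], rule sum.swap)
      finally show ?thesis .
    qed
    also have "\<dots> = (\<Sum>j\<in>{j\<in>J. cl j = s}. \<Sum>y\<in>Y. \<Sum>u\<in>A. r j y u * of_bool (y \<notin> L s u))"
      by (intro sum.cong refl) (auto simp: r_def sum_distrib_right)
    also have "\<dots> \<le> (\<Sum>j\<in>{j\<in>J. cl j = s}. e2 j)"
      unfolding e2_def
    proof (intro sum_mono)
      fix j y u assume j: "j \<in> {j\<in>J. cl j = s}" and y: "y \<in> Y"
      show "r j y u * of_bool (y \<notin> L s u) \<le> r j y u * of_bool (r j y u * \<Lambda> < q (cl j) u)"
        using j y r0[of j y u] by (cases "r j y u = 0") (auto simp: L_def of_bool_def not_le less_le)
    qed
    also have "\<dots> \<le> (\<Sum>j\<in>J. e2 j)"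
      using fin e2_nonneg by (intro sum_mono2) auto
    finally show ?thesis .
  qed
  \<comment> \<open>Markov's inequality on \<open>miss\<close> at level \<theta> accounts for the
    pairs outside \<open>G\<close> that violate only its second condition.\<close>
  have uncov: "(\<Sum>x\<in>X. Q s x * of_bool (\<forall>u\<in>set (cs s). (x, u) \<notin> G s)) \<le> e1 s + (\<Sum>j\<in>J. e2 j) / \<theta> + exp (- (M / \<Gamma>))" if s: "s \<in> cl ` J" for s
  proof -
    have "(\<Sum>x\<in>X. \<Sum>u\<in>A. Q s x * \<kappa> s x u * of_bool ((x, u) \<notin> G s)) \<le> (\<Sum>x\<in>X. \<Sum>u\<in>A. Q s x * \<kappa> s x u * of_bool (\<kappa> s x u > \<Gamma> * q s u) + \<kappa> s x u * miss s x u / \<theta>)"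
    proof (intro sum_mono)
      fix x u assume x: "x \<in> X"
      have b: "\<kappa> s x u * miss s x u / \<theta> \<ge> 0" using \<kappa> miss0 pos by simp
      show "Q s x * \<kappa> s x u * of_bool ((x, u) \<notin> G s) \<le> Q s x * \<kappa> s x u * of_bool (\<kappa> s x u > \<Gamma> * q s u) + \<kappa> s x u * miss s x u / \<theta>"
      proof (cases "\<kappa> s x u \<le> \<Gamma> * q s u \<and> miss s x u > \<theta> * Q s x")
        case True
        then have "Q s x \<le> miss s x u / \<theta>" using pos by (simp add: field_simps)
        then have "\<kappa> s x u * Q s x \<le> \<kappa> s x u * (miss s x u / \<theta>)" using \<kappa> by (intro mult_left_mono)
        then show ?thesis using True by (simp add: G_def ac_simps)
      next
        case False
        then show ?thesis using b Q0[OF s x] \<kappa>[of s x u] by (auto simp: G_def not_le not_less)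
      qed
    qed
    also have "\<dots> = e1 s + (\<Sum>x\<in>X. \<Sum>u\<in>A. \<kappa> s x u * miss s x u) / \<theta>"
      by (simp add: e1_def sum.distrib sum_divide_distrib)
    also have "\<dots> \<le> e1 s + (\<Sum>j\<in>J. e2 j) / \<theta>" using miss_sum[OF s] pos by (simp add: divide_right_mono)
    finally show ?thesis using cs(3)[OF s] by linarith
  qed
  define cover where "cover x \<longleftrightarrow> (\<exists>u\<in>set (cs (t x)). (x, u) \<in> G (t x))" for x
  \<comment> \<open>An uncovered \<open>x\<close> still needs a codeword; \<open>hd\<close> supplies
    one since \<open>M > 0\<close>.\<close>
  define u where "u x = (if cover x then SOME u. u \<in> set (cs (t x)) \<and> (x, u) \<in> G (t x) else hd (cs (t x)))" for x
  define g where "g x = (t x, u x)" for x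
  define W where "W = (SIGMA s:cl ` J. set (cs s))"
  have u_cov: "u x \<in> set (cs (t x)) \<and> (x, u x) \<in> G (t x)" if "cover x" for x
  proof -
    have "\<exists>u. u \<in> set (cs (t x)) \<and> (x, u) \<in> G (t x)" using that by (auto simp: cover_def)
    from someI_ex[OF this] show ?thesis using that by (simp add: u_def)
  qed
  have u_in: "u x \<in> set (cs (t x))" for x
  proof (cases "cover x")
    case False
    have "cs (t x) \<noteq> []" using cs(2)[OF t[of x]] pos by auto
    then show ?thesis using False by (simp add: u_def)
  qed (use u_cov in auto)
  have gW: "g \<in> X \<rightarrow> W" using u_in t by (auto simp: g_def W_def)
  have fW: "finite W" using fin by (auto simp: W_def)
  have cW: "card W \<le> card J * M"
  proof -
    have "card W = (\<Sum>s\<in>cl ` J. card (set (cs s)))" unfolding W_def using fin by (intro card_SigmaI) auto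
    also have "\<dots> \<le> (\<Sum>s\<in>cl ` J. M)" by (intro sum_mono) (metis card_length cs(2))
    also have "\<dots> \<le> card J * M" using fin by (simp add: card_image_le)
    finally show ?thesis .
  qed
  define LL where "LL w = L (fst w) (snd w)" for w
  \<comment> \<open>The weight with which \<open>y'\<close> competes with \<open>y\<close>, summed
    over all sources so that one binning serves every one of them.\<close>
  define c where "c y y' = (\<Sum>j\<in>J. \<Sum>x\<in>X. p j x y * of_bool (y' \<in> LL (g x)))" for y y'
  have c0: "c y y' \<ge> 0" for y y' unfolding c_def using p by (intro sum_nonneg) auto
  obtain f where f: "\<And>y. f y < N" "(\<Sum>y\<in>Y. \<Sum>y'\<in>Y - {y}. c y y' * of_bool (f y = f y')) \<le> (\<Sum>y\<in>Y. \<Sum>y'\<in>Y - {y}. c y y') / N"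
    using greedy_binning[OF fin(2) pos(5), of c] c0 by blast
  \<comment> \<open>One factor \<open>card J\<close> comes from summing over the sources, the other
    from the list size.\<close>
  have c_le: "(\<Sum>y\<in>Y. \<Sum>y'\<in>Y - {y}. c y y') \<le> (real (card J))\<^sup>2 * \<Lambda>"
  proof -
    have "(\<Sum>y\<in>Y. \<Sum>y'\<in>Y - {y}. c y y') \<le> (\<Sum>y\<in>Y. \<Sum>y'\<in>Y. c y y')"
      using fin c0 by (intro sum_mono sum_mono2) auto
    also have "\<dots> = (\<Sum>y\<in>Y. \<Sum>j\<in>J. \<Sum>x\<in>X. p j x y * card (LL (g x)))"
    proof (rule sum.cong[OF refl])
      fix y
      have "(\<Sum>y'\<in>Y. c y y') = (\<Sum>j\<in>J. \<Sum>y'\<in>Y. \<Sum>x\<in>X. p j x y * of_bool (y' \<in> LL (g x)))"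
        unfolding c_def by (rule sum.swap)
      also have "\<dots> = (\<Sum>j\<in>J. \<Sum>x\<in>X. \<Sum>y'\<in>Y. p j x y * of_bool (y' \<in> LL (g x)))"
        by (rule sum.cong[OF refl], rule sum.swap)
      also have "\<dots> = (\<Sum>j\<in>J. \<Sum>x\<in>X. p j x y * card (LL (g x)))"
      proof (intro sum.cong refl)
        fix j x
        have "(\<Sum>y'\<in>Y. (of_bool (y' \<in> LL (g x)) :: real)) = card (Y \<inter> {y'. y' \<in> LL (g x)})"
          using fin by (simp add: sum_of_bool_eq)
        also have "Y \<inter> {y'. y' \<in> LL (g x)} = LL (g x)" by (auto simp: LL_def L_def)
        finally show "(\<Sum>y'\<in>Y. p j x y * of_bool (y' \<in> LL (g x))) = p j x y * card (LL (g x))"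
          by (simp add: sum_distrib_left[symmetric])
      qed
      finally show "(\<Sum>y'\<in>Y. c y y') = (\<Sum>j\<in>J. \<Sum>x\<in>X. p j x y * card (LL (g x)))" .
    qed
    also have "\<dots> \<le> (\<Sum>y\<in>Y. \<Sum>j\<in>J. \<Sum>x\<in>X. p j x y * (card J * \<Lambda>))"
      using p card_L t by (intro sum_mono mult_left_mono) (auto simp: LL_def g_def)
    also have "\<dots> = (\<Sum>j\<in>J. \<Sum>y\<in>Y. \<Sum>x\<in>X. p j x y * (card J * \<Lambda>))" by (rule sum.swap)
    also have "\<dots> = (\<Sum>j\<in>J. \<Sum>x\<in>X. \<Sum>y\<in>Y. p j x y * (card J * \<Lambda>))" by (rule sum.cong[OF refl], rule sum.swap)
    also have "\<dots> = (\<Sum>j\<in>J. card J * \<Lambda>)"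
      by (intro sum.cong refl) (simp add: sum_distrib_right[symmetric] pQ Q1)
    finally show ?thesis by (simp add: power2_eq_square)
  qed
  obtain y0 where y0: "y0 \<in> Y" using Yne by blast
  \<comment> \<open>If no listed word lies in the bin, the fixed \<open>y0\<close> is returned, so
    that the decoder is total with values in \<open>Y\<close>.\<close>
  define D where "D w b = (if \<exists>y. y \<in> LL w \<and> f y = b then SOME y. y \<in> LL w \<and> f y = b else y0)" for w b
  have D_some: "D w b \<in> LL w \<and> f (D w b) = b" if "\<exists>y. y \<in> LL w \<and> f y = b" for w b
    using someI_ex[OF that] that by (simp add: D_def)
  have DY: "D w b \<in> Y" for w b
  proof (cases "\<exists>y. y \<in> LL w \<and> f y = b")
    case True
    from D_some[OF this] show ?thesis by (auto simp: LL_def L_def)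
  next
    case False
    then have "D w b = y0" unfolding D_def by (rule if_not_P)
    then show ?thesis using y0 by simp
  qed
  have "(\<Sum>x\<in>X. \<Sum>y\<in>Y. p j x y * of_bool (D (g x) (f y) \<noteq> y))
       \<le> \<epsilon>3 + \<epsilon>1 + card J * \<epsilon>2 / \<theta> + exp (- (M / \<Gamma>)) + \<theta> + (real (card J))\<^sup>2 * \<Lambda> / N" if j: "j \<in> J" for j
  proof -
    have s: "cl j \<in> cl ` J" using j by simp
    have c_ge: "(\<Sum>x\<in>X. p j x y * of_bool (y' \<in> LL (g x))) \<le> c y y'" for y y'
      unfolding c_def
      by (rule member_le_sum[of j J "\<lambda>j. \<Sum>x\<in>X. p j x y * of_bool (y' \<in> LL (g x))"])
         (use j fin p in \<open>auto intro!: sum_nonneg\<close>)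
    \<comment> \<open>An error means that \<open>y\<close> is not in the list or that another list
      element shares its bin; the union bound covers the latter.\<close>
    have "(\<Sum>x\<in>X. \<Sum>y\<in>Y. p j x y * of_bool (D (g x) (f y) \<noteq> y))
      \<le> (\<Sum>x\<in>X. \<Sum>y\<in>Y. p j x y * of_bool (y \<notin> LL (g x)) + (\<Sum>y'\<in>Y - {y}. p j x y * of_bool (y' \<in> LL (g x)) * of_bool (f y = f y')))"
    proof (intro sum_mono)
      fix x y assume y: "y \<in> Y"
      let ?w = "g x"
      show "p j x y * of_bool (D ?w (f y) \<noteq> y) \<le> p j x y * of_bool (y \<notin> LL ?w) + (\<Sum>y'\<in>Y - {y}. p j x y * of_bool (y' \<in> LL ?w) * of_bool (f y = f y'))"
      proof (cases "D ?w (f y) = y \<or> y \<notin> LL ?w")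
        case True
        have "(\<Sum>y'\<in>Y - {y}. p j x y * of_bool (y' \<in> LL ?w) * of_bool (f y = f y')) \<ge> 0" using p by (intro sum_nonneg) auto
        then show ?thesis using True p[of j x y] by auto
      next
        case False
        then have D: "D ?w (f y) \<in> LL ?w" "f (D ?w (f y)) = f y" using D_some[of ?w "f y"] by auto
        have "p j x y * of_bool (D ?w (f y) \<in> LL ?w) * of_bool (f y = f (D ?w (f y))) \<le> (\<Sum>y'\<in>Y - {y}. p j x y * of_bool (y' \<in> LL ?w) * of_bool (f y = f y'))"
          by (rule member_le_sum) (use False DY p fin in auto)
        then show ?thesis using D False by simp
      qed
    qed
    also have "\<dots> = (\<Sum>x\<in>X. \<Sum>y\<in>Y. p j x y * of_bool (y \<notin> LL (g x))) + (\<Sum>y\<in>Y. \<Sum>y'\<in>Y - {y}. (\<Sum>x\<in>X. p j x y * of_bool (y' \<in> LL (g x))) * of_bool (f y = f y'))"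
    proof -
      have "(\<Sum>x\<in>X. \<Sum>y\<in>Y. \<Sum>y'\<in>Y - {y}. p j x y * of_bool (y' \<in> LL (g x)) * of_bool (f y = f y'))
        = (\<Sum>y\<in>Y. \<Sum>x\<in>X. \<Sum>y'\<in>Y - {y}. p j x y * of_bool (y' \<in> LL (g x)) * of_bool (f y = f y'))" by (rule sum.swap)
      also have "\<dots> = (\<Sum>y\<in>Y. \<Sum>y'\<in>Y - {y}. \<Sum>x\<in>X. p j x y * of_bool (y' \<in> LL (g x)) * of_bool (f y = f y'))"
        by (rule sum.cong[OF refl], rule sum.swap)
      finally show ?thesis by (simp add: sum.distrib sum_distrib_right)
    qed
    also have "(\<Sum>y\<in>Y. \<Sum>y'\<in>Y - {y}. (\<Sum>x\<in>X. p j x y * of_bool (y' \<in> LL (g x))) * of_bool (f y = f y'))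
      \<le> (\<Sum>y\<in>Y. \<Sum>y'\<in>Y - {y}. c y y' * of_bool (f y = f y'))"
      by (intro sum_mono mult_right_mono c_ge) auto
    also have "\<dots> \<le> (real (card J))\<^sup>2 * \<Lambda> / N"
      using f(2) divide_right_mono[OF c_le, of "real N"] by simp
    \<comment> \<open>A \<open>y\<close> escapes the list because the class was guessed wrongly,
      because \<open>x\<close> is uncovered, or with conditional probability at most \<theta>
      otherwise.\<close>
    also have "(\<Sum>x\<in>X. \<Sum>y\<in>Y. p j x y * of_bool (y \<notin> LL (g x)))
      \<le> (\<Sum>x\<in>X. Q (cl j) x * of_bool (t x \<noteq> cl j) + Q (cl j) x * of_bool (\<forall>u\<in>set (cs (cl j)). (x, u) \<notin> G (cl j)) + \<theta> * Q (cl j) x)"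
    proof (rule sum_mono)
      fix x assume x: "x \<in> X"
      have nn: "Q (cl j) x \<ge> 0" "\<theta> * Q (cl j) x \<ge> 0" using Q0[OF s x] pos by auto
      have le: "(\<Sum>y\<in>Y. p j x y * of_bool (y \<notin> LL (g x))) \<le> Q (cl j) x"
        unfolding pQ[OF j x, symmetric] using p by (intro sum_mono) (auto simp: of_bool_def)
      show "(\<Sum>y\<in>Y. p j x y * of_bool (y \<notin> LL (g x))) \<le> Q (cl j) x * of_bool (t x \<noteq> cl j) + Q (cl j) x * of_bool (\<forall>u\<in>set (cs (cl j)). (x, u) \<notin> G (cl j)) + \<theta> * Q (cl j) x"
      proof (cases "t x = cl j \<and> cover x")
        case True
        then have "(x, u x) \<in> G (cl j)" using u_cov by metis
        then have "miss (cl j) x (u x) \<le> \<theta> * Q (cl j) x" by (simp add: G_def)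
        moreover have "(\<Sum>y\<in>Y. p j x y * of_bool (y \<notin> LL (g x))) \<le> miss (cl j) x (u x)"
        proof -
          have "LL (g x) = L (cl j) (u x)" using True by (simp add: LL_def g_def)
          then show ?thesis unfolding miss_def
            by (simp only:) (rule member_le_sum[of j "{j'\<in>J. cl j' = cl j}" "\<lambda>j'. \<Sum>y\<in>Y. p j' x y * of_bool (y \<notin> L (cl j) (u x))"],
               use j fin p in \<open>auto intro!: sum_nonneg\<close>)
        qed
        ultimately have "(\<Sum>y\<in>Y. p j x y * of_bool (y \<notin> LL (g x))) \<le> \<theta> * Q (cl j) x" by simp
        moreover have "0 \<le> Q (cl j) x * of_bool (t x \<noteq> cl j)" "0 \<le> Q (cl j) x * of_bool (\<forall>u\<in>set (cs (cl j)). (x, u) \<notin> G (cl j))"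
          using nn by auto
        ultimately show ?thesis by linarith
      next
        case False
        then have "t x \<noteq> cl j \<or> (\<forall>u\<in>set (cs (cl j)). (x, u) \<notin> G (cl j))" by (auto simp: cover_def)
        then show ?thesis using le nn by (auto simp: of_bool_def)
      qed
    qed
    also have "\<dots> = e3 (cl j) + (\<Sum>x\<in>X. Q (cl j) x * of_bool (\<forall>u\<in>set (cs (cl j)). (x, u) \<notin> G (cl j))) + \<theta>"
      by (simp add: sum.distrib e3_def sum_distrib_left[symmetric] Q1[OF s])
    finally show ?thesis
      using uncov[OF s] e2_sum e1_le[OF s, folded e1_def] e3_le[OF s, folded e3_def] by linarith
  qed
  then show ?thesis using gW fW cW f(1) DY by (intro exI[of _ g] exI[of _ W] exI[of _ f] exI[of _ D]) auto
qed


section \<open>Product weights on words\<close>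

definition words :: "nat \<Rightarrow> 'a set \<Rightarrow> 'a list set" where
  "words n A = {xs. set xs \<subseteq> A \<and> length xs = n}"

lemma finite_words: "finite A \<Longrightarrow> finite (words n A)"
  by (simp add: words_def finite_lists_length_eq)

lemma words_UNIV: "xs \<in> words n UNIV \<longleftrightarrow> length xs = n"
  by (simp add: words_def)

lemma words_nth: "xs \<in> words n A \<Longrightarrow> k < n \<Longrightarrow> xs ! k \<in> A"
  by (auto simp: words_def)

lemma words_Suc: "words (Suc n) A = (\<lambda>(a, l). a # l) ` (A \<times> words n A)"
  by (auto simp: words_def length_Suc_conv image_iff)

lemma sum_words_prod:
  fixes F :: "nat \<Rightarrow> 'a \<Rightarrow> real"
  shows "(\<Sum>xs\<in>words n A. \<Prod>k<n. F k (xs ! k)) = (\<Prod>k<n. \<Sum>a\<in>A. F k a)"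
proof (induction n arbitrary: F)
  case 0
  have "words 0 A = {[]}" by (auto simp: words_def)
  then show ?case by simp
next
  case (Suc n)
  have "(\<Sum>xs\<in>words (Suc n) A. \<Prod>k<Suc n. F k (xs ! k)) = (\<Sum>(a, l)\<in>A \<times> words n A. F 0 a * (\<Prod>k<n. F (Suc k) (l ! k)))"
    unfolding words_Suc
    by (subst sum.reindex) (simp_all add: inj_on_def prod.lessThan_Suc_shift case_prod_unfold del: prod.lessThan_Suc)
  also have "\<dots> = (\<Sum>a\<in>A. F 0 a) * (\<Sum>l\<in>words n A. \<Prod>k<n. F (Suc k) (l ! k))"
    by (simp add: sum.cartesian_product[symmetric] sum_product)
  also have "\<dots> = (\<Prod>k<Suc n. \<Sum>a\<in>A. F k a)"
    by (subst Suc.IH) (simp add: prod.lessThan_Suc_shift del: prod.lessThan_Suc)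
  finally show ?case .
qed

lemma sum_words_prod2:
  fixes F :: "'a \<Rightarrow> 'b \<Rightarrow> real"
  shows "(\<Sum>xs\<in>words n X. \<Sum>us\<in>words n A. \<Prod>k<n. F (xs ! k) (us ! k)) = (\<Sum>x\<in>X. \<Sum>u\<in>A. F x u) ^ n"
proof -
  have "(\<Sum>xs\<in>words n X. \<Sum>us\<in>words n A. \<Prod>k<n. F (xs ! k) (us ! k))
    = (\<Sum>xs\<in>words n X. \<Prod>k<n. \<Sum>u\<in>A. F (xs ! k) u)"
  proof (rule sum.cong[OF refl])
    fix xs
    show "(\<Sum>us\<in>words n A. \<Prod>k<n. F (xs ! k) (us ! k)) = (\<Prod>k<n. \<Sum>u\<in>A. F (xs ! k) u)"
      by (rule sum_words_prod[where F="\<lambda>k. F (xs ! k)"])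
  qed
  also have "\<dots> = (\<Prod>k<n. \<Sum>x\<in>X. \<Sum>u\<in>A. F x u)"
    by (rule sum_words_prod[where F="\<lambda>k x. \<Sum>u\<in>A. F x u"])
  finally show ?thesis by simp
qed

subsection \<open>Exponential tail bounds\<close>

text \<open>As a function of \<open>l\<close> the sum equals 1 at 0, and its derivative there is the
  negative mean of \<open>g\<close>.\<close>

lemma chernoff:
  fixes w g :: "'a \<Rightarrow> real"
  assumes "finite I" "sum w I = 1" "(\<Sum>i\<in>I. w i * g i) < 0"
  shows "\<exists>l>0. (\<Sum>i\<in>I. w i * exp (l * g i)) < 1"
proof -
  let ?\<phi> = "\<lambda>l. \<Sum>i\<in>I. w i * exp (l * g i)"
  have "DERIV ?\<phi> 0 :> (\<Sum>i\<in>I. w i * g i)"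
    by (auto intro!: derivative_eq_intros sum.cong)
  from DERIV_neg_dec_right[OF this assms(3)] obtain d where d: "d > 0" "\<forall>h>0. h < d \<longrightarrow> ?\<phi> 0 > ?\<phi> (0 + h)" by blast
  then show ?thesis using d(2)[rule_format, of "d / 2"] assms(2) by (intro exI[of _ "d / 2"]) simp
qed

text \<open>The Chernoff bound for the sum of ln(a/b) over the letters: the exponential factorises
  over positions.\<close>

lemma words_tail:
  fixes w a b :: "'x \<Rightarrow> 'u \<Rightarrow> real"
  assumes fin: "finite X" "finite A" and w: "\<And>x u. w x u \<ge> 0" and w1: "(\<Sum>x\<in>X. \<Sum>u\<in>A. w x u) = 1"
    and pos: "\<And>x u. x \<in> X \<Longrightarrow> u \<in> A \<Longrightarrow> w x u > 0 \<Longrightarrow> a x u > 0 \<and> b x u > 0"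
    and neg: "(\<Sum>x\<in>X. \<Sum>u\<in>A. w x u * ln (a x u / b x u)) < 0"
  shows "\<exists>\<rho>. 0 < \<rho> \<and> \<rho> < 1 \<and> (\<forall>n. (\<Sum>xs\<in>words n X. \<Sum>us\<in>words n A.
    (\<Prod>k<n. w (xs ! k) (us ! k)) * of_bool ((\<Prod>k<n. b (xs ! k) (us ! k)) < (\<Prod>k<n. a (xs ! k) (us ! k)))) \<le> \<rho> ^ n)"
proof -
  let ?g = "\<lambda>x u. ln (a x u / b x u)"
  obtain l where l: "l > 0" "(\<Sum>z\<in>X \<times> A. w (fst z) (snd z) * exp (l * ?g (fst z) (snd z))) < 1"
    using chernoff[of "X \<times> A" "\<lambda>z. w (fst z) (snd z)" "\<lambda>z. ?g (fst z) (snd z)"] fin w1 neg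
    by (auto simp: sum.cartesian_product case_prod_unfold)
  define \<phi> where "\<phi> = (\<Sum>x\<in>X. \<Sum>u\<in>A. w x u * exp (l * ?g x u))"
  have \<phi>1: "\<phi> < 1" using l(2) by (simp add: \<phi>_def sum.cartesian_product case_prod_unfold)
  have \<phi>0: "\<phi> \<ge> 0" unfolding \<phi>_def using w by (intro sum_nonneg) auto
  have "(\<Sum>xs\<in>words n X. \<Sum>us\<in>words n A.
    (\<Prod>k<n. w (xs ! k) (us ! k)) * of_bool ((\<Prod>k<n. b (xs ! k) (us ! k)) < (\<Prod>k<n. a (xs ! k) (us ! k)))) \<le> \<phi> ^ n" for n
  proof -
    have "(\<Sum>xs\<in>words n X. \<Sum>us\<in>words n A.
      (\<Prod>k<n. w (xs ! k) (us ! k)) * of_bool ((\<Prod>k<n. b (xs ! k) (us ! k)) < (\<Prod>k<n. a (xs ! k) (us ! k))))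
      \<le> (\<Sum>xs\<in>words n X. \<Sum>us\<in>words n A. \<Prod>k<n. w (xs ! k) (us ! k) * exp (l * ?g (xs ! k) (us ! k)))"
    proof (intro sum_mono)
      fix xs us assume xs: "xs \<in> words n X" and us: "us \<in> words n A"
      let ?w = "\<lambda>k. w (xs ! k) (us ! k)" and ?a = "\<lambda>k. a (xs ! k) (us ! k)" and ?b = "\<lambda>k. b (xs ! k) (us ! k)"
      have rhs: "(\<Prod>k<n. ?w k * exp (l * ?g (xs ! k) (us ! k))) = (\<Prod>k<n. ?w k) * exp (l * (\<Sum>k<n. ln (?a k / ?b k)))"
        by (simp add: prod.distrib exp_sum sum_distrib_left)
      have wn: "(\<Prod>k<n. ?w k) \<ge> 0" using w by (intro prod_nonneg) auto
      show "(\<Prod>k<n. ?w k) * of_bool ((\<Prod>k<n. ?b k) < (\<Prod>k<n. ?a k)) \<le> (\<Prod>k<n. ?w k * exp (l * ?g (xs ! k) (us ! k)))"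
      proof (cases "(\<Prod>k<n. ?w k) = 0 \<or> \<not> (\<Prod>k<n. ?b k) < (\<Prod>k<n. ?a k)")
        case True
        then show ?thesis
        proof
          assume "(\<Prod>k<n. ?w k) = 0"
          then show ?thesis unfolding rhs by (simp only: mult_zero_left)
        next
          assume "\<not> (\<Prod>k<n. ?b k) < (\<Prod>k<n. ?a k)"
          then show ?thesis unfolding rhs using wn by simp
        qed
      next
        case False
        have "?w k > 0" if "k < n" for k using False w[of "xs ! k" "us ! k"] that by (force simp: less_le)
        then have ab: "?a k > 0" "?b k > 0" if "k < n" for k
          using that pos words_nth[OF xs that] words_nth[OF us that] by blast+
        have "(\<Sum>k<n. ln (?a k / ?b k)) = (\<Sum>k<n. ln (?a k)) - (\<Sum>k<n. ln (?b k))"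
          unfolding sum_subtractf[symmetric] by (intro sum.cong refl ln_divide_pos ab) auto
        also have "(\<Sum>k<n. ln (?a k)) = ln (\<Prod>k<n. ?a k)"
          by (rule ln_prod[symmetric]) (use ab in \<open>auto simp: less_le\<close>)
        also have "(\<Sum>k<n. ln (?b k)) = ln (\<Prod>k<n. ?b k)"
          by (rule ln_prod[symmetric]) (use ab in \<open>auto simp: less_le\<close>)
        also have "ln (\<Prod>k<n. ?a k) - ln (\<Prod>k<n. ?b k) \<ge> 0"
        proof -
          have "(\<Prod>k<n. ?b k) > 0" "(\<Prod>k<n. ?a k) > 0" using ab by (auto intro!: prod_pos)
          then show ?thesis using False by simp
        qed
        finally have "exp (l * (\<Sum>k<n. ln (?a k / ?b k))) \<ge> 1" using l(1) by simp
        from mult_left_mono[OF this wn] show ?thesis unfolding rhs using False by simp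
      qed
    qed
    also have "\<dots> = \<phi> ^ n" unfolding \<phi>_def by (rule sum_words_prod2)
    finally show ?thesis .
  qed
  \<comment> \<open>The maximum with 1/2 makes the rate positive even if \<phi> is zero.\<close>
  moreover have "\<phi> ^ n \<le> (max \<phi> (1 / 2)) ^ n" for n using \<phi>0 by (intro power_mono) auto
  ultimately show ?thesis using \<phi>1 by (intro exI[of _ "max \<phi> (1 / 2)"]) (auto intro: order_trans)
qed

text \<open>The threshold exp(nc) is absorbed letterwise into \<open>b\<close>, which lowers the
  mean log ratio by \<open>c\<close>.\<close>

lemma words_tail_shift:
  fixes w a b :: "'x \<Rightarrow> 'u \<Rightarrow> real"
  assumes fin: "finite X" "finite A" and w: "\<And>x u. w x u \<ge> 0" and w1: "(\<Sum>x\<in>X. \<Sum>u\<in>A. w x u) = 1"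
    and pos: "\<And>x u. x \<in> X \<Longrightarrow> u \<in> A \<Longrightarrow> w x u > 0 \<Longrightarrow> a x u > 0 \<and> b x u > 0"
    and less: "(\<Sum>x\<in>X. \<Sum>u\<in>A. w x u * ln (a x u / b x u)) < c"
  shows "\<exists>\<rho>. 0 < \<rho> \<and> \<rho> < 1 \<and> (\<forall>n. (\<Sum>xs\<in>words n X. \<Sum>us\<in>words n A. (\<Prod>k<n. w (xs ! k) (us ! k)) *
    of_bool (exp (n * c) * (\<Prod>k<n. b (xs ! k) (us ! k)) < (\<Prod>k<n. a (xs ! k) (us ! k)))) \<le> \<rho> ^ n)"
proof -
  have "(\<Sum>x\<in>X. \<Sum>u\<in>A. w x u * ln (a x u / (exp c * b x u))) = (\<Sum>x\<in>X. \<Sum>u\<in>A. w x u * ln (a x u / b x u) - c * w x u)"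
  proof (intro sum.cong refl)
    fix x u assume xu: "x \<in> X" "u \<in> A"
    show "w x u * ln (a x u / (exp c * b x u)) = w x u * ln (a x u / b x u) - c * w x u"
    proof (cases "w x u = 0")
      case False
      then have "a x u > 0" "b x u > 0" using pos[OF xu] w[of x u] by (auto simp: less_le)
      then have e: "ln (a x u / (exp c * b x u)) = ln (a x u / b x u) - c"
        by (simp add: ln_divide_pos ln_mult_pos)
      show ?thesis unfolding e by (simp add: right_diff_distrib)
    qed simp
  qed
  also have "\<dots> = (\<Sum>x\<in>X. \<Sum>u\<in>A. w x u * ln (a x u / b x u)) - c"
    using w1 by (simp add: sum_subtractf sum_distrib_left[symmetric])
  finally have neg: "(\<Sum>x\<in>X. \<Sum>u\<in>A. w x u * ln (a x u / (exp c * b x u))) < 0" using less by simp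
  have "exp (n * c) * (\<Prod>k<n. b (xs ! k) (us ! k)) = (\<Prod>k<n. exp c * b (xs ! k) (us ! k))" for n xs us
    by (simp add: prod.distrib exp_of_nat_mult)
  then show ?thesis
    using words_tail[OF fin w w1, of a "\<lambda>x u. exp c * b x u"] pos neg by auto
qed

text \<open>The arithmetic-geometric mean inequality is strict at a letter where the two laws
  differ.\<close>

lemma bhattacharyya_less_1:
  fixes Q Q' :: "'x::finite pmf"
  assumes "Q \<noteq> Q'"
  shows "(\<Sum>x\<in>UNIV. sqrt (pmf Q x * pmf Q' x)) < 1"
proof -
  have amgm: "sqrt (a * b) \<le> (a + b) / 2" "a \<noteq> b \<Longrightarrow> sqrt (a * b) < (a + b) / 2" if "a \<ge> 0" "b \<ge> 0" for a b :: real
  proof -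
    have e: "(a + b) / 2 - sqrt (a * b) = (sqrt a - sqrt b)\<^sup>2 / 2"
      using that by (simp add: power2_diff real_sqrt_mult field_simps)
    show "sqrt (a * b) \<le> (a + b) / 2" using e zero_le_power2[of "sqrt a - sqrt b"] by linarith
    assume "a \<noteq> b"
    then have "(sqrt a - sqrt b)\<^sup>2 > 0" by simp
    then show "sqrt (a * b) < (a + b) / 2" using e by linarith
  qed
  obtain x where x: "pmf Q x \<noteq> pmf Q' x" using assms by (meson pmf_eqI)
  have "(\<Sum>x\<in>UNIV. sqrt (pmf Q x * pmf Q' x)) < (\<Sum>x\<in>UNIV. (pmf Q x + pmf Q' x) / 2)"
  proof (rule sum_strict_mono_ex1)
    show "\<forall>x\<in>UNIV. sqrt (pmf Q x * pmf Q' x) \<le> (pmf Q x + pmf Q' x) / 2"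
      by (intro ballI amgm(1) pmf_nonneg)
    show "\<exists>x\<in>UNIV. sqrt (pmf Q x * pmf Q' x) < (pmf Q x + pmf Q' x) / 2"
      using amgm(2)[OF pmf_nonneg pmf_nonneg x] by blast
  qed simp
  also have "\<dots> = 1" by (simp add: sum_divide_distrib[symmetric] sum.distrib sum_pmf_eq_1)
  finally show ?thesis .
qed

lemma uniform_rate:
  fixes \<rho> :: "'i \<Rightarrow> real"
  assumes "finite I" "\<And>i. i \<in> I \<Longrightarrow> \<rho> i < 1"
  shows "\<exists>\<sigma>. 0 < \<sigma> \<and> \<sigma> < 1 \<and> (\<forall>i\<in>I. \<rho> i \<le> \<sigma>)"
proof -
  let ?B = "insert (1 / 2) (\<rho> ` I)"
  have f: "finite ?B" using assms by simp
  have "1 / 2 \<le> Max ?B" by (rule Max_ge[OF f]) simp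
  moreover have "Max ?B < 1" using assms f by (subst Max_less_iff) auto
  moreover have "\<rho> i \<le> Max ?B" if "i \<in> I" for i by (rule Max_ge[OF f]) (use that in simp)
  ultimately show ?thesis by (intro exI[of _ "Max ?B"]) auto
qed

text \<open>Maximum likelihood identifies the marginal of the source word.\<close>

lemma identify_marginal:
  fixes S :: "'x::finite pmf set"
  assumes fin: "finite S" and ne: "S \<noteq> {}"
  shows "\<exists>\<rho> :: real. 0 < \<rho> \<and> \<rho> < 1 \<and> (\<forall>n. \<exists>t. (\<forall>xs. t xs \<in> S) \<and>
    (\<forall>Q\<in>S. (\<Sum>xs\<in>words n UNIV. (\<Prod>k<n. pmf Q (xs ! k)) * of_bool (t xs \<noteq> Q)) \<le> card S * \<rho> ^ n))"
proof -
  define bc where "bc Q Q' = (\<Sum>x\<in>UNIV. sqrt (pmf Q x * pmf Q' x))" for Q Q' :: "'x pmf"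
  have "\<exists>\<sigma>. 0 < \<sigma> \<and> \<sigma> < 1 \<and> (\<forall>z\<in>{z \<in> S \<times> S. fst z \<noteq> snd z}. bc (fst z) (snd z) \<le> \<sigma>)"
    using fin bhattacharyya_less_1 by (intro uniform_rate) (auto simp: bc_def)
  then obtain \<sigma> where \<sigma>: "0 < \<sigma>" "\<sigma> < 1" "\<And>Q Q'. Q \<in> S \<Longrightarrow> Q' \<in> S \<Longrightarrow> Q \<noteq> Q' \<Longrightarrow> bc Q Q' \<le> \<sigma>"
    by auto
  have "\<exists>t. (\<forall>xs. t xs \<in> S) \<and>
    (\<forall>Q\<in>S. (\<Sum>xs\<in>words n UNIV. (\<Prod>k<n. pmf Q (xs ! k)) * of_bool (t xs \<noteq> Q)) \<le> card S * \<sigma> ^ n)" for n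
  proof -
    define L where "L Q xs = (\<Prod>k<n. pmf Q (xs ! k))" for Q and xs :: "'x list"
    have L0: "L Q xs \<ge> 0" for Q xs unfolding L_def by (intro prod_nonneg) auto
    have "\<exists>Q\<in>S. \<forall>Q'\<in>S. L Q' xs \<le> L Q xs" for xs
    proof -
      have "Max ((\<lambda>Q. L Q xs) ` S) \<in> (\<lambda>Q. L Q xs) ` S" using fin ne by (intro Max_in) auto
      then obtain Q where "Q \<in> S" "L Q xs = Max ((\<lambda>Q. L Q xs) ` S)" by force
      then show ?thesis using fin by (intro bexI[of _ Q]) auto
    qed
    then obtain t where t: "\<And>xs. t xs \<in> S" "\<And>xs Q'. Q' \<in> S \<Longrightarrow> L Q' xs \<le> L (t xs) xs" by metis
    have "(\<Sum>xs\<in>words n UNIV. L Q xs * of_bool (t xs \<noteq> Q)) \<le> card S * \<sigma> ^ n" if Q: "Q \<in> S" for Q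
    proof -
      \<comment> \<open>When \<open>Q\<close> loses, its likelihood is at most the geometric mean
        with the winner's. Summing over all rivals removes the dependence on the winner and leaves
        powers of Bhattacharyya coefficients.\<close>
      have "(\<Sum>xs\<in>words n UNIV. L Q xs * of_bool (t xs \<noteq> Q)) \<le> (\<Sum>xs\<in>words n UNIV. \<Sum>Q'\<in>S - {Q}. sqrt (L Q xs * L Q' xs))"
      proof (rule sum_mono)
        fix xs
        have nn: "(\<Sum>Q'\<in>S - {Q}. sqrt (L Q xs * L Q' xs)) \<ge> 0" using L0 by (intro sum_nonneg) auto
        show "L Q xs * of_bool (t xs \<noteq> Q) \<le> (\<Sum>Q'\<in>S - {Q}. sqrt (L Q xs * L Q' xs))"
        proof (cases "t xs = Q")
          case False
          have "L Q xs = sqrt (L Q xs * L Q xs)" using L0 by simp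
          also have "\<dots> \<le> sqrt (L Q xs * L (t xs) xs)" using L0 t(2)[OF Q] by (intro real_sqrt_le_mono mult_left_mono) auto
          also have "\<dots> \<le> (\<Sum>Q'\<in>S - {Q}. sqrt (L Q xs * L Q' xs))"
            using fin False t(1) L0 by (intro member_le_sum[of "t xs" "S - {Q}" "\<lambda>Q'. sqrt (L Q xs * L Q' xs)"]) auto
          finally show ?thesis using False by simp
        qed (use nn in simp)
      qed
      also have "\<dots> = (\<Sum>Q'\<in>S - {Q}. \<Sum>xs\<in>words n UNIV. sqrt (L Q xs * L Q' xs))" by (rule sum.swap)
      also have "\<dots> = (\<Sum>Q'\<in>S - {Q}. bc Q Q' ^ n)"
      proof (rule sum.cong[OF refl])
        fix Q'
        have "sqrt (L Q xs * L Q' xs) = (\<Prod>k<n. sqrt (pmf Q (xs ! k) * pmf Q' (xs ! k)))" for xs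
        proof -
          have "sqrt (\<Prod>k<m. f k) = (\<Prod>k<m. sqrt (f k))" for f :: "nat \<Rightarrow> real" and m
            by (induction m) (auto simp: real_sqrt_mult)
          then show ?thesis by (simp add: L_def prod.distrib[symmetric])
        qed
        then show "(\<Sum>xs\<in>words n UNIV. sqrt (L Q xs * L Q' xs)) = bc Q Q' ^ n"
          using sum_words_prod[where F="\<lambda>k x. sqrt (pmf Q x * pmf Q' x)" and A=UNIV and n=n] by (simp add: bc_def)
      qed
      also have "\<dots> \<le> (\<Sum>Q'\<in>S - {Q}. \<sigma> ^ n)"
        using \<sigma>(3)[OF Q] by (intro sum_mono power_mono) (auto simp: bc_def intro!: sum_nonneg)
      also have "\<dots> \<le> card S * \<sigma> ^ n" using fin \<sigma>(1) card_mono[of S "S - {Q}"] by (auto intro!: mult_right_mono)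
      finally show ?thesis .
    qed
    then show ?thesis using t(1) by (intro exI[of _ t]) (auto simp: L_def)
  qed
  then show ?thesis using \<sigma>(1,2) by (intro exI[of _ \<sigma>] conjI allI)
qed

subsection \<open>Single-letter information as sums\<close>

lemma pmf_marginal_X_sum:
  fixes P :: "('x::finite \<times> 'y::finite) pmf"
  shows "pmf (marginal_X P) x = (\<Sum>y\<in>UNIV. pmf P (x, y))"
  by (simp add: marginal_X_def pmf_map_fst_sum)

lemma pmf_map_snd_joint_XU:
  fixes Q :: "'x::finite pmf"
  shows "pmf (map_pmf snd (joint_XU Q K)) u = (\<Sum>x\<in>UNIV. pmf Q x * pmf (K x) u)"
proof -
  have "map_pmf snd (joint_XU Q K) = bind_pmf Q K"
    by (simp add: joint_XU_def map_bind_pmf map_pmf_comp)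
  then have "pmf (map_pmf snd (joint_XU Q K)) u = expct Q (\<lambda>x. pmf (K x) u)"
    by (simp add: pmf_bind)
  also have "\<dots> = (\<Sum>x\<in>UNIV. pmf (K x) u * pmf Q x)"
    by (rule integral_measure_pmf_real) auto
  finally show ?thesis by (simp add: mult.commute)
qed

text \<open>The mean of a log ratio over letter pairs is the form in which
  \<open>words_tail_shift\<close> takes a rate condition.\<close>

lemma mutual_info_XU_sum:
  fixes Q :: "'x::finite pmf"
  assumes A: "finite A" "\<And>x. set_pmf (K x) \<subseteq> A"
  defines "q \<equiv> \<lambda>u. \<Sum>x\<in>UNIV. pmf Q x * pmf (K x) u"
  shows "mutual_info_XU Q K = (\<Sum>x\<in>UNIV. \<Sum>u\<in>A. pmf Q x * pmf (K x) u * ln (pmf (K x) u / q u))"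
proof -
  let ?R = "joint_XU Q K"
  have sub: "set_pmf ?R \<subseteq> UNIV \<times> A" using A(2) by (auto simp: joint_XU_def)
  then have fin: "finite (set_pmf ?R)" by (rule finite_subset) (use A in auto)
  have 1: "map_pmf fst ?R = Q" by (simp add: joint_XU_def map_bind_pmf map_pmf_comp bind_return_pmf')
  have 2: "pmf (map_pmf snd ?R) u = q u" for u by (simp add: pmf_map_snd_joint_XU q_def)
  have "mutual_info_XU Q K = ent ?R fst + ent ?R snd - ent ?R (\<lambda>z. (fst z, snd z))"
    unfolding mutual_info_XU_def by (rule mutual_information_pmf[OF fin])
  also have "\<dots> = expct ?R (\<lambda>z. - ln (pmf Q (fst z)) + - ln (q (snd z)) - (- ln (pmf ?R z)))"
    unfolding ent_def using fin by (simp add: integrable_measure_pmf_finite 1 2)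
  also have "\<dots> = expct ?R (\<lambda>z. ln (pmf (K (fst z)) (snd z) / q (snd z)))"
  proof (rule expectation_cong_pmf)
    fix z assume z: "z \<in> set_pmf ?R"
    obtain x u where zz: "z = (x, u)" by (cases z)
    have p: "pmf Q x * pmf (K x) u > 0" using z by (metis pmf_joint_XU pmf_positive zz)
    then have pos: "pmf Q x > 0" "pmf (K x) u > 0"
      using pmf_nonneg[of Q x] pmf_nonneg[of "K x" u] by (auto simp: zero_less_mult_iff)
    have "q u > 0" using pmf_map_pos[OF z, of snd] by (simp add: 2 zz)
    with pos show "- ln (pmf Q (fst z)) + - ln (q (snd z)) - (- ln (pmf ?R z)) = ln (pmf (K (fst z)) (snd z) / q (snd z))"
      by (simp add: zz pmf_joint_XU ln_mult_pos ln_divide_pos)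
  qed
  also have "\<dots> = (\<Sum>z\<in>UNIV \<times> A. ln (pmf (K (fst z)) (snd z) / q (snd z)) * pmf ?R z)"
    by (rule integral_measure_pmf_real) (use A sub in auto)
  also have "\<dots> = (\<Sum>x\<in>UNIV. \<Sum>u\<in>A. pmf Q x * pmf (K x) u * ln (pmf (K x) u / q u))"
    unfolding sum.cartesian_product by (rule sum.cong) (auto simp: pmf_joint_XU mult.commute)
  finally show ?thesis .
qed

lemma cond_entropy_YU_sum:
  fixes P :: "('x::finite \<times> 'y::finite) pmf"
  assumes A: "finite A" "\<And>x. set_pmf (K x) \<subseteq> A"
  defines "q \<equiv> \<lambda>u. \<Sum>x\<in>UNIV. pmf (marginal_X P) x * pmf (K x) u"
    and "r \<equiv> \<lambda>y u. \<Sum>x\<in>UNIV. pmf P (x, y) * pmf (K x) u"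
  shows "cond_entropy_YU P K = (\<Sum>y\<in>UNIV. \<Sum>u\<in>A. r y u * ln (q u / r y u))"
proof -
  let ?J = "joint_XYU P K" and ?YU = "\<lambda>z. (coordY z, coordU z)"
  have K: "test_kernel K" unfolding test_kernel_def using A by (meson UN_least finite_subset)
  note fin = finite_set_joint_XYU[OF K, of P]
  have 1: "pmf (map_pmf coordU ?J) u = q u" for u
    using pmf_map_snd_joint_XU[of "marginal_X P" K u] by (simp add: joint_XU_eq map_pmf_comp q_def)
  have 2: "pmf (map_pmf ?YU ?J) (y, u) = r y u" for y u
  proof -
    have e: "?YU -` {(y, u)} = (\<lambda>x. (x, y, u)) ` (UNIV :: 'x set)" by auto
    have "pmf (map_pmf ?YU ?J) (y, u) = (\<Sum>w\<in>(\<lambda>x. (x, y, u)) ` UNIV. pmf ?J w)"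
      unfolding pmf_map e by (rule measure_measure_pmf_finite) simp
    also have "\<dots> = (\<Sum>x\<in>UNIV. pmf ?J (x, y, u))" by (subst sum.reindex) (auto simp: inj_on_def)
    finally show ?thesis by (simp add: pmf_joint_XYU r_def)
  qed
  have "cond_entropy_YU P K = expct ?J (\<lambda>z. - ln (pmf (map_pmf ?YU ?J) (?YU z)) - (- ln (pmf (map_pmf coordU ?J) (coordU z))))"
    unfolding cond_entropy_YU_eq[OF K] ent_def using fin by (subst Bochner_Integration.integral_diff) (auto intro: integrable_measure_pmf_finite)
  also have "\<dots> = expct ?J (\<lambda>z. (\<lambda>w. ln (q (snd w) / r (fst w) (snd w))) (?YU z))"
  proof (rule expectation_cong_pmf)
    fix z assume z: "z \<in> set_pmf ?J"
    have "q (coordU z) > 0" "r (coordY z) (coordU z) > 0"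
      using pmf_map_pos[OF z, of coordU] pmf_map_pos[OF z, of ?YU] by (simp_all add: 1 2)
    then show "- ln (pmf (map_pmf ?YU ?J) (?YU z)) - (- ln (pmf (map_pmf coordU ?J) (coordU z))) = (\<lambda>w. ln (q (snd w) / r (fst w) (snd w))) (?YU z)"
      by (simp add: 1 2 ln_divide_pos)
  qed
  also have "\<dots> = expct (map_pmf ?YU ?J) (\<lambda>w. ln (q (snd w) / r (fst w) (snd w)))" by simp
  also have "\<dots> = (\<Sum>w\<in>UNIV \<times> A. ln (q (snd w) / r (fst w) (snd w)) * pmf (map_pmf ?YU ?J) w)"
    by (rule integral_measure_pmf_real) (use A(1) in \<open>auto simp: joint_XYU_def dest: subsetD[OF A(2)]\<close>)
  also have "\<dots> = (\<Sum>y\<in>UNIV. \<Sum>u\<in>A. r y u * ln (q u / r y u))"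
    unfolding sum.cartesian_product
    by (rule sum.cong) (auto simp: 2 mult.commute)
  finally show ?thesis .
qed

subsection \<open>Error probabilities as sums over words\<close>

lemma set_pmf_subset_words:
  fixes p :: "'a list pmf"
  assumes "\<And>z. length z \<noteq> n \<Longrightarrow> pmf p z = 0"
  shows "set_pmf p \<subseteq> words n UNIV"
proof
  fix z assume "z \<in> set_pmf p"
  then have "pmf p z \<noteq> 0" by (simp add: set_pmf_iff)
  then show "z \<in> words n UNIV" using assms[of z] by (auto simp: words_UNIV)
qed

lemma prob_sum_words:
  fixes p :: "'a::finite list pmf"
  assumes "set_pmf p \<subseteq> words n UNIV"
  shows "measure_pmf.prob p E = (\<Sum>z\<in>words n UNIV. pmf p z * of_bool (z \<in> E))"
proof -
  have "measure_pmf.prob p E = expct p (indicator E)" by simp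
  also have "\<dots> = (\<Sum>z\<in>words n UNIV. indicator E z * pmf p z)"
    by (rule integral_measure_pmf_real) (use assms finite_words[of "UNIV :: 'a set"] in auto)
  finally show ?thesis by (simp add: indicator_def of_bool_def mult.commute)
qed

lemma replicate_pmf_subset_words: "set_pmf (replicate_pmf n p) \<subseteq> words n UNIV"
  by (auto simp: set_replicate_pmf words_UNIV)

lemma wak_error_mixture:
  fixes P :: "nat \<Rightarrow> ('x::finite \<times> 'y::finite) pmf"
  assumes source: "\<And>z. pmf S z = (\<Sum>i = 1..m. \<nu> i * pmf (replicate_pmf n (P i)) z)"
  shows "wak_error S C = (\<Sum>i = 1..m. \<nu> i * wak_error (replicate_pmf n (P i)) C)"
proof -
  let ?E = "{z. dec C (enc1 C (map fst z), enc2 C (map snd z)) \<noteq> map snd z}"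
  have "set_pmf S \<subseteq> words n UNIV"
    by (rule set_pmf_subset_words) (simp add: source pmf_replicate_pmf)
  then have "wak_error S C = (\<Sum>z\<in>words n UNIV. (\<Sum>i = 1..m. \<nu> i * pmf (replicate_pmf n (P i)) z) * of_bool (z \<in> ?E))"
    unfolding wak_error_def by (simp add: prob_sum_words source)
  also have "\<dots> = (\<Sum>i = 1..m. \<Sum>z\<in>words n UNIV. \<nu> i * (pmf (replicate_pmf n (P i)) z * of_bool (z \<in> ?E)))"
    unfolding sum_distrib_right by (subst sum.swap) (simp add: mult.assoc)
  also have "\<dots> = (\<Sum>i = 1..m. \<nu> i * wak_error (replicate_pmf n (P i)) C)"
    unfolding wak_error_def by (simp add: prob_sum_words[OF replicate_pmf_subset_words] sum_distrib_left)
  finally show ?thesis .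
qed

lemma wak_error_replicate:
  fixes P :: "('x::finite \<times> 'y::finite) pmf"
  shows "wak_error (replicate_pmf n P) C = (\<Sum>xs\<in>words n UNIV. \<Sum>ys\<in>words n UNIV.
     (\<Prod>k<n. pmf P (xs ! k, ys ! k)) * of_bool (dec C (enc1 C xs, enc2 C ys) \<noteq> ys))"
proof -
  let ?E = "{z. dec C (enc1 C (map fst z), enc2 C (map snd z)) \<noteq> map snd z}"
  have "wak_error (replicate_pmf n P) C = (\<Sum>z\<in>words n UNIV. pmf (replicate_pmf n P) z * of_bool (z \<in> ?E))"
    unfolding wak_error_def by (rule prob_sum_words[OF replicate_pmf_subset_words])
  also have "\<dots> = (\<Sum>(xs, ys)\<in>words n UNIV \<times> words n UNIV. (\<Prod>k<n. pmf P (xs ! k, ys ! k)) * of_bool (dec C (enc1 C xs, enc2 C ys) \<noteq> ys))"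
    by (rule sum.reindex_bij_witness[where i="\<lambda>(xs, ys). zip xs ys" and j="\<lambda>z. (map fst z, map snd z)"])
       (auto simp: words_UNIV zip_map_fst_snd pmf_replicate_pmf)
  finally show ?thesis by (simp add: sum.cartesian_product)
qed


section \<open>Achievability\<close>

text \<open>The constant factor \<open>k\<close> pays for sending the guessed marginal with the
  codeword and does not affect the rate. At least one message keeps the logarithm of the size
  nonnegative.\<close>

definition code_within :: "nat \<Rightarrow> nat \<Rightarrow> real \<Rightarrow> real \<Rightarrow> ('x, 'y) wak_code \<Rightarrow> bool" where
  "code_within n k R1 R2 C \<longleftrightarrow> is_wak_code n C \<and> 1 \<le> card (msgs1 C) \<and>
     card (msgs1 C) \<le> k * nat \<lceil>exp (n * R1)\<rceil> \<and> card (msgs2 C) = nat \<lceil>exp (n * R2)\<rceil>"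

text \<open>Of the excess rate 2\<delta>, one \<delta> enters the thresholds \<Gamma> and \<Lambda>,
  so that atypical pairs are exponentially rare. The other lets M/\<Gamma> and N/\<Lambda> grow like
  exp(n\<delta>).\<close>

lemma achievable_codes:
  fixes P :: "nat \<Rightarrow> ('x::finite \<times> 'y::finite) pmf" and K :: "'x pmf \<Rightarrow> 'x \<Rightarrow> nat pmf"
  assumes J: "finite J" "J \<noteq> {}" and \<delta>: "\<delta> > 0"
    and K: "\<And>j. j \<in> J \<Longrightarrow> test_kernel (K (marginal_X (P j)))"
    and I: "\<And>j. j \<in> J \<Longrightarrow> mutual_info_XU (marginal_X (P j)) (K (marginal_X (P j))) \<le> Rc"
    and H: "\<And>j. j \<in> J \<Longrightarrow> cond_entropy_YU (P j) (K (marginal_X (P j))) \<le> h"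
  shows "\<exists>\<sigma> c :: real. 0 < \<sigma> \<and> \<sigma> < 1 \<and> (\<forall>n. \<exists>C. code_within n (card J) (Rc + 2 * \<delta>) (h + 2 * \<delta>) C \<and>
     (\<forall>j\<in>J. wak_error (replicate_pmf n (P j)) C \<le> c * \<sigma> ^ n))"
proof -
  define s where "s j = marginal_X (P j)" for j
  define S where "S = s ` J"
  define A where "A = (\<Union>Q\<in>S. \<Union>x. set_pmf (K Q x))"
  have finS: "finite S" and neS: "S \<noteq> {}" using J by (auto simp: S_def)
  have finA: "finite A"
    unfolding A_def using finS by (intro finite_UN_I) (use K in \<open>auto simp: S_def s_def test_kernel_def\<close>)
  have KA: "set_pmf (K Q x) \<subseteq> A" if "Q \<in> S" for Q x using that by (auto simp: A_def)
  have K1: "(\<Sum>u\<in>A. pmf (K Q x) u) = 1" if "Q \<in> S" for Q x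
    using sum_pmf_eq_1[OF finA KA[OF that]] .
  define q where "q Q u = (\<Sum>x\<in>UNIV. pmf Q x * pmf (K Q x) u)" for Q u
  define r where "r j y u = (\<Sum>x\<in>UNIV. pmf (P j) (x, y) * pmf (K (s j) x) u)" for j y u
  have q0: "q Q u \<ge> 0" for Q u unfolding q_def by (intro sum_nonneg) auto
  have r0: "r j y u \<ge> 0" for j y u unfolding r_def by (intro sum_nonneg) auto
  have rq: "(\<Sum>y\<in>UNIV. r j y u) = q (s j) u" for j u
    unfolding r_def q_def by (subst sum.swap) (simp add: s_def pmf_marginal_X_sum sum_distrib_right)
  have q1: "(\<Sum>u\<in>A. q Q u) = 1" if "Q \<in> S" for Q
    unfolding q_def by (subst sum.swap) (simp add: sum_distrib_left[symmetric] K1[OF that] sum_pmf_eq_1)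
  \<comment> \<open>\<open>E1\<close> is the probability that the information density of (x, u)
    exceeds n(Rc + \<delta>); \<open>E2\<close> is the probability that y has conditional
    probability below exp(-n(h + \<delta>)) given u.\<close>
  define E1 where "E1 n Q = (\<Sum>xs\<in>words n UNIV. \<Sum>us\<in>words n A. (\<Prod>k<n. pmf Q (xs ! k) * pmf (K Q (xs ! k)) (us ! k)) *
    of_bool (exp (n * (Rc + \<delta>)) * (\<Prod>k<n. q Q (us ! k)) < (\<Prod>k<n. pmf (K Q (xs ! k)) (us ! k))))" for n :: nat and Q
  define E2 where "E2 n j = (\<Sum>ys\<in>words n UNIV. \<Sum>us\<in>words n A. (\<Prod>k<n. r j (ys ! k) (us ! k)) *
    of_bool (exp (n * (h + \<delta>)) * (\<Prod>k<n. r j (ys ! k) (us ! k)) < (\<Prod>k<n. q (s j) (us ! k))))" for n :: nat and j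
  have "\<exists>\<rho>. 0 < \<rho> \<and> \<rho> < 1 \<and> (\<forall>n. E1 n Q \<le> \<rho> ^ n)" if Q: "Q \<in> S" for Q
    unfolding E1_def
  proof (rule words_tail_shift[where w="\<lambda>x u. pmf Q x * pmf (K Q x) u" and a="\<lambda>x u. pmf (K Q x) u" and b="\<lambda>x u. q Q u"])
    show "(\<Sum>x\<in>UNIV. \<Sum>u\<in>A. pmf Q x * pmf (K Q x) u) = 1"
      by (simp add: sum_distrib_left[symmetric] K1[OF Q] sum_pmf_eq_1)
    show "0 < pmf (K Q x) u \<and> 0 < q Q u" if "0 < pmf Q x * pmf (K Q x) u" for x u
    proof -
      have "pmf Q x * pmf (K Q x) u \<le> q Q u"
        unfolding q_def by (rule member_le_sum[of x UNIV "\<lambda>x. pmf Q x * pmf (K Q x) u"]) auto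
      then have "0 < q Q u" using that by linarith
      moreover have "pmf (K Q x) u \<noteq> 0" using that by auto
      ultimately show ?thesis by (simp add: less_le)
    qed
    obtain j where j: "j \<in> J" "Q = s j" using Q by (auto simp: S_def)
    have "mutual_info_XU Q (K Q) = (\<Sum>x\<in>UNIV. \<Sum>u\<in>A. pmf Q x * pmf (K Q x) u * ln (pmf (K Q x) u / q Q u))"
      unfolding q_def by (rule mutual_info_XU_sum[OF finA KA[OF Q]])
    then show "(\<Sum>x\<in>UNIV. \<Sum>u\<in>A. pmf Q x * pmf (K Q x) u * ln (pmf (K Q x) u / q Q u)) < Rc + \<delta>"
      using I[OF j(1)] j(2) \<delta> by (simp add: s_def)
  qed (use finA in auto)
  then have "\<forall>Q\<in>S. \<exists>\<rho>. 0 < \<rho> \<and> \<rho> < 1 \<and> (\<forall>n. E1 n Q \<le> \<rho> ^ n)" by blast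
  from bchoice[OF this] obtain \<rho>1 where \<rho>1: "\<forall>Q\<in>S. 0 < \<rho>1 Q \<and> \<rho>1 Q < 1 \<and> (\<forall>n. E1 n Q \<le> \<rho>1 Q ^ n)" by (rule exE)
  have "\<exists>\<rho>. 0 < \<rho> \<and> \<rho> < 1 \<and> (\<forall>n. E2 n j \<le> \<rho> ^ n)" if j: "j \<in> J" for j
    unfolding E2_def
  proof (rule words_tail_shift[where w="r j" and a="\<lambda>y u. q (s j) u" and b="r j"])
    have Q: "s j \<in> S" using j by (simp add: S_def)
    show "(\<Sum>y\<in>UNIV. \<Sum>u\<in>A. r j y u) = 1"
      by (subst sum.swap) (simp add: rq q1[OF Q])
    show "0 < q (s j) u \<and> 0 < r j y u" if "0 < r j y u" for y u
    proof -
      have "r j y u \<le> q (s j) u"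
        unfolding rq[symmetric] by (rule member_le_sum[of y UNIV "\<lambda>y. r j y u"]) (auto simp: r0)
      then show ?thesis using that by linarith
    qed
    have "cond_entropy_YU (P j) (K (s j)) = (\<Sum>y\<in>UNIV. \<Sum>u\<in>A. r j y u * ln (q (s j) u / r j y u))"
      unfolding q_def r_def using cond_entropy_YU_sum[OF finA KA[OF Q], of "P j"] by (simp add: s_def)
    then show "(\<Sum>y\<in>UNIV. \<Sum>u\<in>A. r j y u * ln (q (s j) u / r j y u)) < h + \<delta>"
      using H[OF j] \<delta> by (simp add: s_def)
  qed (use finA r0 in auto)
  then have "\<forall>j\<in>J. \<exists>\<rho>. 0 < \<rho> \<and> \<rho> < 1 \<and> (\<forall>n. E2 n j \<le> \<rho> ^ n)" by blast
  from bchoice[OF this] obtain \<rho>2 where \<rho>2: "\<forall>j\<in>J. 0 < \<rho>2 j \<and> \<rho>2 j < 1 \<and> (\<forall>n. E2 n j \<le> \<rho>2 j ^ n)" by (rule exE)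
  obtain \<rho>3 :: real where \<rho>3: "0 < \<rho>3" "\<rho>3 < 1" "\<forall>n. \<exists>t. (\<forall>xs. t xs \<in> S) \<and>
    (\<forall>Q\<in>S. (\<Sum>xs\<in>words n UNIV. (\<Prod>k<n. pmf Q (xs ! k)) * of_bool (t xs \<noteq> Q)) \<le> card S * \<rho>3 ^ n)"
    using identify_marginal[OF finS neS] by (elim exE conjE)
  obtain \<sigma>1 where \<sigma>1: "0 < \<sigma>1" "\<sigma>1 < 1" "\<forall>Q\<in>S. \<rho>1 Q \<le> \<sigma>1"
    using uniform_rate[OF finS, of \<rho>1] \<rho>1 by blast
  obtain \<sigma>2 where \<sigma>2: "0 < \<sigma>2" "\<sigma>2 < 1" "\<forall>j\<in>J. \<rho>2 j \<le> \<sigma>2"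
    using uniform_rate[OF J(1), of \<rho>2] \<rho>2 by blast
  define \<sigma>0 where "\<sigma>0 = max (max \<sigma>1 \<sigma>2) (max \<rho>3 (exp (- \<delta>)))"
  \<comment> \<open>The square root splits the decay: with \<theta> = \<sigma>^n, the quotient of
    the \<open>E2\<close> bound by \<theta> is still \<sigma>^n.\<close>
  define \<sigma> where "\<sigma> = sqrt \<sigma>0"
  have \<sigma>0: "0 < \<sigma>0" "\<sigma>0 < 1" using \<sigma>1 \<sigma>2 \<rho>3 \<delta> by (auto simp: \<sigma>0_def)
  have le0: "\<sigma>1 \<le> \<sigma>0" "\<sigma>2 \<le> \<sigma>0" "\<rho>3 \<le> \<sigma>0" "exp (- \<delta>) \<le> \<sigma>0" by (auto simp: \<sigma>0_def)
  have \<sigma>: "0 < \<sigma>" "\<sigma> < 1" using \<sigma>0 by (auto simp: \<sigma>_def real_sqrt_lt_1_iff)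
  have sq: "\<sigma> * \<sigma> = \<sigma>0" using \<sigma>0 by (simp add: \<sigma>_def)
  have "\<sigma>0 \<le> \<sigma>" using \<sigma> mult_right_mono[of \<sigma> 1 \<sigma>] by (simp add: sq[symmetric])
  then have pow_le: "\<sigma>0 ^ n \<le> \<sigma> ^ n" for n using \<sigma>0 by (intro power_mono) auto
  have pow_sq: "\<sigma>0 ^ n = \<sigma> ^ n * \<sigma> ^ n" for n by (simp add: sq[symmetric] power_mult_distrib)
  have b1: "E1 n Q \<le> \<sigma> ^ n" if "Q \<in> S" for n Q
  proof -
    have "E1 n Q \<le> \<rho>1 Q ^ n" using \<rho>1 that by blast
    also have "\<dots> \<le> \<sigma>0 ^ n" using \<rho>1 \<sigma>1(3) le0(1) that by (intro power_mono) force+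
    finally show ?thesis using pow_le[of n] by linarith
  qed
  have b2: "E2 n j \<le> \<sigma> ^ n * \<sigma> ^ n" if "j \<in> J" for n j
  proof -
    have "E2 n j \<le> \<rho>2 j ^ n" using \<rho>2 that by blast
    also have "\<dots> \<le> \<sigma>0 ^ n" using \<rho>2 \<sigma>2(3) le0(2) that by (intro power_mono) force+
    finally show ?thesis by (simp add: pow_sq)
  qed
  have b4: "exp (- (n * \<delta>)) \<le> \<sigma> ^ n" for n :: nat
  proof -
    have "exp (- (n * \<delta>)) = exp (- \<delta>) ^ n" by (simp add: exp_of_nat_mult[symmetric])
    also have "\<dots> \<le> \<sigma>0 ^ n" using le0(4) by (intro power_mono) auto
    finally show ?thesis using pow_le[of n] by linarith
  qed
  \<comment> \<open>The two multiples of \<open>card J\<close> are the wrong guess and the missed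
    lists; the 3 counts atypical (x, u), the covering exponential and \<theta>; the square comes
    from binning.\<close>
  define c where "c = 2 * real (card J) + 3 + (real (card J))\<^sup>2"
  have "\<exists>C. code_within n (card J) (Rc + 2 * \<delta>) (h + 2 * \<delta>) C \<and>
     (\<forall>j\<in>J. wak_error (replicate_pmf n (P j)) C \<le> c * \<sigma> ^ n)" for n
  proof -
    define M where "M = nat \<lceil>exp (n * (Rc + 2 * \<delta>))\<rceil>"
    define N where "N = nat \<lceil>exp (n * (h + 2 * \<delta>))\<rceil>"
    have MN: "M > 0" "N > 0" by (simp_all add: M_def N_def)
    have M_ge: "real M \<ge> exp (n * (Rc + 2 * \<delta>))" and N_ge: "real N \<ge> exp (n * (h + 2 * \<delta>))"
      unfolding M_def N_def by (rule real_nat_ceiling_ge)+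
    obtain t where t: "\<forall>xs. t xs \<in> S" "\<forall>Q\<in>S. (\<Sum>xs\<in>words n UNIV. (\<Prod>k<n. pmf Q (xs ! k)) * of_bool (t xs \<noteq> Q)) \<le> card S * \<rho>3 ^ n"
      using \<rho>3(3) by blast
    have b3: "(\<Sum>xs\<in>words n UNIV. (\<Prod>k<n. pmf Q (xs ! k)) * of_bool (t xs \<noteq> Q)) \<le> card J * \<sigma> ^ n" if "Q \<in> S" for Q
    proof -
      have "card S * \<rho>3 ^ n \<le> card J * \<sigma> ^ n"
        using card_image_le[OF J(1), of s] power_mono[OF le0(3), of n] \<rho>3(1) pow_le[of n] \<sigma>(1)
        by (intro mult_mono) (auto simp: S_def)
      then show ?thesis using t(2) that by force
    qed
    let ?X = "words n (UNIV :: 'x set)" and ?Y = "words n (UNIV :: 'y set)" and ?A = "words n A"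
    have fin: "finite ?X" "finite ?Y" "finite ?A" using finA by (auto intro: finite_words)
    have Yne: "?Y \<noteq> {}"
    proof -
      have "replicate n undefined \<in> ?Y" by (simp add: words_UNIV)
      then show ?thesis by blast
    qed
    have pQ: "(\<Sum>ys\<in>?Y. \<Prod>k<n. pmf (P j) (xs ! k, ys ! k)) = (\<Prod>k<n. pmf (s j) (xs ! k))" for j xs
      using sum_words_prod[where F="\<lambda>k y. pmf (P j) (xs ! k, y)" and A=UNIV and n=n]
      by (simp add: s_def pmf_marginal_X_sum)
    have Q1: "(\<Sum>xs\<in>?X. \<Prod>k<n. pmf Q (xs ! k)) = 1" for Q :: "'x pmf"
      using sum_words_prod[where F="\<lambda>k. pmf Q" and A=UNIV and n=n] by (simp add: sum_pmf_eq_1)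
    have kap1: "(\<Sum>us\<in>?A. \<Prod>k<n. pmf (K Q (xs ! k)) (us ! k)) = 1" if "Q \<in> S" for Q xs
      using sum_words_prod[where F="\<lambda>k. pmf (K Q (xs ! k))" and A=A and n=n] by (simp add: K1[OF that])
    have qn: "(\<Sum>xs\<in>?X. (\<Prod>k<n. pmf Q (xs ! k)) * (\<Prod>k<n. pmf (K Q (xs ! k)) (us ! k))) = (\<Prod>k<n. q Q (us ! k))" for Q us
      using sum_words_prod[where F="\<lambda>k x. pmf Q x * pmf (K Q x) (us ! k)" and A=UNIV and n=n]
      by (simp add: prod.distrib q_def)
    have rn: "(\<Sum>xs\<in>?X. (\<Prod>k<n. pmf (P j) (xs ! k, ys ! k)) * (\<Prod>k<n. pmf (K (s j) (xs ! k)) (us ! k))) = (\<Prod>k<n. r j (ys ! k) (us ! k))" for j ys us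
      using sum_words_prod[where F="\<lambda>k x. pmf (P j) (x, ys ! k) * pmf (K (s j) x) (us ! k)" and A=UNIV and n=n]
      by (simp add: prod.distrib r_def)
    have pos: "0 < exp (n * (Rc + \<delta>))" "0 < exp (n * (h + \<delta>))" "0 < \<sigma> ^ n" using \<sigma> by auto
    have "\<exists>(g :: 'x list \<Rightarrow> 'x pmf \<times> nat list) W f D. g \<in> ?X \<rightarrow> W \<and> finite W \<and> card W \<le> card J * M \<and> (\<forall>y. f y < N) \<and>
     (\<forall>w b. D w b \<in> ?Y) \<and>
     (\<forall>j\<in>J. (\<Sum>xs\<in>?X. \<Sum>ys\<in>?Y. (\<Prod>k<n. pmf (P j) (xs ! k, ys ! k)) * of_bool (D (g xs) (f ys) \<noteq> ys))
       \<le> card J * \<sigma> ^ n + \<sigma> ^ n + card J * (\<sigma> ^ n * \<sigma> ^ n) / \<sigma> ^ n + exp (- (M / exp (n * (Rc + \<delta>)))) + \<sigma> ^ n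
         + (real (card J))\<^sup>2 * exp (n * (h + \<delta>)) / N)"
    proof (rule one_shot[where Q="\<lambda>Q xs. \<Prod>k<n. pmf Q (xs ! k)" and \<kappa>="\<lambda>Q xs us. \<Prod>k<n. pmf (K Q (xs ! k)) (us ! k)" and cl=s and t=t and A="?A"
        and q="\<lambda>Q us. \<Prod>k<n. q Q (us ! k)" and r="\<lambda>j ys us. \<Prod>k<n. r j (ys ! k) (us ! k)", 
        OF fin J _ pQ _ _ _ _ pos MN Yne qn[symmetric] rn[symmetric]])
      show "(\<Sum>xs\<in>?X. \<Sum>us\<in>?A. (\<Prod>k<n. pmf Q (xs ! k)) * (\<Prod>k<n. pmf (K Q (xs ! k)) (us ! k)) *
         of_bool (exp (n * (Rc + \<delta>)) * (\<Prod>k<n. q Q (us ! k)) < (\<Prod>k<n. pmf (K Q (xs ! k)) (us ! k)))) \<le> \<sigma> ^ n" if "Q \<in> s ` J" for Q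
        using b1[of Q n] that by (simp add: E1_def prod.distrib S_def)
      show "(\<Sum>ys\<in>?Y. \<Sum>us\<in>?A. (\<Prod>k<n. r j (ys ! k) (us ! k)) *
         of_bool (exp (n * (h + \<delta>)) * (\<Prod>k<n. r j (ys ! k) (us ! k)) < (\<Prod>k<n. q (s j) (us ! k)))) \<le> \<sigma> ^ n * \<sigma> ^ n" if "j \<in> J" for j
        using b2[of j n] that by (simp add: E2_def)
      show "(\<Sum>xs\<in>?X. (\<Prod>k<n. pmf Q (xs ! k)) * of_bool (t xs \<noteq> Q)) \<le> card J * \<sigma> ^ n" if "Q \<in> s ` J" for Q
        using b3[of Q] that by (simp add: S_def)
      show "t xs \<in> s ` J" for xs using t(1) by (simp add: S_def)
      show "(\<Sum>us\<in>?A. \<Prod>k<n. pmf (K Q (xs ! k)) (us ! k)) = 1" if "Q \<in> s ` J" for Q xs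
        using kap1[of Q xs] that by (simp add: S_def)
      show "(\<Sum>xs\<in>?X. \<Prod>k<n. pmf Q (xs ! k)) = 1" if "Q \<in> s ` J" for Q by (rule Q1)
    qed (auto intro!: prod_nonneg)
    then obtain g :: "'x list \<Rightarrow> 'x pmf \<times> nat list" and W f D where g: "g \<in> ?X \<rightarrow> W" and W: "finite W" "card W \<le> card J * M"
      and f: "\<forall>y. f y < N" and D: "\<forall>w b. D w b \<in> ?Y" and
      err: "\<forall>j\<in>J. (\<Sum>xs\<in>?X. \<Sum>ys\<in>?Y. (\<Prod>k<n. pmf (P j) (xs ! k, ys ! k)) * of_bool (D (g xs) (f ys) \<noteq> ys))
       \<le> card J * \<sigma> ^ n + \<sigma> ^ n + card J * (\<sigma> ^ n * \<sigma> ^ n) / \<sigma> ^ n + exp (- (M / exp (n * (Rc + \<delta>)))) + \<sigma> ^ n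
         + (real (card J))\<^sup>2 * exp (n * (h + \<delta>)) / N"
      by (elim exE conjE)
    \<comment> \<open>Messages are numbers, so the pairs of marginal and codeword are numbered; the
      decoder first inverts the numbering.\<close>
    obtain b where b: "bij_betw b W {0..<card W}" using ex_bij_betw_finite_nat[OF W(1)] by blast
    define C :: "('x, 'y) wak_code" where "C = \<lparr>msgs1 = {0..<card W}, msgs2 = {..<N}, enc1 = b \<circ> g, enc2 = f, dec = (\<lambda>(i, k). D (inv_into W b i) k)\<rparr>"
    have bg: "b w \<in> {0..<card W}" "inv_into W b (b w) = w" if "w \<in> W" for w
      using b that by (auto simp: bij_betw_def)
    have code: "is_wak_code n C"
      using g f D bg(1) by (auto simp: is_wak_code_def C_def words_UNIV Pi_iff simp del: split_paired_All)
    have "W \<noteq> {}"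
    proof -
      have "replicate n undefined \<in> ?X" by (simp add: words_UNIV)
      then show ?thesis using g by blast
    qed
    then have "1 \<le> card W" using W(1) by (simp add: Suc_le_eq card_gt_0_iff)
    moreover have "wak_error (replicate_pmf n (P j)) C \<le> c * \<sigma> ^ n" if j: "j \<in> J" for j
    proof -
      have "wak_error (replicate_pmf n (P j)) C = (\<Sum>xs\<in>?X. \<Sum>ys\<in>?Y. (\<Prod>k<n. pmf (P j) (xs ! k, ys ! k)) * of_bool (D (g xs) (f ys) \<noteq> ys))"
        unfolding wak_error_replicate
      proof (rule sum.cong[OF refl], rule sum.cong[OF refl])
        fix xs ys assume "xs \<in> ?X"
        then have "g xs \<in> W" using g by blast
        then show "(\<Prod>k<n. pmf (P j) (xs ! k, ys ! k)) * of_bool (dec C (enc1 C xs, enc2 C ys) \<noteq> ys)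
          = (\<Prod>k<n. pmf (P j) (xs ! k, ys ! k)) * of_bool (D (g xs) (f ys) \<noteq> ys)"
          by (simp add: C_def bg(2))
      qed
      also note bspec[OF err j]
      also have "exp (- (M / exp (n * (Rc + \<delta>)))) \<le> \<sigma> ^ n"
      proof -
        have "real n * \<delta> \<le> exp (n * \<delta>)" using exp_ge_add_one_self[of "n * \<delta>"] by linarith
        also have "\<dots> = exp (n * (Rc + 2 * \<delta>)) / exp (n * (Rc + \<delta>))"
          by (simp add: exp_diff[symmetric] algebra_simps)
        also have "\<dots> \<le> M / exp (n * (Rc + \<delta>))" using M_ge by (intro divide_right_mono) auto
        finally have "exp (- (M / exp (n * (Rc + \<delta>)))) \<le> exp (- (n * \<delta>))" by simp
        then show ?thesis using b4[of n] by linarith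
      qed
      also have "(real (card J))\<^sup>2 * exp (n * (h + \<delta>)) / N \<le> (real (card J))\<^sup>2 * \<sigma> ^ n"
      proof -
        have "exp (n * (h + \<delta>)) / N \<le> exp (n * (h + \<delta>)) / exp (n * (h + 2 * \<delta>))"
          using N_ge MN by (intro divide_left_mono) auto
        also have "\<dots> = exp (- (n * \<delta>))" by (simp add: exp_diff[symmetric] algebra_simps)
        also have "\<dots> \<le> \<sigma> ^ n" by (rule b4)
        finally have "(real (card J))\<^sup>2 * (exp (n * (h + \<delta>)) / N) \<le> (real (card J))\<^sup>2 * \<sigma> ^ n"
          by (intro mult_left_mono) auto
        then show ?thesis by simp
      qed
      also have "card J * (\<sigma> ^ n * \<sigma> ^ n) / \<sigma> ^ n = card J * \<sigma> ^ n" using \<sigma> by simp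
      finally show ?thesis by (simp add: c_def algebra_simps)
    qed
    ultimately show ?thesis using code W(2)
      by (intro exI[of _ C]) (auto simp: C_def M_def N_def code_within_def)
  qed
  then show ?thesis using \<sigma> by (intro exI[of _ \<sigma>] exI[of _ c] conjI allI)
qed

text \<open>Rounding up at most doubles a number that is at least 1, so the excess over
  \<open>R\<close> is at most ln(2c)/n.\<close>

lemma limsup_rate_le:
  fixes a :: "nat \<Rightarrow> nat" and R :: real
  assumes R: "R \<ge> 0" and c: "c \<ge> 1" and a: "\<And>n. 1 \<le> a n" "\<And>n. a n \<le> c * nat \<lceil>exp (n * R)\<rceil>"
  shows "limsup (\<lambda>n. ereal (ln (a n) / n)) \<le> ereal R"
proof -
  have bound: "ln (a n) / n \<le> ln (2 * c) / n + R" if n: "n > 0" for n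
  proof -
    have "real (nat \<lceil>exp (n * R)\<rceil>) \<le> exp (n * R) + 1"
      using of_int_ceiling_le_add_one[of "exp (n * R)"] by simp
    also have "\<dots> \<le> 2 * exp (n * R)" using R by simp
    finally have "real c * real (nat \<lceil>exp (n * R)\<rceil>) \<le> real c * (2 * exp (n * R))"
      by (rule mult_left_mono) simp
    then have "real (a n) \<le> real c * (2 * exp (n * R))"
      using a(2)[of n] by (metis of_nat_le_iff of_nat_mult order_trans)
    then have "ln (a n) \<le> ln (real c * (2 * exp (n * R)))" using a(1)[of n] c by (subst ln_le_cancel_iff) auto
    also have "\<dots> = ln (2 * c) + n * R" using c by (simp add: ln_mult_pos)
    finally have "ln (a n) / n \<le> (ln (2 * c) + n * R) / n" by (rule divide_right_mono) simp
    then show ?thesis using n by (simp add: add_divide_distrib)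
  qed
  have "limsup (\<lambda>n. ereal (ln (a n) / n)) \<le> limsup (\<lambda>n. ereal (ln (2 * c) / n + R))"
    by (rule Limsup_mono, rule eventually_mono[OF eventually_gt_at_top[of 0]]) (use bound in auto)
  also have "\<dots> = ereal R"
  proof (rule lim_imp_Limsup)
    have "(\<lambda>n. ln (2 * c) / real n + R) \<longlonglongrightarrow> 0 + R"
      by (intro tendsto_add lim_const_over_n tendsto_const)
    then show "(\<lambda>n. ereal (ln (2 * c) / n + R)) \<longlonglongrightarrow> ereal R" by (simp add: lim_ereal)
  qed simp
  finally show ?thesis .
qed

text \<open>Sources before \<open>i\<close> are given up and cost at most their total weight; the
  errors of all others decay geometrically under one code.\<close>

lemma achievable_mixture:
  fixes P :: "nat \<Rightarrow> ('x::finite \<times> 'y::finite) pmf" and S :: "nat \<Rightarrow> ('x \<times> 'y) list pmf"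
  assumes \<nu>: "\<And>i. i \<in> {1..m} \<Longrightarrow> \<nu> i > 0" and \<nu>1: "(\<Sum>i = 1..m. \<nu> i) = 1"
    and source: "\<And>n z. pmf (S n) z = (\<Sum>i = 1..m. \<nu> i * pmf (replicate_pmf n (P i)) z)"
    and Rc: "Rc \<ge> 0" and sep: "separable m P Rc" and i: "i \<in> {1..m}" and h: "h \<ge> 0"
    and hmin: "\<And>j. j \<in> {i..m} \<Longrightarrow> hmin (P j) Rc \<le> h"
    and \<epsilon>: "(\<Sum>j = 1..<i. \<nu> j) \<le> \<epsilon>" and \<delta>: "\<delta> > 0"
  shows "wak_achievable S \<epsilon> (Rc + 2 * \<delta>, h + 2 * \<delta>)"
proof -
  have "\<forall>Q\<in>marginals_X m P. \<exists>K. test_kernel K \<and> mutual_info_XU Q K \<le> Rc \<and>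
     (\<forall>j\<in>{1..m}. marginal_X (P j) = Q \<longrightarrow> hmin (P j) Rc \<le> h \<longrightarrow> cond_entropy_YU (P j) K \<le> h)"
    using common_kernel[OF Rc sep] by blast
  from bchoice[OF this] obtain K where K: "\<forall>Q\<in>marginals_X m P. test_kernel (K Q) \<and> mutual_info_XU Q (K Q) \<le> Rc \<and>
     (\<forall>j\<in>{1..m}. marginal_X (P j) = Q \<longrightarrow> hmin (P j) Rc \<le> h \<longrightarrow> cond_entropy_YU (P j) (K Q) \<le> h)" by (rule exE)
  have mX: "marginal_X (P j) \<in> marginals_X m P" if "j \<in> {i..m}" for j
    using that i by (auto simp: marginals_X_def)
  have "\<exists>\<sigma> c :: real. 0 < \<sigma> \<and> \<sigma> < 1 \<and> (\<forall>n. \<exists>C. code_within n (card {i..m}) (Rc + 2 * \<delta>) (h + 2 * \<delta>) C \<and>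
     (\<forall>j\<in>{i..m}. wak_error (replicate_pmf n (P j)) C \<le> c * \<sigma> ^ n))"
  proof (rule achievable_codes[where K=K])
    fix j assume j: "j \<in> {i..m}"
    have j1: "j \<in> {1..m}" using j i by auto
    note k = bspec[OF K mX[OF j]]
    show "test_kernel (K (marginal_X (P j)))" using k by blast
    show "mutual_info_XU (marginal_X (P j)) (K (marginal_X (P j))) \<le> Rc" using k by blast
    show "cond_entropy_YU (P j) (K (marginal_X (P j))) \<le> h" using k j1 hmin[OF j] by blast
  qed (use i \<delta> in auto)
  then obtain \<sigma> c :: real where \<sigma>: "0 < \<sigma>" "\<sigma> < 1" and "\<forall>n. \<exists>C. code_within n (card {i..m}) (Rc + 2 * \<delta>) (h + 2 * \<delta>) C \<and>
     (\<forall>j\<in>{i..m}. wak_error (replicate_pmf n (P j)) C \<le> c * \<sigma> ^ n)" by (elim exE conjE)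
  from choice[OF this(3)] obtain C where C: "\<forall>n. code_within n (card {i..m}) (Rc + 2 * \<delta>) (h + 2 * \<delta>) (C n) \<and>
     (\<forall>j\<in>{i..m}. wak_error (replicate_pmf n (P j)) (C n) \<le> c * \<sigma> ^ n)" by (rule exE)
  have err: "wak_error (S n) (C n) \<le> (\<Sum>j = 1..<i. \<nu> j) + c * \<sigma> ^ n" for n
  proof -
    have split: "{1..m} = {1..<i} \<union> {i..m}" using i by auto
    have "wak_error (S n) (C n) = (\<Sum>j = 1..m. \<nu> j * wak_error (replicate_pmf n (P j)) (C n))"
      by (rule wak_error_mixture) (rule source)
    also have "\<dots> = (\<Sum>j = 1..<i. \<nu> j * wak_error (replicate_pmf n (P j)) (C n)) + (\<Sum>j = i..m. \<nu> j * wak_error (replicate_pmf n (P j)) (C n))"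
      unfolding split by (rule sum.union_disjoint) auto
    also have "\<dots> \<le> (\<Sum>j = 1..<i. \<nu> j * 1) + (\<Sum>j = i..m. \<nu> j * (c * \<sigma> ^ n))"
    proof (intro add_mono sum_mono mult_left_mono)
      fix j assume "j \<in> {1..<i}"
      then show "0 \<le> \<nu> j" using \<nu>[of j] i by auto
      show "wak_error (replicate_pmf n (P j)) (C n) \<le> 1" by (simp add: wak_error_def)
    next
      fix j assume j: "j \<in> {i..m}"
      then show "0 \<le> \<nu> j" using \<nu>[of j] i by auto
      show "wak_error (replicate_pmf n (P j)) (C n) \<le> c * \<sigma> ^ n" using C j by blast
    qed
    also have "(\<Sum>j = i..m. \<nu> j * (c * \<sigma> ^ n)) \<le> c * \<sigma> ^ n"
    proof -
      \<comment> \<open>The sign of \<open>c\<close> was not recorded; an error probability below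
        \<open>c * \<sigma> ^ n\<close> shows that the bound is nonnegative.\<close>
      have "0 \<le> wak_error (replicate_pmf n (P i)) (C n)" by (simp add: wak_error_def)
      also have "\<dots> \<le> c * \<sigma> ^ n" using C i by auto
      finally have "0 \<le> c * \<sigma> ^ n" .
      moreover have "(\<Sum>j = i..m. \<nu> j) \<le> (\<Sum>j = 1..m. \<nu> j)"
        using i \<nu> by (intro sum_mono2) (auto simp: less_imp_le)
      ultimately show ?thesis using \<nu>1 mult_right_mono[of "\<Sum>j = i..m. \<nu> j" 1 "c * \<sigma> ^ n"]
        by (simp add: sum_distrib_right)
    qed
    finally show ?thesis by simp
  qed
  show ?thesis
    unfolding wak_achievable_def prod.case
  proof (intro exI[of _ C] conjI)
    show "\<forall>n. is_wak_code n (C n)" using C by (auto simp: code_within_def)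
    show "limsup (\<lambda>n. ereal (ln (card (msgs1 (C n))) / n)) \<le> ereal (Rc + 2 * \<delta>)"
      by (rule limsup_rate_le[where c="card {i..m}"]) (use C Rc \<delta> i in \<open>auto simp: code_within_def\<close>)
    have pos: "nat \<lceil>exp (real n * (h + 2 * \<delta>))\<rceil> > 0" for n by simp
    show "limsup (\<lambda>n. ereal (ln (card (msgs2 (C n))) / n)) \<le> ereal (h + 2 * \<delta>)"
    proof (rule limsup_rate_le[where c=1])
      show "1 \<le> card (msgs2 (C n))" for n using C pos[of n] by (simp add: code_within_def Suc_le_eq)
      show "card (msgs2 (C n)) \<le> 1 * nat \<lceil>exp (n * (h + 2 * \<delta>))\<rceil>" for n using C by (simp add: code_within_def)
    qed (use h \<delta> in auto)
    have "limsup (\<lambda>n. ereal (wak_error (S n) (C n))) \<le> limsup (\<lambda>n. ereal ((\<Sum>j = 1..<i. \<nu> j) + c * \<sigma> ^ n))"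
      by (rule Limsup_mono, rule always_eventually) (use err in auto)
    also have "\<dots> = ereal (\<Sum>j = 1..<i. \<nu> j)"
    proof (rule lim_imp_Limsup)
      have "(\<lambda>n. (\<Sum>j = 1..<i. \<nu> j) + c * \<sigma> ^ n) \<longlonglongrightarrow> (\<Sum>j = 1..<i. \<nu> j) + c * 0"
        using \<sigma> by (intro tendsto_intros LIMSEQ_realpow_zero) auto
      then show "(\<lambda>n. ereal ((\<Sum>j = 1..<i. \<nu> j) + c * \<sigma> ^ n)) \<longlonglongrightarrow> ereal (\<Sum>j = 1..<i. \<nu> j)"
        by (simp add: lim_ereal)
    qed simp
    finally show "limsup (\<lambda>n. ereal (wak_error (S n) (C n))) \<le> ereal \<epsilon>"
      using \<epsilon> by (meson ereal_less_eq(3) order_trans)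
  qed
qed

section \<open>The converse for mixtures\<close>

lemma wak_error_bounds: "0 \<le> wak_error p C" "wak_error p C \<le> 1"
  by (simp_all add: wak_error_def)

text \<open>If the claim failed, each source up to \<open>i\<close> would have its own tolerance
  within which no code of any length is good. The least of these finitely many tolerances works for
  all of them, so the source singled out may depend on n.\<close>

lemma converse_mixture:
  fixes P :: "nat \<Rightarrow> ('x::finite \<times> 'y::finite) pmf" and S :: "nat \<Rightarrow> ('x \<times> 'y) list pmf"
  assumes \<nu>: "\<And>i. i \<in> {1..m} \<Longrightarrow> \<nu> i > 0" and \<nu>1: "(\<Sum>i = 1..m. \<nu> i) = 1"
    and source: "\<And>n z. pmf (S n) z = (\<Sum>i = 1..m. \<nu> i * pmf (replicate_pmf n (P i)) z)"
    and Rc: "Rc \<ge> 0" and i: "i \<in> {1..m}" and \<epsilon>: "\<epsilon> < (\<Sum>j = 1..i. \<nu> j)"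
    and region: "(Rc, R2) \<in> wak_region S \<epsilon>"
  shows "\<exists>j\<in>{1..i}. hmin (P j) Rc \<le> R2"
proof (rule ccontr)
  assume contr: "\<not> ?thesis"
  define good where "good j \<eta> n C \<longleftrightarrow> is_wak_code n C \<and> ln (card (msgs1 C)) / n \<le> Rc + \<eta> \<and>
      ln (card (msgs2 C)) / n \<le> R2 + \<eta> \<and> wak_error (replicate_pmf n (P j)) C < 1 \<and>
      - ln (1 - wak_error (replicate_pmf n (P j)) C) / n \<le> \<eta>" for j \<eta> n and C :: "('x, 'y) wak_code"
  have "\<exists>\<eta>>0. \<forall>n>0. \<forall>C. \<not> good j \<eta> n C" if j: "j \<in> {1..i}" for j
  proof (rule ccontr)
    assume "\<not> ?thesis"
    then have "\<exists>n>0. \<exists>C. good j \<eta> n C" if "\<eta> > 0" for \<eta> using that by blast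
    from strong_converse[OF Rc this[unfolded good_def]] have "hmin (P j) Rc \<le> R2" by simp
    then show False using contr j by blast
  qed
  then have "\<forall>j\<in>{1..i}. \<exists>\<eta>. \<eta> > 0 \<and> (\<forall>n>0. \<forall>C. \<not> good j \<eta> n C)" by blast
  from bchoice[OF this] obtain e where e: "\<forall>j\<in>{1..i}. e j > 0 \<and> (\<forall>n>0. \<forall>C. \<not> good j (e j) n C)" by (rule exE)
  define \<eta> where "\<eta> = Min (e ` {1..i})"
  have ne: "e ` {1..i} \<noteq> {}" using i by auto
  have \<eta>: "\<eta> > 0" unfolding \<eta>_def using e ne by (subst Min_gr_iff) auto
  have \<eta>_le: "\<eta> \<le> e j" if "j \<in> {1..i}" for j unfolding \<eta>_def using that by (intro Min_le) auto
  obtain R where R: "wak_achievable S \<epsilon> R" "dist R (Rc, R2) < \<eta> / 2"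
    using region \<eta> unfolding wak_region_def closure_approachable by (metis half_gt_zero mem_Collect_eq)
  obtain Rc' R2' where RR: "R = (Rc', R2')" by (cases R)
  have "\<bar>Rc' - Rc\<bar> < \<eta> / 2" "\<bar>R2' - R2\<bar> < \<eta> / 2"
    using dist_fst_le[of R "(Rc, R2)"] dist_snd_le[of R "(Rc, R2)"] R(2) by (simp_all add: RR dist_real_def)
  then have R': "Rc' < Rc + \<eta>" "R2' < R2 + \<eta>" using \<eta> by linarith+
  obtain C where C: "\<forall>n. is_wak_code n (C n)" 
    "limsup (\<lambda>n. ereal (ln (card (msgs1 (C n))) / n)) \<le> ereal Rc'"
    "limsup (\<lambda>n. ereal (ln (card (msgs2 (C n))) / n)) \<le> ereal R2'"
    "limsup (\<lambda>n. ereal (wak_error (S n) (C n))) \<le> ereal \<epsilon>"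
    using R(1) unfolding RR wak_achievable_def prod.case by (elim exE conjE)
  define s where "s = (\<Sum>j = 1..i. \<nu> j)"
  \<comment> \<open>Half the gap, so that s - \<tau> = \<epsilon> + \<tau>. Were every error up to
    \<open>i\<close> above 1 - \<tau>, the mixture would err with probability at least s(1 - \<tau>)
    \<ge> s - \<tau>.\<close>
  define \<tau> where "\<tau> = (s - \<epsilon>) / 2"
  have \<tau>: "\<tau> > 0" using \<epsilon> by (simp add: \<tau>_def s_def)
  have s1: "s \<le> 1" unfolding s_def \<nu>1[symmetric] using i \<nu> by (intro sum_mono2) (auto simp: less_imp_le)
  have "ereal Rc' < ereal (Rc + \<eta>)" "ereal R2' < ereal (R2 + \<eta>)" "ereal \<epsilon> < ereal (\<epsilon> + \<tau>)" using R' \<tau> by auto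
  note ev = Limsup_lessD[OF le_less_trans[OF C(2) this(1)]] Limsup_lessD[OF le_less_trans[OF C(3) this(2)]]
    Limsup_lessD[OF le_less_trans[OF C(4) this(3)]]
  have "(\<lambda>n. - ln \<tau> / real n) \<longlonglongrightarrow> 0" by (rule lim_const_over_n)
  then have ev4: "\<forall>\<^sub>F n in sequentially. - ln \<tau> / real n < \<eta>" using \<eta> by (rule order_tendstoD)
  have "\<forall>\<^sub>F n in sequentially. False"
    using ev ev4 eventually_gt_at_top[of 0]
  proof eventually_elim
    case (elim n)
    have "\<exists>j\<in>{1..i}. wak_error (replicate_pmf n (P j)) (C n) \<le> 1 - \<tau>"
    proof (rule ccontr)
      assume "\<not> ?thesis"
      then have gt: "wak_error (replicate_pmf n (P j)) (C n) \<ge> 1 - \<tau>" if "j \<in> {1..i}" for j using that by force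
      have "s - \<tau> \<le> s * (1 - \<tau>)" using s1 \<tau> mult_right_mono[of s 1 \<tau>] by (simp add: algebra_simps)
      also have "\<dots> \<le> (\<Sum>j = 1..i. \<nu> j * wak_error (replicate_pmf n (P j)) (C n))"
        unfolding s_def sum_distrib_right using gt \<nu> i by (intro sum_mono mult_left_mono) (auto simp: less_imp_le)
      also have "\<dots> \<le> (\<Sum>j = 1..m. \<nu> j * wak_error (replicate_pmf n (P j)) (C n))"
        using i \<nu> wak_error_bounds by (intro sum_mono2) (auto intro!: mult_nonneg_nonneg intro: less_imp_le)
      also have "\<dots> = wak_error (S n) (C n)" by (rule wak_error_mixture[symmetric]) (rule source)
      also have "\<dots> < \<epsilon> + \<tau>" using elim(3) by simp
      finally show False by (simp add: \<tau>_def field_simps)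
    qed
    then obtain j where j: "j \<in> {1..i}" "wak_error (replicate_pmf n (P j)) (C n) \<le> 1 - \<tau>" by blast
    have "ln \<tau> \<le> ln (1 - wak_error (replicate_pmf n (P j)) (C n))" using j \<tau> by (subst ln_le_cancel_iff) auto
    then have "- ln (1 - wak_error (replicate_pmf n (P j)) (C n)) / n \<le> - ln \<tau> / n" by (intro divide_right_mono) auto
    then have "- ln (1 - wak_error (replicate_pmf n (P j)) (C n)) / n \<le> e j" using elim(4) \<eta>_le[OF j(1)] by linarith
    moreover have "ln (card (msgs1 (C n))) / n \<le> Rc + e j" "ln (card (msgs2 (C n))) / n \<le> R2 + e j"
      using elim(1,2) \<eta>_le[OF j(1)] by simp_all
    ultimately have "good j (e j) n (C n)" using C(1) j \<tau> by (simp add: good_def)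
    then show False using e j(1) elim(5) by blast
  qed
  then show False by simp
qed

section \<open>Combination of achievability and converse\<close>

theorem mainTheorem7:
  fixes P :: "nat \<Rightarrow> ('x::finite \<times> 'y::finite) pmf"
    and \<nu> :: "nat \<Rightarrow> real"
    and m :: nat
    and S :: "nat \<Rightarrow> ('x \<times> 'y) list pmf"
    and Rc :: real
  assumes weights_pos: "\<And>i. i \<in> {1..m} \<Longrightarrow> \<nu> i > 0"
    and weights_sum: "(\<Sum>i = 1..m. \<nu> i) = 1"
    and source: "\<And>n z. pmf (S n) z = (\<Sum>i = 1..m. \<nu> i * pmf (replicate_pmf n (P i)) z)"
    and Rc_pos: "Rc > 0"
    and separability: "separable m P Rc"
    and increasing: "mono_on {1..m} (\<lambda>i. \<xi> (P i) Rc)"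
  shows "\<forall>\<epsilon>. 0 \<le> \<epsilon> \<and> \<epsilon> < 1 \<longrightarrow>
    (\<forall>i \<in> {1..m}. (\<Sum>j = 1..<i. \<nu> j) \<le> \<epsilon> \<and> \<epsilon> < (\<Sum>j = 1..i. \<nu> j) \<longrightarrow>
      wak_min_rate S \<epsilon> Rc = ln (real CARD('y)) - \<xi> (P i) Rc)"
proof (intro allI impI ballI)
  fix \<epsilon> i assume i: "i \<in> {1..m}" and e: "(\<Sum>j = 1..<i. \<nu> j) \<le> \<epsilon> \<and> \<epsilon> < (\<Sum>j = 1..i. \<nu> j)"
  define h where "h = hmin (P i) Rc"
  have Rc0: "Rc \<ge> 0" using Rc_pos by simp
  \<comment> \<open>Increasing \<xi> means decreasing \<open>hmin\<close>, so the sources with the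
    smallest indices are the most expensive ones and are given up first.\<close>
  have mono: "hmin (P k) Rc \<le> hmin (P j) Rc" if "j \<in> {1..m}" "k \<in> {1..m}" "j \<le> k" for j k
    using mono_onD[OF increasing that] by (simp add: xi_eq)
  obtain K where "K \<in> admissible_kernels (marginal_X (P i)) Rc" "cond_entropy_YU (P i) K = h"
    using hmin_attained(1)[OF Rc0, of "P i"] by (auto simp: h_def)
  then have h0: "h \<ge> 0" using cond_entropy_YU_nonneg[of K "P i"] by (auto simp: admissible_kernels_def)
  have "(Rc, h) \<in> wak_region S \<epsilon>"
    unfolding wak_region_def closure_approachable
  proof (intro allI impI)
    fix r :: real assume r: "r > 0"
    \<comment> \<open>Only rates slightly above the target are achieved, and the closure does the
      rest; with \<delta> = r/8 the distance is at most r/2.\<close>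
    have "wak_achievable S \<epsilon> (Rc + 2 * (r / 8), h + 2 * (r / 8))"
    proof (rule achievable_mixture[OF weights_pos weights_sum source Rc0 separability i h0])
      show "hmin (P j) Rc \<le> h" if "j \<in> {i..m}" for j unfolding h_def using that i by (intro mono) auto
    qed (use e r in auto)
    moreover have "dist (Rc + 2 * (r / 8), h + 2 * (r / 8)) (Rc, h) < r"
    proof -
      have "dist (Rc + 2 * (r / 8), h + 2 * (r / 8)) (Rc, h) \<le> r / 4 + r / 4"
        using r sqrt_sum_squares_le_sum[of "r / 4" "r / 4"] by (simp add: dist_Pair_Pair dist_real_def)
      then show ?thesis using r by simp
    qed
    ultimately show "\<exists>y\<in>{R. wak_achievable S \<epsilon> R}. dist y (Rc, h) < r" by blast
  qed
  \<comment> \<open>The converse yields some \<open>j\<close> up to \<open>i\<close>; its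
    \<open>hmin\<close> is at least that of \<open>i\<close>.\<close>
  moreover have "h \<le> R2" if R2: "(Rc, R2) \<in> wak_region S \<epsilon>" for R2
  proof -
    obtain j where "j \<in> {1..i}" "hmin (P j) Rc \<le> R2"
      using converse_mixture[OF weights_pos weights_sum source Rc0 i _ R2] e by blast
    then show ?thesis using mono[of j i] i by (auto simp: h_def)
  qed
  ultimately have "wak_min_rate S \<epsilon> Rc = h"
    unfolding wak_min_rate_def by (intro cInf_eq_minimum) auto
  then show "wak_min_rate S \<epsilon> Rc = ln (real CARD('y)) - \<xi> (P i) Rc"
    by (simp add: xi_eq h_def)
qed

end
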